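(* There is a positive constant $a$ such that, with probability $1$, for all $n$ large enough $$\mathcal{D}\big(n-a\sqrt{\log(n)}\big)\subset A(n)\subset \mathcal{D}\big(n+a\sqrt{\log(n)}\big).$$
   Context: The comb lattice $\mathcal{C}$ is the graph with vertex set $\mathbb{Z}^2$ in which $(x,y)$ and $(x',y')$ are neighbors if either $x=x'$ and $|y-y'|=1$, or $y=y'=0$ and $|x-x'|=1$. The simple random walk on $\mathcal{C}$ jumps at each step to a uniformly chosen neighbor. Internal DLA on $\mathcal{C}$ is the Markov chain on finite subsets of $\mathbb{Z}^2$ started from the empty set and growing as follows: given the current cluster $A$, launch an (independent) simple random walk on $\mathcal{C}$ from the origin $0=(0,0)$ (an "explorer"), stop it at the first site $z\notin A$ that it visits (possibly at time $0$), and let the new cluster be $A\cup\{z\}$. For real $\rho$, $\mathcal{D}(\rho)=\{(x,y)\in\mathbb{Z}^2:\ |x|<\rho,\ |y|<\frac13(\rho-|x|)^2\}$. For an integer $n$, $d(n)=|\mathcal{D}(n)|$ is the number of sites of $\mathcal{D}(n)$, and $A(n)$ is the internal DLA cluster obtained after sending $d(n)$ explorers from the origin. *)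

theory Defs
  imports "HOL-Probability.Probability"
begin

definition comb_adj :: "int \<times> int \<Rightarrow> int \<times> int \<Rightarrow> bool" where
  "comb_adj v w \<longleftrightarrow>
     (fst v = fst w \<and> \<bar>snd v - snd w\<bar> = 1) \<or>
     (snd v = 0 \<and> snd w = 0 \<and> \<bar>fst v - fst w\<bar> = 1)"

definition comb_nbrs :: "int \<times> int \<Rightarrow> (int \<times> int) set" where
  "comb_nbrs v = {w. comb_adj v w}"

lemma finite_comb_nbrs: "finite (comb_nbrs v)"
proof (rule finite_subset)
  show "comb_nbrs v \<subseteq> {fst v - 1..fst v + 1} \<times> {snd v - 1..snd v + 1}"
    by (auto simp: comb_nbrs_def comb_adj_def)
qed simp

lemma comb_nbrs_nonempty: "comb_nbrs v \<noteq> {}"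
proof -
  have "(fst v, snd v + 1) \<in> comb_nbrs v"
    by (simp add: comb_nbrs_def comb_adj_def)
  then show ?thesis by blast
qed

definition srw_step :: "int \<times> int \<Rightarrow> (int \<times> int) pmf" where
  "srw_step v = pmf_of_set (comb_nbrs v)"

lemma pmf_srw_step:
  "pmf (srw_step v) w = (if comb_adj v w then 1 / real (card (comb_nbrs v)) else 0)"
  by (simp add: srw_step_def pmf_of_set finite_comb_nbrs comb_nbrs_nonempty indicator_def)
     (simp add: comb_nbrs_def)

text \<open>The law of the position at time \<open>t\<close>, given the positions \<open>w 0, \<dots>, w (t - 1)\<close>.\<close>

definition srw_kernel :: "nat \<Rightarrow> (nat \<Rightarrow> int \<times> int) \<Rightarrow> (int \<times> int) measure" where
  "srw_kernel t w = measure_pmf (if t = 0 then return_pmf (0, 0) else srw_step (w (t - 1)))"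

interpretation srw: Ionescu_Tulcea srw_kernel "\<lambda>_. count_space UNIV"
proof (rule Ionescu_Tulcea.intro)
  show "srw_kernel i \<in> measurable (PiM {0..<i} (\<lambda>_. count_space UNIV))
          (subprob_algebra (count_space UNIV))" for i
  proof (cases "i = 0")
    case True
    then show ?thesis
      by (simp add: srw_kernel_def[abs_def] measure_pmf_in_subprob_algebra)
  next
    case False
    have "(\<lambda>w. w (i - 1)) \<in> measurable (PiM {0..<i} (\<lambda>_. count_space (UNIV :: (int \<times> int) set)))
            (count_space UNIV)"
      using False by (intro measurable_component_singleton) auto
    moreover have "(\<lambda>v. measure_pmf (srw_step v)) \<in>
        measurable (count_space UNIV) (subprob_algebra (count_space UNIV))"
      by (rule measurable_count_space_eq1[THEN iffD2]) (auto intro: measure_pmf_in_subprob_algebra)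
    ultimately have "(\<lambda>w. measure_pmf (srw_step (w (i - 1)))) \<in>
        measurable (PiM {0..<i} (\<lambda>_. count_space UNIV)) (subprob_algebra (count_space UNIV))"
      by (rule measurable_compose)
    with False show ?thesis
      by (simp add: srw_kernel_def[abs_def])
  qed
  show "prob_space (srw_kernel i x)" for i x
    by (simp add: srw_kernel_def prob_space_measure_pmf)
qed

text \<open>The law of a whole trajectory of the walk started at the origin, a measure on path space.
  Lemma \<open>srw_law_path\<close> below identifies its finite-dimensional marginals.\<close>

definition srw_law :: "(nat \<Rightarrow> int \<times> int) measure" where
  "srw_law = srw.PF.lim"

lemma prob_space_srw_law: "prob_space srw_law"
proof -
  have "emeasure srw.PF.lim (srw.PF.emb UNIV {} {\<lambda>_. undefined}) = emeasure (srw.CI {}) {\<lambda>_. undefined}"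
    by (rule srw.lim) (auto simp: PiM_empty)
  moreover have "emeasure (srw.CI {}) {\<lambda>_. undefined} = 1"
    using prob_space.emeasure_space_1[OF srw.PF.prob_space_P, of "{}"]
    by (simp add: srw.CI_def space_PiM)
  moreover have "srw.PF.emb UNIV {} {\<lambda>_. undefined} = space srw.PF.lim"
    by (auto simp: srw.PF.space_lim prod_emb_def space_PiM restrict_def)
  ultimately show ?thesis
    unfolding srw_law_def by (intro prob_spaceI) simp
qed

lemma emeasure_srw_C:
  "emeasure (srw.C 0 n (\<lambda>_. undefined)) {restrict x {0..<n}} =
     (\<Prod>i<n. ennreal (pmf (if i = 0 then return_pmf (0, 0) else srw_step (x (i - 1))) (x i)))"
proof (induction n)
  case 0
  have "restrict x {} = (\<lambda>_. undefined)" by (auto simp: restrict_def)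
  then show ?case by (simp add: PiM_empty)
next
  case (Suc n)
  let ?M = "\<lambda>_ :: nat. count_space (UNIV :: (int \<times> int) set)"
  let ?p = "pmf (if n = 0 then return_pmf (0, 0) else srw_step (x (n - 1))) (x n)"
  have sing: "{restrict x {0..<k}} \<in> sets (PiM {0..<k} ?M)" for k
  proof -
    have "{restrict x {0..<k}} = PiE {0..<k} (\<lambda>i. {x i})"
      by (auto simp: PiE_iff extensional_def restrict_def fun_eq_iff)
    then show ?thesis by (auto intro!: sets_PiM_I_finite)
  qed
  have und: "(\<lambda>_. undefined) \<in> space (PiM {0..<0} ?M)" by (simp add: space_PiM)
  have eP: "emeasure (srw.eP n w) {restrict x {0..<Suc n}} =
      ennreal ?p * indicator {restrict x {0..<n}} w" if w: "w \<in> space (PiM {0..<n} ?M)" for w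
  proof (cases "w = restrict x {0..<n}")
    case True
    have "(w(n := z) = restrict x {0..<Suc n}) \<longleftrightarrow> z = x n" for z
      unfolding True by (auto simp: fun_eq_iff restrict_def)
    then have "fun_upd w n -` {restrict x {0..<Suc n}} = {x n}" by auto
    then show ?thesis
      unfolding srw.emeasure_eP[OF w sing] srw_kernel_def using True
      by (cases n) (simp_all add: emeasure_pmf_single)
  next
    case False
    have "w(n := z) \<noteq> restrict x {0..<Suc n}" for z
    proof
      assume eq: "w(n := z) = restrict x {0..<Suc n}"
      have "w i = restrict x {0..<n} i" for i
      proof (cases "i < n")
        case True
        then show ?thesis using fun_cong[OF eq, of i] by simp
      next
        case False
        then show ?thesis using w by (auto simp: space_PiM PiE_iff extensional_def)
      qed
      with \<open>w \<noteq> restrict x {0..<n}\<close> show False by blast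
    qed
    then have e: "fun_upd w n -` {restrict x {0..<Suc n}} = {}" by auto
    show ?thesis
      unfolding srw.emeasure_eP[OF w sing] e using False by simp
  qed
  have "emeasure (srw.C 0 (Suc n) (\<lambda>_. undefined)) {restrict x {0..<Suc n}} =
      (\<integral>\<^sup>+w. emeasure (srw.eP n w) {restrict x {0..<Suc n}} \<partial>srw.C 0 n (\<lambda>_. undefined))"
    unfolding srw.C.simps add_0
  proof (rule emeasure_bind)
    show "space (srw.C 0 n (\<lambda>_. undefined)) \<noteq> {}"
      by (rule prob_space.not_empty[OF srw.prob_space_C[OF und]])
    show "srw.eP n \<in> measurable (srw.C 0 n (\<lambda>_. undefined)) (subprob_algebra (PiM {0..<Suc n} ?M))"
      using srw.measurable_eP[of n]
        measurable_cong_sets[OF srw.sets_C[OF und, of n, unfolded add_0] refl]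
      by blast
  qed (rule sing)
  also have "\<dots> = (\<integral>\<^sup>+w. ennreal ?p * indicator {restrict x {0..<n}} w \<partial>srw.C 0 n (\<lambda>_. undefined))"
    using srw.space_C[OF und, of n] by (intro nn_integral_cong eP) simp
  also have "\<dots> = ennreal ?p * emeasure (srw.C 0 n (\<lambda>_. undefined)) {restrict x {0..<n}}"
    using sing[of n] srw.sets_C[OF und, of n] by (intro nn_integral_cmult_indicator) simp
  finally show ?case
    by (simp only: Suc.IH prod.lessThan_Suc mult.commute)
qed

lemma srw_law_path:
  "measure srw_law {w. \<forall>i\<le>t. w i = x i} =
     (if x 0 = (0, 0) then 1 else 0) * (\<Prod>i<t. pmf (srw_step (x i)) (x (Suc i)))"
proof -
  let ?M = "\<lambda>_ :: nat. count_space (UNIV :: (int \<times> int) set)"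
  let ?J = "{0..<Suc t}"
  have pe: "{restrict x ?J} = PiE ?J (\<lambda>i. {x i})"
    by (auto simp: PiE_iff extensional_def restrict_def fun_eq_iff)
  have sing: "{restrict x ?J} \<in> sets (PiM ?J ?M)"
    unfolding pe by (auto intro!: sets_PiM_I_finite)
  have emb: "srw.PF.emb UNIV ?J {restrict x ?J} = {w. \<forall>i\<le>t. w i = x i}"
  proof -
    have "restrict w ?J = restrict x ?J \<longleftrightarrow> (\<forall>i\<le>t. w i = x i)" for w :: "nat \<Rightarrow> int \<times> int"
    proof
      assume e: "restrict w ?J = restrict x ?J"
      show "\<forall>i\<le>t. w i = x i"
      proof (intro allI impI)
        fix i assume "i \<le> t"
        then show "w i = x i" using fun_cong[OF e, of i] by simp
      qed
    qed (auto intro!: restrict_ext)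
    then show ?thesis by (auto simp: prod_emb_def space_PiM)
  qed
  have emb2: "srw.PF.emb ?J ?J {restrict x ?J} = {restrict x ?J}"
    by (auto simp: prod_emb_def PiE_iff space_PiM extensional_restrict)
  have "emeasure srw_law {w. \<forall>i\<le>t. w i = x i} = emeasure (srw.CI ?J) {restrict x ?J}"
    unfolding srw_law_def emb[symmetric] by (rule srw.lim) (use sing in auto)
  also have "\<dots> = emeasure (srw.C 0 (Suc t) (\<lambda>_. undefined)) {restrict x ?J}"
    using srw.emeasure_CI[of ?J "Suc t" "{restrict x ?J}"] sing emb2 by simp
  also have "\<dots> = (\<Prod>i<Suc t. ennreal (pmf (if i = 0 then return_pmf (0, 0) else srw_step (x (i - 1))) (x i)))"
    by (rule emeasure_srw_C)
  also have "\<dots> = ennreal (\<Prod>i<Suc t. pmf (if i = 0 then return_pmf (0, 0) else srw_step (x (i - 1))) (x i))"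
    by (rule prod_ennreal) simp
  also have "(\<Prod>i<Suc t. pmf (if i = 0 then return_pmf (0, 0) else srw_step (x (i - 1))) (x i)) =
      (if x 0 = (0, 0) then 1 else 0) * (\<Prod>i<t. pmf (srw_step (x i)) (x (Suc i)))"
    by (subst prod.lessThan_Suc_shift) (simp add: indicator_def)
  finally show ?thesis
    by (simp add: measure_def prod_nonneg)
qed

text \<open>The joint law of the independent explorers; \<open>\<omega> k t\<close> is the position of the \<open>k\<close>-th explorer
  at time \<open>t\<close>.\<close>

definition explorers_law :: "(nat \<Rightarrow> nat \<Rightarrow> int \<times> int) measure" where
  "explorers_law = PiM UNIV (\<lambda>k. srw_law)"

lemma prob_space_explorers_law: "prob_space explorers_law"
  unfolding explorers_law_def by (intro prob_space_PiM prob_space_srw_law)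

definition first_outside :: "(int \<times> int) set \<Rightarrow> (nat \<Rightarrow> int \<times> int) \<Rightarrow> int \<times> int" where
  "first_outside A w = w (LEAST t. w t \<notin> A)"

text \<open>On the null event that an explorer never leaves the current cluster, \<open>first_outside\<close> is a
  site of the cluster, and so the cluster does not change.\<close>

primrec idla :: "(nat \<Rightarrow> nat \<Rightarrow> int \<times> int) \<Rightarrow> nat \<Rightarrow> (int \<times> int) set" where
  "idla \<omega> 0 = {}"
| "idla \<omega> (Suc k) = idla \<omega> k \<union> {first_outside (idla \<omega> k) (\<omega> k)}"

definition \<D> :: "real \<Rightarrow> (int \<times> int) set" where
  "\<D> \<rho> = {(x, y). \<bar>real_of_int x\<bar> < \<rho> \<and>
                  \<bar>real_of_int y\<bar> < 1 / 3 * (\<rho> - \<bar>real_of_int x\<bar>)\<^sup>2}"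

lemma finite_\<D>: "finite (\<D> \<rho>)"
proof (rule finite_subset)
  let ?r = "\<lceil>\<rho>\<rceil>" and ?s = "\<lceil>1 / 3 * \<rho>\<^sup>2\<rceil>"
  show "\<D> \<rho> \<subseteq> {- ?r..?r} \<times> {- ?s..?s}"
  proof
    fix v assume "v \<in> \<D> \<rho>"
    then obtain x y where v: "v = (x, y)" and x: "\<bar>real_of_int x\<bar> < \<rho>"
      and y: "\<bar>real_of_int y\<bar> < 1 / 3 * (\<rho> - \<bar>real_of_int x\<bar>)\<^sup>2"
      by (auto simp: \<D>_def)
    have "(\<rho> - \<bar>real_of_int x\<bar>)\<^sup>2 \<le> \<rho>\<^sup>2"
      using x by (intro power_mono) auto
    with y have "\<bar>real_of_int y\<bar> \<le> 1 / 3 * \<rho>\<^sup>2" by linarith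
    with x v show "v \<in> {- ?r..?r} \<times> {- ?s..?s}"
      by simp linarith
  qed
qed simp

definition num_sites :: "nat \<Rightarrow> nat" where
  "num_sites n = card (\<D> (real n))"

definition idla_cluster :: "(nat \<Rightarrow> nat \<Rightarrow> int \<times> int) \<Rightarrow> nat \<Rightarrow> (int \<times> int) set" where
  "idla_cluster \<omega> n = idla \<omega> (num_sites n)"

end

theory Submission imports Defs "HOL-Real_Asymp.Real_Asymp"
begin

text \<open>
  The comb carries a large supply of harmonic functions. For an arbitrary function \<open>p\<close> on the backbone and
  an arbitrary slope \<open>c\<close> on each tooth,
  \<open>F (x, y) = p x + c x * y - \<bar>y\<bar> * (p (x + 1) + p (x - 1) - 2 * p x) / 2\<close> is harmonic
  (\<open>nbr_mean_comb_harmonic\<close>). Moreover \<open>\<D> \<rho>\<close> is a quadrature domain up to small errors: because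
  \<open>h = (\<rho> - \<bar>x\<bar>)\<^sup>2 / 3\<close> solves \<open>2 * h = (h\<^sup>2)'' / 2\<close> away from \<open>0\<close>, summation by parts shows that
  the sum of \<open>F\<close> over \<open>\<D> \<rho>\<close> is close to \<open>4 / 9 * \<rho> ^ 3 * F (0, 0)\<close> (\<open>comb_quadrature\<close>),
  and \<open>4 / 9 * \<rho> ^ 3\<close> is the number of sites up to \<open>O(\<rho>)\<close>.

  Probability enters through one inequality. If, given the cluster \<open>A\<close>, the function \<open>\<Psi> A\<close> is nonnegative,
  superharmonic on a finite set \<open>S A\<close> and at most \<open>1\<close> at the origin, then the product over the explorers of
  \<open>\<Psi> A\<close> at the exit point from \<open>S A\<close> has expectation at most \<open>1\<close>
  (\<open>expectation_explorer_product\<close>), so by Markov's inequality it exceeds \<open>exp (4 * s\<^sup>2) = n ^ 4\<close> with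
  probability at most \<open>1 / n ^ 4\<close>, where \<open>s = sqrt (ln n)\<close>. With \<open>\<Psi> = 1 \<plusminus> s * (F - F (0, 0))\<close>
  the logarithm of the product is the deviation of the sum of \<open>F\<close> over the exit points from its mean, up to
  a quadratic term that the sum of \<open>F\<^sup>2\<close> controls; all these sums are bounded. This turns deviations of order
  \<open>s\<close> into events of probability \<open>1 / n ^ 4\<close>, whence the \<open>sqrt (ln n)\<close> of the theorem.

  Inner bound. For a site just outside the tip of a tooth, choose \<open>F\<close> as an approximate Green function of
  \<open>\<D> \<rho>\<close>, \<open>\<rho> = n - O(s)\<close>, with pole at that site: \<open>F \<le> 0\<close> on the rest of the outer boundary
  (\<open>F_exit\<close>). If the site were missed, the exit points would be distinct sites of \<open>\<D> \<rho>\<close> together with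
  boundary points where \<open>F \<le> 0\<close>, and quadrature makes the sum of \<open>F\<close> too small (\<open>tip_reached\<close>).
  A cluster is a subtree of the comb, so the tips of the teeth carry the whole of \<open>\<D>\<close>
  (\<open>inner_bound\<close>).

  Outer bound. Choose \<open>F \<ge> 0\<close> growing towards a tooth of a slightly larger region. The cluster contains
  \<open>\<D> (n - O(s))\<close>, which uses up almost all of the mean, so the sum of \<open>F\<close> over the remaining sites is
  \<open>O(s)\<close> (\<open>outer_excess\<close>). A tooth reaching the boundary of the region would contribute a larger
  multiple of \<open>s\<close> (\<open>tip_excess\<close>, \<open>far_tip_excess\<close>), which is impossible. For these estimates the walks
  are stopped when they leave the region (\<open>frozen_idla\<close>); once the cluster is known to lie within it, nothing
  was changed (\<open>idla_eq_frozen_within\<close>). The same sum shows that only \<open>O(s ^ 3)\<close> sites have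
  \<open>\<bar>x\<bar> \<ge> n + O(s)\<close> (\<open>count_excess\<close>).

  It remains to prevent a long thin finger along the backbone. Few sites mean short teeth, and short teeth swallow
  the explorers that walk past them: if at most \<open>N\<close> sites lie beyond \<open>X\<close>, then at most \<open>N / 8\<close> lie
  beyond \<open>X + w\<close>, where \<open>w = O(N powr (1 / 3))\<close> as long as \<open>N \<ge> s\<^sup>2\<close> and only somewhat larger
  for smaller \<open>N\<close> (\<open>halving_step\<close>, \<open>halving_cube\<close>). Iteration leaves \<open>O(s)\<close> sites beyond \<open>n + O(s)\<close> (\<open>few_sites_far_right\<close>), and these reach only \<open>O(s)\<close> further.
  Summing over \<open>O(n)\<close> choices of the tooth gives a failure probability \<open>O(1 / n ^ 3)\<close>
  (\<open>finite_clusters_at_scale\<close>), and Borel--Cantelli finishes the proof.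
\<close>

section \<open>The simple random walk on the comb\<close>

definition nbr_mean :: "(int \<times> int \<Rightarrow> real) \<Rightarrow> int \<times> int \<Rightarrow> real" where
  "nbr_mean H v = (\<Sum>w\<in>comb_nbrs v. H w) / real (card (comb_nbrs v))"

text \<open>
  Every point at which a walk from the origin can leave \<open>S\<close>; the origin itself is included because a walk
  may leave at time \<open>0\<close>.
\<close>

definition comb_closure :: "(int \<times> int) set \<Rightarrow> (int \<times> int) set" where
  "comb_closure S = insert (0, 0) (S \<union> (\<Union>v\<in>S. comb_nbrs v))"

definition stays :: "(int \<times> int) set \<Rightarrow> nat \<Rightarrow> (nat \<Rightarrow> int \<times> int) set" where
  "stays S t = {w. \<forall>i\<le>t. w i \<in> S}"

text \<open>
  The almost sure properties of a trajectory on which the deterministic arguments about clusters rely.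
\<close>

definition proper_path :: "(nat \<Rightarrow> int \<times> int) \<Rightarrow> bool" where
  "proper_path w \<longleftrightarrow> w 0 = (0, 0) \<and> (\<forall>t. comb_adj (w t) (w (Suc t))) \<and>
     (\<forall>S. finite S \<longrightarrow> (\<exists>t. w t \<notin> S))"

lemma comb_nbrs_eq:
  "comb_nbrs (x, y) = (if y = 0 then {(x + 1, 0), (x - 1, 0), (x, 1), (x, -1)}
                       else {(x, y + 1), (x, y - 1)})"
  by (auto simp: comb_nbrs_def comb_adj_def)

lemma nbr_mean_backbone:
  "nbr_mean H (x, 0) = (H (x + 1, 0) + H (x - 1, 0) + H (x, 1) + H (x, -1)) / 4"
  unfolding nbr_mean_def comb_nbrs_eq by simp

lemma nbr_mean_tooth:
  "y \<noteq> 0 \<Longrightarrow> nbr_mean H (x, y) = (H (x, y + 1) + H (x, y - 1)) / 2"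
  unfolding nbr_mean_def comb_nbrs_eq by simp

lemma nbr_mean_cong:
  assumes "\<And>w. w \<in> comb_nbrs v \<Longrightarrow> H w = H' w"
  shows "nbr_mean H v = nbr_mean H' v"
  unfolding nbr_mean_def using assms by simp

lemma nbr_mean_pmf:
  assumes "finite V" "{v. H v \<noteq> 0} \<subseteq> V"
  shows "(\<Sum>v\<in>V. H v * pmf (srw_step u) v) = nbr_mean H u"
proof -
  have "(\<Sum>v\<in>V. H v * pmf (srw_step u) v) =
      (\<Sum>v\<in>V. if v \<in> comb_nbrs u then H v / real (card (comb_nbrs u)) else 0)"
    by (intro sum.cong) (auto simp: pmf_srw_step comb_nbrs_def)
  also have "\<dots> = (\<Sum>v\<in>V \<inter> comb_nbrs u. H v / real (card (comb_nbrs u)))"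
    using assms(1) by (simp add: sum.inter_restrict)
  also have "\<dots> = (\<Sum>v\<in>comb_nbrs u. H v / real (card (comb_nbrs u)))"
    using assms(2) by (intro sum.mono_neutral_left) (auto simp: finite_comb_nbrs)
  finally show ?thesis by (simp add: nbr_mean_def sum_divide_distrib)
qed

lemma sets_srw_law [measurable_cong]:
  "sets srw_law = sets (PiM UNIV (\<lambda>_::nat. count_space (UNIV :: (int \<times> int) set)))"
  unfolding srw_law_def by (rule srw.PF.sets_lim)

lemma space_srw_law [simp]: "space srw_law = UNIV"
  using sets_eq_imp_space_eq[OF sets_srw_law] by (simp add: space_PiM)

lemma measurable_position [measurable]: "(\<lambda>w. w t) \<in> measurable srw_law (count_space UNIV)"
  by measurable

interpretation SL: prob_space srw_law by (rule prob_space_srw_law)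

lemma sets_cylinder [measurable]: "{w. \<forall>i\<le>t. w i = x i} \<in> sets srw_law"
proof -
  have "{w \<in> space srw_law. \<forall>i\<le>t. w i = x i} \<in> sets srw_law" by measurable
  then show ?thesis by simp
qed

lemma sets_stays [measurable]: "stays S t \<in> sets srw_law"
proof -
  have "{w \<in> space srw_law. \<forall>i\<le>t. w i \<in> S} \<in> sets srw_law" by measurable
  then show ?thesis by (simp add: stays_def)
qed

lemma cylinder_Suc:
  "measure srw_law {w. (\<forall>i\<le>t. w i = x i) \<and> w (Suc t) = v} =
   measure srw_law {w. \<forall>i\<le>t. w i = x i} * pmf (srw_step (x t)) v"
proof -
  have "{w. (\<forall>i\<le>t. w i = x i) \<and> w (Suc t) = v} = {w. \<forall>i\<le>Suc t. w i = (x(Suc t := v)) i}"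
    by (auto simp: le_Suc_eq)
  then show ?thesis
    by (simp only: srw_law_path) (simp add: prod.lessThan_Suc)
qed

text \<open>
  A path that has stayed in a finite set follows one of finitely many initial segments, so integrals over
  the event \<open>stays S t\<close> are finite sums over cylinders.
\<close>

lemma stays_sum:
  assumes "finite S"
  shows "indicator (stays S t) w * (f w :: real) =
    (\<Sum>x\<in>PiE {..t} (\<lambda>_. S). indicator {w. \<forall>i\<le>t. w i = x i} w * f w)"
proof (cases "w \<in> stays S t")
  case True
  let ?r = "restrict w {..t}"
  have r: "?r \<in> PiE {..t} (\<lambda>_. S)" using True by (auto simp: stays_def)
  have z: "indicator {w. \<forall>i\<le>t. w i = x i} w * f w = (if x = ?r then f w else 0)"
    if "x \<in> PiE {..t} (\<lambda>_. S)" for x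
  proof -
    have "(\<forall>i\<le>t. w i = x i) \<longleftrightarrow> x = ?r"
      using that by (auto simp: fun_eq_iff PiE_iff extensional_def restrict_def)
    then show ?thesis by (simp add: indicator_def)
  qed
  show ?thesis using True r z assms by (simp add: finite_PiE sum.delta cong: sum.cong)
next
  case False
  have "indicator {w. \<forall>i\<le>t. w i = x i} w * f w = 0" if "x \<in> PiE {..t} (\<lambda>_. S)" for x
    using False that by (auto simp: stays_def indicator_def PiE_iff)
  then have "(\<Sum>x\<in>PiE {..t} (\<lambda>_. S). indicator {w. \<forall>i\<le>t. w i = x i} w * f w) = 0"
    by (intro sum.neutral) blast
  then show ?thesis using False by simp
qed

lemma finite_support_sum:
  assumes "finite V" "{v. H v \<noteq> (0::real)} \<subseteq> V"
  shows "H u = (\<Sum>v\<in>V. H v * indicator {v} u)"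
proof -
  have "(\<Sum>v\<in>V. H v * indicator {v} u) = (\<Sum>v\<in>V. if v = u then H u else 0)"
    by (intro sum.cong) (auto simp: indicator_def)
  also have "\<dots> = H u" using assms by (auto simp: sum.delta)
  finally show ?thesis ..
qed

text \<open>
  The Markov property, from the probabilities of cylinders: on the event that the walk has not yet left
  \<open>S\<close>, the next step averages over the neighbours.
\<close>

lemma markov_step:
  assumes S: "finite S" and H: "finite {v. H v \<noteq> 0}"
  shows "(\<integral>w. indicator (stays S t) w * H (w (Suc t)) \<partial>srw_law) =
         (\<integral>w. indicator (stays S t) w * nbr_mean H (w t) \<partial>srw_law)"
proof -
  let ?P = "PiE {..t} (\<lambda>_. S)" and ?V = "{v. H v \<noteq> 0}"
  let ?C = "\<lambda>x. {w. \<forall>i\<le>t. w i = x i}"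
  let ?Cv = "\<lambda>x v. {w. (\<forall>i\<le>t. w i = x i) \<and> w (Suc t) = v}"
  have mCv: "?Cv x v \<in> sets srw_law" for x v
  proof -
    have "{w \<in> space srw_law. (\<forall>i\<le>t. w i = x i) \<and> w (Suc t) = v} \<in> sets srw_law" by measurable
    then show ?thesis by simp
  qed
  have "(\<integral>w. indicator (stays S t) w * H (w (Suc t)) \<partial>srw_law) =
      (\<integral>w. (\<Sum>x\<in>?P. \<Sum>v\<in>?V. H v * indicator (?Cv x v) w) \<partial>srw_law)"
  proof (intro Bochner_Integration.integral_cong refl)
    fix w
    have "indicator (?C x) w * H (w (Suc t)) = (\<Sum>v\<in>?V. H v * indicator (?Cv x v) w)" for x
      unfolding finite_support_sum[OF H subset_refl, of "w (Suc t)"] sum_distrib_left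
      by (intro sum.cong refl) (auto simp: indicator_def)
    then show "indicator (stays S t) w * H (w (Suc t)) =
        (\<Sum>x\<in>?P. \<Sum>v\<in>?V. H v * indicator (?Cv x v) w)"
      by (simp only: stays_sum[OF S, where f = "\<lambda>w. H (w (Suc t))"])
  qed
  also have "\<dots> = (\<Sum>x\<in>?P. \<Sum>v\<in>?V. H v * measure srw_law (?Cv x v))"
    using mCv by (simp add: Bochner_Integration.integral_sum SL.emeasure_eq_measure)
  also have "\<dots> = (\<Sum>x\<in>?P. nbr_mean H (x t) * measure srw_law (?C x))"
  proof (intro sum.cong refl)
    fix x
    have "(\<Sum>v\<in>?V. H v * measure srw_law (?Cv x v)) =
        (\<Sum>v\<in>?V. H v * pmf (srw_step (x t)) v) * measure srw_law (?C x)"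
      by (simp add: cylinder_Suc sum_distrib_left mult.assoc mult.commute)
    then show "(\<Sum>v\<in>?V. H v * measure srw_law (?Cv x v)) = nbr_mean H (x t) * measure srw_law (?C x)"
      by (simp add: nbr_mean_pmf[OF H subset_refl])
  qed
  also have "\<dots> = (\<integral>w. (\<Sum>x\<in>?P. nbr_mean H (x t) * indicator (?C x) w) \<partial>srw_law)"
    by (simp add: Bochner_Integration.integral_sum SL.emeasure_eq_measure)
  also have "\<dots> = (\<integral>w. indicator (stays S t) w * nbr_mean H (w t) \<partial>srw_law)"
  proof (intro Bochner_Integration.integral_cong refl)
    fix w
    have "nbr_mean H (x t) * indicator (?C x) w = indicator (?C x) w * nbr_mean H (w t)" for x
      by (auto simp: indicator_def)
    then show "(\<Sum>x\<in>?P. nbr_mean H (x t) * indicator (?C x) w) =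
        indicator (stays S t) w * nbr_mean H (w t)"
      by (simp only: stays_sum[OF S, where f = "\<lambda>w. nbr_mean H (w t)"])
  qed
  finally show ?thesis .
qed

lemma measurable_first_outside [measurable]:
  "first_outside S \<in> measurable srw_law (count_space UNIV)"
proof -
  have [measurable]: "(\<lambda>w. LEAST t. w t \<notin> S) \<in> measurable srw_law (count_space UNIV)"
    by measurable
  have "(\<lambda>w. w (LEAST t. w t \<notin> S)) \<in> measurable srw_law (count_space UNIV)"
    by (rule measurable_compose_countable) measurable
  then show ?thesis by (simp add: first_outside_def[abs_def])
qed

definition stopped :: "(int \<times> int) set \<Rightarrow> (nat \<Rightarrow> int \<times> int) \<Rightarrow> nat \<Rightarrow> int \<times> int" where
  "stopped S w t = (if w \<in> stays S t then w t else first_outside S w)"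

lemma stopped_0: "stopped S w 0 = w 0"
proof (cases "w 0 \<in> S")
  case False
  then have "(LEAST t. w t \<notin> S) = 0" by (intro Least_equality) auto
  then show ?thesis by (simp add: stopped_def first_outside_def)
qed (simp add: stopped_def stays_def)

lemma stopped_Suc:
  "stopped S w (Suc t) = (if w \<in> stays S t then w (Suc t) else stopped S w t)"
proof (cases "w \<in> stays S t")
  case True
  show ?thesis
  proof (cases "w (Suc t) \<in> S")
    case False
    have "(LEAST t. w t \<notin> S) = Suc t"
    proof (rule Least_equality)
      show "w (Suc t) \<notin> S" by (rule False)
      show "Suc t \<le> y" if "w y \<notin> S" for y
        using True that by (auto simp: stays_def not_less_eq_eq[symmetric])
    qed
    with True False show ?thesis by (auto simp: stopped_def first_outside_def stays_def)
  qed (use True in \<open>auto simp: stopped_def stays_def le_Suc_eq\<close>)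
next
  case False
  then have "w \<notin> stays S (Suc t)" unfolding stays_def using le_Suc_eq by blast
  with False show ?thesis by (simp add: stopped_def)
qed

lemma measurable_stopped [measurable]:
  "(\<lambda>w. stopped S w t) \<in> measurable srw_law (count_space UNIV)"
  unfolding stopped_def by measurable

lemma srw_start: "AE w in srw_law. w 0 = (0, 0)"
proof -
  have m: "{w. w 0 = (0, 0)} \<in> sets srw_law"
    using sets_cylinder[of 0 "\<lambda>_. (0, 0)"] by simp
  have "measure srw_law {w. w 0 = (0, 0)} = 1"
    using srw_law_path[of 0 "\<lambda>_. (0, 0)"] by simp
  then show ?thesis using SL.AE_in_set_eq_1[OF m] by simp
qed

lemma srw_adjacent: "AE w in srw_law. comb_adj (w t) (w (Suc t))"
proof -
  let ?X = "{x \<in> PiE {..Suc t} (\<lambda>_. UNIV :: (int \<times> int) set). \<not> comb_adj (x t) (x (Suc t))}"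
  have "countable ?X" by (rule countable_Collect[OF countable_PiE]) auto
  have null: "{w. \<forall>i\<le>Suc t. w i = x i} \<in> null_sets srw_law" if "x \<in> ?X" for x
  proof -
    have "measure srw_law {w. \<forall>i\<le>Suc t. w i = x i} = 0"
      unfolding srw_law_path using that by (auto simp: pmf_srw_step)
    then show ?thesis by (simp add: null_sets_def SL.emeasure_eq_measure)
  qed
  have "(\<Union>x\<in>?X. {w. \<forall>i\<le>Suc t. w i = x i}) \<in> null_sets srw_law"
    using \<open>countable ?X\<close> null by (rule null_sets_UN')
  moreover have "{w \<in> space srw_law. \<not> comb_adj (w t) (w (Suc t))} \<subseteq>
      (\<Union>x\<in>?X. {w. \<forall>i\<le>Suc t. w i = x i})"
  proof
    fix w assume w: "w \<in> {w \<in> space srw_law. \<not> comb_adj (w t) (w (Suc t))}"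
    then have "restrict w {..Suc t} \<in> ?X" by auto
    moreover have "w \<in> {v. \<forall>i\<le>Suc t. v i = restrict w {..Suc t} i}" by auto
    ultimately show "w \<in> (\<Union>x\<in>?X. {w. \<forall>i\<le>Suc t. w i = x i})" by blast
  qed
  ultimately show ?thesis by (rule AE_I')
qed

lemma finite_comb_closure: "finite S \<Longrightarrow> finite (comb_closure S)"
  by (simp add: comb_closure_def finite_comb_nbrs)

text \<open>
  Optional stopping at a bounded time. The constant \<open>\<epsilon>\<close> allows the drift to control the exit time
  as well (\<open>\<epsilon> > 0\<close>), besides the value at the exit (\<open>\<epsilon> = 0\<close>).
\<close>

lemma expectation_stopped_le:
  assumes S: "finite S" and drift: "\<And>v. v \<in> S \<Longrightarrow> nbr_mean H v \<le> H v - \<epsilon>"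
    and supp: "finite {v. H v \<noteq> 0}"
  shows "(\<integral>w. H (stopped S w t) \<partial>srw_law) \<le> H (0, 0) - \<epsilon> * (\<Sum>i<t. measure srw_law (stays S i))"
proof (induction t)
  case 0
  have "(\<integral>w. H (stopped S w 0) \<partial>srw_law) = (\<integral>w. H (0, 0) \<partial>srw_law)"
    using srw_start by (intro integral_cong_AE) (auto simp: stopped_0)
  then show ?case using SL.prob_space by simp
next
  case (Suc t)
  define B where "B = (\<Sum>v | H v \<noteq> 0. \<bar>H v\<bar>)"
  have B: "\<bar>H v\<bar> \<le> B" for v
  proof (cases "H v = 0")
    case False
    then show ?thesis unfolding B_def using supp by (intro member_le_sum) auto
  qed (simp add: B_def sum_nonneg)
  have int: "integrable srw_law (\<lambda>w. H (g w))" if [measurable]: "g \<in> measurable srw_law (count_space UNIV)" for g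
    using B by (intro SL.integrable_const_bound[of _ B]) auto
  have indint: "integrable srw_law (\<lambda>w. indicator (stays S t) w * H (g w))"
    if [measurable]: "g \<in> measurable srw_law (count_space UNIV)" for g
    using B that by (intro SL.integrable_const_bound[of _ B])
      (auto simp: indicator_def B_def intro!: sum_nonneg)
  have "H (stopped S w (Suc t)) = H (stopped S w t) +
      (indicator (stays S t) w * H (w (Suc t)) - indicator (stays S t) w * H (w t))" for w
    by (subst stopped_Suc) (simp add: stopped_def)
  then have "(\<integral>w. H (stopped S w (Suc t)) \<partial>srw_law) = (\<integral>w. H (stopped S w t) \<partial>srw_law) +
      ((\<integral>w. indicator (stays S t) w * H (w (Suc t)) \<partial>srw_law) -
       (\<integral>w. indicator (stays S t) w * H (w t) \<partial>srw_law))"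
    by (simp add: int indint)
  also have "(\<integral>w. indicator (stays S t) w * H (w (Suc t)) \<partial>srw_law) =
      (\<integral>w. indicator (stays S t) w * nbr_mean H (w t) \<partial>srw_law)"
    by (rule markov_step[OF S supp])
  also have "\<dots> \<le> (\<integral>w. indicator (stays S t) w * H (w t) - \<epsilon> * indicator (stays S t) w \<partial>srw_law)"
  proof (rule integral_mono)
    have nb: "\<bar>nbr_mean H v\<bar> \<le> B" for v
    proof -
      have "\<bar>\<Sum>w\<in>comb_nbrs v. H w\<bar> \<le> (\<Sum>w\<in>comb_nbrs v. B)"
        using B by (intro order_trans[OF sum_abs] sum_mono)
      moreover have "card (comb_nbrs v) > 0"
        using finite_comb_nbrs comb_nbrs_nonempty by (simp add: card_gt_0_iff)
      ultimately show ?thesis by (simp add: nbr_mean_def field_simps)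
    qed
    show "integrable srw_law (\<lambda>w. indicator (stays S t) w * nbr_mean H (w t))"
      using nb by (intro SL.integrable_const_bound[of _ B])
        (auto simp: indicator_def B_def intro!: sum_nonneg)
    show "integrable srw_law (\<lambda>w. indicator (stays S t) w * H (w t) - \<epsilon> * indicator (stays S t) w)"
      by (intro Bochner_Integration.integrable_diff indint) (auto simp: SL.emeasure_eq_measure)
  next
    fix w
    show "indicator (stays S t) w * nbr_mean H (w t) \<le>
        indicator (stays S t) w * H (w t) - \<epsilon> * indicator (stays S t) w"
      using drift[of "w t"] by (auto simp: indicator_def stays_def)
  qed
  also have "\<dots> = (\<integral>w. indicator (stays S t) w * H (w t) \<partial>srw_law) - \<epsilon> * measure srw_law (stays S t)"
    by (subst Bochner_Integration.integral_diff) (auto simp: indint SL.emeasure_eq_measure)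
  finally show ?case using Suc by (simp add: algebra_simps)
qed

lemma nbr_mean_restrict_closure:
  assumes "v \<in> S"
  shows "nbr_mean (\<lambda>u. if u \<in> comb_closure S then H u else 0) v = nbr_mean H v"
  using assms by (intro nbr_mean_cong) (auto simp: comb_closure_def)

text \<open>
  The height \<open>y\<close> makes a step of size \<open>1\<close> with probability at least \<open>1 / 2\<close>, even on the
  backbone, so \<open>y\<^sup>2\<close> gains at least \<open>1 / 2\<close> per step on average, while it is bounded on a finite set.
\<close>

lemma AE_exits:
  assumes S: "finite S"
  shows "AE w in srw_law. \<exists>t. w t \<notin> S"
proof -
  let ?cl = "comb_closure S"
  \<comment> \<open>Large enough for \<open>V\<close> to be nonnegative; cutting \<open>V\<close> off outside the closure is not felt from \<open>S\<close>.\<close>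
  define C where "C = (\<Sum>v\<in>?cl. (real_of_int (snd v))\<^sup>2)"
  define V where "V = (\<lambda>v. if v \<in> ?cl then C - (real_of_int (snd v))\<^sup>2 else 0)"
  have V0: "V v \<ge> 0" for v
    using member_le_sum[of v ?cl "\<lambda>v. (real_of_int (snd v))\<^sup>2"] finite_comb_closure[OF S]
    by (auto simp: V_def C_def)
  have drift: "nbr_mean V v \<le> V v - 1 / 2" if v: "v \<in> S" for v
  proof -
    have "nbr_mean (\<lambda>v. C - (real_of_int (snd v))\<^sup>2) v \<le> (C - (real_of_int (snd v))\<^sup>2) - 1 / 2"
      by (cases v; cases "snd v = 0")
        (auto simp: nbr_mean_backbone nbr_mean_tooth power2_eq_square field_simps)
    then show ?thesis
      using v by (simp add: V_def nbr_mean_restrict_closure) (simp add: comb_closure_def)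
  qed
  have supp: "finite {v. V v \<noteq> 0}"
    by (rule finite_subset[OF _ finite_comb_closure[OF S]]) (auto simp: V_def split: if_splits)
  let ?E = "\<Inter>t. stays S t"
  have "real t * measure srw_law ?E \<le> 2 * V (0, 0)" for t
  proof -
    have "real t * measure srw_law ?E = (\<Sum>i<t. measure srw_law ?E)" by simp
    also have "\<dots> \<le> (\<Sum>i<t. measure srw_law (stays S i))"
      by (intro sum_mono SL.finite_measure_mono) auto
    finally have "real t * measure srw_law ?E \<le> (\<Sum>i<t. measure srw_law (stays S i))" .
    moreover have "0 \<le> (\<integral>w. V (stopped S w t) \<partial>srw_law)"
      by (intro Bochner_Integration.integral_nonneg V0)
    ultimately show ?thesis
      using expectation_stopped_le[of S V "1/2" t, OF S drift supp] by simp
  qed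
  then have "measure srw_law ?E \<le> 0"
    by (metis ex_less_of_nat_mult not_le)
  then have "?E \<in> null_sets srw_law"
    by (auto simp: null_sets_def SL.emeasure_eq_measure measure_le_0_iff)
  then show ?thesis
    by (rule AE_I') (auto simp: stays_def)
qed

lemma AE_proper_path: "AE w in srw_law. proper_path w"
proof -
  have "AE w in srw_law. \<forall>S\<in>{S :: (int \<times> int) set. finite S}. \<exists>t. w t \<notin> S"
    by (rule AE_ball_countable'[OF _ countable_Collect_finite]) (use AE_exits in auto)
  moreover have "AE w in srw_law. \<forall>t. comb_adj (w t) (w (Suc t))"
    unfolding AE_all_countable using srw_adjacent by blast
  ultimately show ?thesis using srw_start by eventually_elim (auto simp: proper_path_def)
qed

lemma first_outside_facts:
  assumes "proper_path w" "finite S"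
  obtains \<tau> where "first_outside S w = w \<tau>" "w \<tau> \<notin> S" "\<And>t. t < \<tau> \<Longrightarrow> w t \<in> S"
proof
  let ?\<tau> = "LEAST t. w t \<notin> S"
  show "first_outside S w = w ?\<tau>" by (simp add: first_outside_def)
  have "\<exists>t. w t \<notin> S" using assms by (auto simp: proper_path_def)
  then show "w ?\<tau> \<notin> S" by (rule LeastI_ex)
  show "\<And>t. t < ?\<tau> \<Longrightarrow> w t \<in> S" using not_less_Least by blast
qed

lemma first_outside_cases:
  assumes "proper_path w" "finite S"
  shows "first_outside S w \<notin> S"
    and "first_outside S w = (0, 0) \<or> (\<exists>u\<in>S. comb_adj u (first_outside S w))"
proof -
  obtain \<tau> where t: "first_outside S w = w \<tau>" "w \<tau> \<notin> S" "\<And>t. t < \<tau> \<Longrightarrow> w t \<in> S"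
    using first_outside_facts[OF assms] by blast
  show "first_outside S w \<notin> S" using t by simp
  show "first_outside S w = (0, 0) \<or> (\<exists>u\<in>S. comb_adj u (first_outside S w))"
  proof (cases \<tau>)
    case 0
    then show ?thesis using t assms by (simp add: proper_path_def)
  next
    case (Suc i)
    then have "w i \<in> S" "comb_adj (w i) (w \<tau>)" using t assms by (auto simp: proper_path_def)
    then show ?thesis using t by auto
  qed
qed

lemma first_outside_in_closure:
  assumes "proper_path w" "finite S"
  shows "first_outside S w \<in> comb_closure S"
  using first_outside_cases(2)[OF assms] by (auto simp: comb_closure_def comb_nbrs_def)

text \<open>
  Optional stopping at the exit time, by dominated convergence; only finitely many values of \<open>H\<close> matter.
\<close>

lemma expectation_exit_le:
  assumes S: "finite S" and super: "\<And>v. v \<in> S \<Longrightarrow> nbr_mean H v \<le> H v"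
    and nonneg: "\<And>v. v \<in> comb_closure S \<Longrightarrow> 0 \<le> H v"
  shows "(\<integral>\<^sup>+w. ennreal (H (first_outside S w)) \<partial>srw_law) \<le> ennreal (H (0, 0))"
proof -
  let ?cl = "comb_closure S"
  define V where "V = (\<lambda>v. if v \<in> ?cl then H v else 0)"
  have supp: "finite {v. V v \<noteq> 0}"
    by (rule finite_subset[OF _ finite_comb_closure[OF S]]) (auto simp: V_def split: if_splits)
  have V0: "V v \<ge> 0" for v using nonneg by (simp add: V_def)
  have drift: "nbr_mean V v \<le> V v - 0" if "v \<in> S" for v
    using super[OF that] that by (simp add: V_def nbr_mean_restrict_closure) (simp add: comb_closure_def)
  define B where "B = (\<Sum>v | V v \<noteq> 0. \<bar>V v\<bar>)"
  have B: "\<bar>V v\<bar> \<le> B" for v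
  proof (cases "V v = 0")
    case False
    then show ?thesis unfolding B_def using supp by (intro member_le_sum) auto
  qed (simp add: B_def sum_nonneg)
  have "(\<lambda>t. \<integral>w. V (stopped S w t) \<partial>srw_law) \<longlonglongrightarrow> (\<integral>w. V (first_outside S w) \<partial>srw_law)"
  proof (rule integral_dominated_convergence[where w="\<lambda>_. B"])
    show "AE w in srw_law. (\<lambda>t. V (stopped S w t)) \<longlonglongrightarrow> V (first_outside S w)"
      using AE_exits[OF S]
    proof eventually_elim
      case (elim w)
      then obtain t0 where "w t0 \<notin> S" by blast
      then have "\<And>t. t \<ge> t0 \<Longrightarrow> stopped S w t = first_outside S w"
        by (auto simp: stopped_def stays_def)
      then show ?case
        by (intro tendsto_eventually) (auto simp: eventually_sequentially intro!: exI[of _ t0])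
    qed
  qed (use B in auto)
  moreover have "(\<integral>w. V (stopped S w t) \<partial>srw_law) \<le> V (0, 0)" for t
    using expectation_stopped_le[of S V 0 t, OF S drift supp] by simp
  ultimately have le: "(\<integral>w. V (first_outside S w) \<partial>srw_law) \<le> V (0, 0)"
    by (intro LIMSEQ_le_const2) auto
  have "(\<integral>\<^sup>+w. ennreal (H (first_outside S w)) \<partial>srw_law) =
      (\<integral>\<^sup>+w. ennreal (V (first_outside S w)) \<partial>srw_law)"
    using AE_proper_path
    by (intro nn_integral_cong_AE, eventually_elim) (simp add: V_def first_outside_in_closure S)
  also have "\<dots> = ennreal (\<integral>w. V (first_outside S w) \<partial>srw_law)"
    using B by (intro nn_integral_eq_integral SL.integrable_const_bound[of _ B]) (auto simp: V0)
  also have "\<dots> \<le> ennreal (V (0, 0))" using le by (rule ennreal_leI)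
  finally show ?thesis by (simp add: V_def comb_closure_def)
qed

section \<open>Products along the explorers\<close>

text \<open>
  Internal DLA in which an explorer also settles as soon as it leaves \<open>R\<close>, at a site that may already
  be occupied. The walks then only visit \<open>R\<close> and its boundary, where a potential can be controlled without
  any knowledge of the cluster.
\<close>

primrec frozen_idla :: "(int \<times> int) set \<Rightarrow> (nat \<Rightarrow> nat \<Rightarrow> int \<times> int) \<Rightarrow> nat \<Rightarrow> (int \<times> int) set" where
  "frozen_idla R \<omega> 0 = {}"
| "frozen_idla R \<omega> (Suc k) =
     insert (first_outside (frozen_idla R \<omega> k \<inter> R) (\<omega> k)) (frozen_idla R \<omega> k)"

lemma finite_frozen_idla [simp]: "finite (frozen_idla R \<omega> k)"
  by (induction k) auto

lemma frozen_idla_cong: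
  "(\<And>j. j < k \<Longrightarrow> \<omega> j = \<omega>' j) \<Longrightarrow> frozen_idla R \<omega> k = frozen_idla R \<omega>' k"
  by (induction k) auto

lemma frozen_idla_mono: "j \<le> k \<Longrightarrow> frozen_idla R \<omega> j \<subseteq> frozen_idla R \<omega> k"
  by (induction k) (auto simp: le_Suc_eq)

lemma idla_eq_frozen: "idla \<omega> k = frozen_idla UNIV \<omega> k"
  by (induction k) auto

text \<open>
  As long as nobody has settled outside \<open>R\<close>, the constraint has never been felt.
\<close>

lemma idla_eq_frozen_within:
  "frozen_idla R \<omega> k \<subseteq> R \<Longrightarrow> idla \<omega> k = frozen_idla R \<omega> k"
proof (induction k)
  case (Suc k)
  then have "frozen_idla R \<omega> k \<subseteq> R" by auto
  with Suc show ?case by (auto simp: Int_absorb2)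
qed simp

text \<open>
  There are countably many finite clusters, so measurability can be checked for each value of the cluster.
\<close>

lemma measurable_frozen_idla:
  assumes "{..<k} \<subseteq> I"
  shows "(\<lambda>\<omega>. frozen_idla R \<omega> k) \<in> measurable (PiM I (\<lambda>_. srw_law)) (count_space {B. finite B})"
  using assms
proof (induction k)
  case (Suc k)
  have "(\<lambda>\<omega>. insert (first_outside (B \<inter> R) (\<omega> k)) B) \<in>
      measurable (PiM I (\<lambda>_. srw_law)) (count_space {B. finite B})"
    if "B \<in> {B. finite B}" for B
  proof -
    have "(\<lambda>\<omega>. \<omega> k) \<in> measurable (PiM I (\<lambda>_. srw_law)) srw_law"
      using Suc.prems by (intro measurable_component_singleton) auto
    then have "(\<lambda>\<omega>. first_outside (B \<inter> R) (\<omega> k)) \<in> measurable (PiM I (\<lambda>_. srw_law)) (count_space UNIV)"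
      by (rule measurable_compose) (rule measurable_first_outside)
    then show ?thesis
      by (rule measurable_compose) (use that in auto)
  qed
  moreover have "(\<lambda>\<omega>. frozen_idla R \<omega> k) \<in> measurable (PiM I (\<lambda>_. srw_law)) (count_space {B. finite B})"
    by (rule Suc.IH) (use Suc.prems in auto)
  ultimately show ?case
    unfolding frozen_idla.simps by (rule measurable_compose_countable'[OF _ _ countable_Collect_finite])
qed simp

text \<open>
  Given the cluster \<open>A\<close>, the next explorer is evaluated where it leaves \<open>S A\<close>, a set that may be
  smaller than the one in which it wanders before settling.
\<close>

definition explorer_product where
  "explorer_product R S \<Psi> k \<omega> =
    (\<Prod>j<k. ennreal (\<Psi> (frozen_idla R \<omega> j) (first_outside (S (frozen_idla R \<omega> j)) (\<omega> j))))"

lemma measurable_explorer_product: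
  assumes "{..<k} \<subseteq> I"
  shows "explorer_product R S \<Psi> k \<in> borel_measurable (PiM I (\<lambda>_. srw_law))"
  unfolding explorer_product_def[abs_def]
proof (rule borel_measurable_prod_ennreal)
  fix j assume j: "j \<in> {..<k}"
  have w: "(\<lambda>\<omega>. \<omega> j) \<in> measurable (PiM I (\<lambda>_. srw_law)) srw_law"
    using j assms by (intro measurable_component_singleton) auto
  have "(\<lambda>\<omega>. ennreal (\<Psi> B (first_outside (S B) (\<omega> j)))) \<in> borel_measurable (PiM I (\<lambda>_. srw_law))" for B
  proof -
    have "(\<lambda>\<omega>. first_outside (S B) (\<omega> j)) \<in> measurable (PiM I (\<lambda>_. srw_law)) (count_space UNIV)"
      using w by (rule measurable_compose) (rule measurable_first_outside)
    then show ?thesis by (rule measurable_compose) auto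
  qed
  then show "(\<lambda>\<omega>. ennreal (\<Psi> (frozen_idla R \<omega> j) (first_outside (S (frozen_idla R \<omega> j)) (\<omega> j))))
      \<in> borel_measurable (PiM I (\<lambda>_. srw_law))"
    by (rule measurable_compose_countable'[OF _ measurable_frozen_idla countable_Collect_finite])
      (use j assms in auto)
qed

interpretation EL: product_prob_space "\<lambda>_ :: nat. srw_law" UNIV
  by unfold_locales

lemma space_explorers_law [simp]: "space explorers_law = UNIV"
  by (simp add: explorers_law_def space_PiM)

interpretation EP: prob_space explorers_law
  by (rule prob_space_explorers_law)

lemma explorer_product_cong:
  "(\<And>j. j < k \<Longrightarrow> \<omega> j = \<omega>' j) \<Longrightarrow> explorer_product R S \<Psi> k \<omega> = explorer_product R S \<Psi> k \<omega>'"
  unfolding explorer_product_def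
  by (intro prod.cong refl) (auto simp: frozen_idla_cong[of _ \<omega> \<omega>'])

text \<open>
  Integrating out the last explorer, whose starting cluster depends on the earlier ones only, multiplies
  the product by at most \<open>\<Psi> A (0, 0) \<le> 1\<close>.
\<close>

lemma expectation_explorer_product:
  assumes S: "\<And>A. finite A \<Longrightarrow> finite (S A)"
    and super: "\<And>A v. finite A \<Longrightarrow> v \<in> S A \<Longrightarrow> nbr_mean (\<Psi> A) v \<le> \<Psi> A v"
    and nonneg: "\<And>A v. finite A \<Longrightarrow> v \<in> comb_closure (S A) \<Longrightarrow> 0 \<le> \<Psi> A v"
    and start: "\<And>A. finite A \<Longrightarrow> \<Psi> A (0, 0) \<le> 1"
  shows "(\<integral>\<^sup>+\<omega>. explorer_product R S \<Psi> k \<omega> \<partial>explorers_law) \<le> 1"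
proof -
  let ?Z = "explorer_product R S \<Psi>"
  have fin: "(\<integral>\<^sup>+\<omega>. ?Z k \<omega> \<partial>PiM {..<k} (\<lambda>_. srw_law)) \<le> 1"
  proof (induction k)
    case 0
    then show ?case by (simp add: explorer_product_def PiM_empty)
  next
    case (Suc k)
    have "(\<integral>\<^sup>+\<omega>. ?Z (Suc k) \<omega> \<partial>PiM {..<Suc k} (\<lambda>_. srw_law)) =
        (\<integral>\<^sup>+\<omega>. (\<integral>\<^sup>+w. ?Z (Suc k) (fun_upd \<omega> k w) \<partial>srw_law) \<partial>PiM {..<k} (\<lambda>_. srw_law))"
      unfolding lessThan_Suc
      by (rule EL.product_nn_integral_insert)
        (auto simp flip: lessThan_Suc intro: measurable_explorer_product)
    also have "\<dots> \<le> (\<integral>\<^sup>+\<omega>. ?Z k \<omega> \<partial>PiM {..<k} (\<lambda>_. srw_law))"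
    proof (rule nn_integral_mono)
      fix \<omega>
      let ?A = "frozen_idla R \<omega> k"
      have "?Z (Suc k) (fun_upd \<omega> k w) = ?Z k \<omega> * ennreal (\<Psi> ?A (first_outside (S ?A) w))" for w
      proof -
        have "?Z (Suc k) (fun_upd \<omega> k w) = ?Z k (fun_upd \<omega> k w) *
            ennreal (\<Psi> (frozen_idla R (fun_upd \<omega> k w) k) (first_outside (S (frozen_idla R (fun_upd \<omega> k w) k)) w))"
          by (simp add: explorer_product_def)
        also have "?Z k (fun_upd \<omega> k w) = ?Z k \<omega>" by (rule explorer_product_cong) auto
        also have "frozen_idla R (fun_upd \<omega> k w) k = ?A" by (rule frozen_idla_cong) auto
        finally show ?thesis .
      qed
      then have "(\<integral>\<^sup>+w. ?Z (Suc k) (fun_upd \<omega> k w) \<partial>srw_law) =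
          ?Z k \<omega> * (\<integral>\<^sup>+w. ennreal (\<Psi> ?A (first_outside (S ?A) w)) \<partial>srw_law)"
        by (simp add: nn_integral_cmult)
      also have "\<dots> \<le> ?Z k \<omega> * ennreal (\<Psi> ?A (0, 0))"
        using S super nonneg by (intro mult_left_mono expectation_exit_le) auto
      also have "\<dots> \<le> ?Z k \<omega> * 1"
        using start[of ?A] by (intro mult_left_mono) (auto simp: ennreal_le_1)
      finally show "(\<integral>\<^sup>+w. ?Z (Suc k) (fun_upd \<omega> k w) \<partial>srw_law) \<le> ?Z k \<omega>" by simp
    qed
    also have "\<dots> \<le> 1" by (rule Suc)
    finally show ?case .
  qed
  \<comment> \<open>Only the first \<open>k\<close> explorers matter, and their joint law is a finite product.\<close>
  have "(\<integral>\<^sup>+\<omega>. ?Z k \<omega> \<partial>explorers_law) = (\<integral>\<^sup>+\<omega>. ?Z k (restrict \<omega> {..<k}) \<partial>explorers_law)"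
    by (intro nn_integral_cong explorer_product_cong) auto
  also have "\<dots> = (\<integral>\<^sup>+\<omega>. ?Z k \<omega> \<partial>distr explorers_law (PiM {..<k} (\<lambda>_. srw_law)) (\<lambda>\<omega>. restrict \<omega> {..<k}))"
    unfolding explorers_law_def
    by (intro nn_integral_distr[symmetric] measurable_restrict_subset)
      (auto simp: measurable_explorer_product)
  also have "distr explorers_law (PiM {..<k} (\<lambda>_. srw_law)) (\<lambda>\<omega>. restrict \<omega> {..<k}) =
      PiM {..<k} (\<lambda>_. srw_law)"
    unfolding explorers_law_def by (rule EL.distr_PiM_restrict_finite) auto
  finally show ?thesis using fin by simp
qed

lemma explorer_product_markov:
  assumes S: "\<And>A. finite A \<Longrightarrow> finite (S A)"
    and super: "\<And>A v. finite A \<Longrightarrow> v \<in> S A \<Longrightarrow> nbr_mean (\<Psi> A) v \<le> \<Psi> A v"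
    and nonneg: "\<And>A v. finite A \<Longrightarrow> v \<in> comb_closure (S A) \<Longrightarrow> 0 \<le> \<Psi> A v"
    and start: "\<And>A. finite A \<Longrightarrow> \<Psi> A (0, 0) \<le> 1"
    and c: "c > 0"
  shows "{\<omega>. ennreal c \<le> explorer_product R S \<Psi> k \<omega>} \<in> sets explorers_law" (is "?E \<in> _")
    and "measure explorers_law {\<omega>. ennreal c \<le> explorer_product R S \<Psi> k \<omega>} \<le> 1 / c"
proof -
  have [measurable]: "explorer_product R S \<Psi> k \<in> borel_measurable explorers_law"
    unfolding explorers_law_def by (rule measurable_explorer_product) simp
  have "{\<omega> \<in> space explorers_law. ennreal c \<le> explorer_product R S \<Psi> k \<omega>} \<in> sets explorers_law"
    by measurable
  then show E: "?E \<in> sets explorers_law" by simp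
  have "ennreal c * emeasure explorers_law ?E = (\<integral>\<^sup>+\<omega>. ennreal c * indicator ?E \<omega> \<partial>explorers_law)"
    using E by (simp add: nn_integral_cmult_indicator)
  also have "\<dots> \<le> (\<integral>\<^sup>+\<omega>. explorer_product R S \<Psi> k \<omega> \<partial>explorers_law)"
    by (intro nn_integral_mono) (auto simp: indicator_def)
  also have "\<dots> \<le> 1" by (rule expectation_explorer_product[OF S super nonneg start])
  finally have "ennreal (c * measure explorers_law ?E) \<le> ennreal 1"
    using c by (simp add: EP.emeasure_eq_measure ennreal_mult)
  then have "c * measure explorers_law ?E \<le> 1"
    by (simp only: ennreal_le_iff zero_le_one)
  then show "measure explorers_law ?E \<le> 1 / c" using c by (simp add: field_simps)
qed

lemma AE_proper_explorers: "AE \<omega> in explorers_law. \<forall>k. proper_path (\<omega> k)"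
  unfolding AE_all_countable explorers_law_def
  by (intro allI AE_PiM_component prob_space_srw_law AE_proper_path) simp

section \<open>Clusters as subtrees\<close>

text \<open>
  The comb is a tree rooted at the origin; the origin is its own parent because \<open>sgn 0 = 0\<close>.
\<close>

definition parent :: "int \<times> int \<Rightarrow> int \<times> int" where
  "parent v = (if snd v = 0 then (fst v - sgn (fst v), 0) else (fst v, snd v - sgn (snd v)))"

definition star_closed :: "(int \<times> int) set \<Rightarrow> bool" where
  "star_closed A \<longleftrightarrow> (\<forall>v\<in>A. parent v \<in> A)"

lemma adjacent_parent: "comb_adj u v \<Longrightarrow> u = parent v \<or> v = parent u"
  by (cases u; cases v) (auto simp: comb_adj_def parent_def sgn_if abs_if split: if_splits)

text \<open>
  An explorer leaves the occupied subtree towards a child of one of its sites; if it is frozen on its way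
  towards the root, it is frozen at an occupied site.
\<close>

lemma star_closed_frozen_idla:
  assumes "\<And>j. proper_path (\<omega> j)"
  shows "star_closed (frozen_idla R \<omega> k)"
proof (induction k)
  case (Suc k)
  let ?A = "frozen_idla R \<omega> k"
  let ?z = "first_outside (?A \<inter> R) (\<omega> k)"
  have "parent ?z \<in> insert ?z ?A"
  proof (cases "?z \<in> ?A")
    case True
    then show ?thesis using Suc by (auto simp: star_closed_def)
  next
    case False
    from first_outside_cases(2)[OF assms, of "?A \<inter> R" k]
    consider "?z = (0, 0)" | u where "u \<in> ?A" "comb_adj u ?z" by auto
    then show ?thesis
    proof cases
      case 1
      then show ?thesis by (simp add: parent_def)
    next
      case 2
      then show ?thesis using adjacent_parent[OF 2(2)] Suc False by (auto simp: star_closed_def)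
    qed
  qed
  with Suc show ?case by (auto simp: star_closed_def)
qed (simp add: star_closed_def)

lemma star_closed_tooth_pos:
  assumes "star_closed A" "(x, y) \<in> A" "0 \<le> y'" "y' \<le> y"
  shows "(x, y') \<in> A"
proof -
  have "(x, y - int j) \<in> A" if "int j \<le> y" for j
    using that
  proof (induction j)
    case (Suc j)
    then have "parent (x, y - int j) \<in> A" using assms(1) by (auto simp: star_closed_def)
    then show ?case using Suc.prems by (auto simp: parent_def algebra_simps)
  qed (use assms in simp)
  from this[of "nat (y - y')"] show ?thesis using assms by simp
qed

lemma star_closed_tooth_neg:
  assumes "star_closed A" "(x, y) \<in> A" "y' \<le> 0" "y \<le> y'"
  shows "(x, y') \<in> A"
proof -
  have "(x, y + int j) \<in> A" if "int j \<le> - y" for j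
    using that
  proof (induction j)
    case (Suc j)
    then have "parent (x, y + int j) \<in> A" using assms(1) by (auto simp: star_closed_def)
    then show ?case using Suc.prems by (auto simp: parent_def algebra_simps)
  qed (use assms in simp)
  from this[of "nat (y' - y)"] show ?thesis using assms by simp
qed

lemma star_closed_backbone_pos:
  assumes "star_closed A" "(x, 0) \<in> A" "0 \<le> x'" "x' \<le> x"
  shows "(x', 0) \<in> A"
proof -
  have "(x - int j, 0) \<in> A" if "int j \<le> x" for j
    using that
  proof (induction j)
    case (Suc j)
    then have "parent (x - int j, 0) \<in> A" using assms(1) by (auto simp: star_closed_def)
    then show ?case using Suc.prems by (auto simp: parent_def algebra_simps)
  qed (use assms in simp)
  from this[of "nat (x - x')"] show ?thesis using assms by simp
qed

lemma star_closed_backbone_neg: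
  assumes "star_closed A" "(x, 0) \<in> A" "x' \<le> 0" "x \<le> x'"
  shows "(x', 0) \<in> A"
proof -
  have "(x + int j, 0) \<in> A" if "int j \<le> - x" for j
    using that
  proof (induction j)
    case (Suc j)
    then have "parent (x + int j, 0) \<in> A" using assms(1) by (auto simp: star_closed_def)
    then show ?case using Suc.prems by (auto simp: parent_def algebra_simps)
  qed (use assms in simp)
  from this[of "nat (x' - x)"] show ?thesis using assms by simp
qed

section \<open>Harmonic functions and quadrature on the comb\<close>

definition laplace :: "(int \<Rightarrow> real) \<Rightarrow> int \<Rightarrow> real" where
  "laplace p x = p (x + 1) + p (x - 1) - 2 * p x"

text \<open>
  On a tooth a harmonic function is linear on either side of the backbone; the mean of the two slopes is
  then dictated by harmonicity at the root of the tooth, and their difference is free.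
\<close>

definition comb_harmonic :: "(int \<Rightarrow> real) \<Rightarrow> (int \<Rightarrow> real) \<Rightarrow> int \<times> int \<Rightarrow> real" where
  "comb_harmonic p c v = p (fst v) + c (fst v) * real_of_int (snd v)
     - \<bar>real_of_int (snd v)\<bar> * laplace p (fst v) / 2"

lemma nbr_mean_comb_harmonic: "nbr_mean (comb_harmonic p c) v = comb_harmonic p c v"
proof (cases v)
  case (Pair x y)
  show ?thesis
  proof (cases "y = 0")
    case True
    then show ?thesis unfolding Pair
      by (simp add: nbr_mean_backbone comb_harmonic_def laplace_def field_simps)
  next
    case False
    then consider "y \<ge> 1" | "y \<le> -1" by linarith
    then show ?thesis
    proof cases
      case 1
      then have "\<bar>real_of_int y\<bar> = y" "\<bar>real_of_int (y + 1)\<bar> = y + 1" "\<bar>real_of_int (y - 1)\<bar> = y - 1" by auto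
      then show ?thesis using False unfolding Pair
        by (simp add: nbr_mean_tooth comb_harmonic_def field_simps)
    next
      case 2
      then have "\<bar>real_of_int y\<bar> = - y" "\<bar>real_of_int (y + 1)\<bar> = - y - 1" "\<bar>real_of_int (y - 1)\<bar> = 1 - y" by auto
      then show ?thesis using False unfolding Pair
        by (simp add: nbr_mean_tooth comb_harmonic_def field_simps)
    qed
  qed
qed

definition tooth_sites :: "real \<Rightarrow> int set" where
  "tooth_sites h = {y. \<bar>real_of_int y\<bar> < h}"

lemma tooth_sites_eq:
  assumes "h > 0"
  shows "tooth_sites h = {1 - \<lceil>h\<rceil>..\<lceil>h\<rceil> - 1}"
  by (auto simp: tooth_sites_def abs_less_iff less_ceiling_iff) (use assms in linarith)+

lemma finite_tooth_sites [simp]: "finite (tooth_sites h)"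
proof (cases "h > 0")
  case False
  then have "tooth_sites h = {}" by (auto simp: tooth_sites_def)
  then show ?thesis by simp
qed (simp add: tooth_sites_eq)

lemma card_tooth_sites:
  assumes "h > 0"
  shows "\<bar>real (card (tooth_sites h)) - 2 * h\<bar> \<le> 1"
proof -
  have "\<lceil>h\<rceil> \<ge> 1" using assms by linarith
  then have "real (card (tooth_sites h)) = 2 * real_of_int \<lceil>h\<rceil> - 1"
    by (simp add: tooth_sites_eq[OF assms])
  moreover have "h \<le> real_of_int \<lceil>h\<rceil>" "real_of_int \<lceil>h\<rceil> < h + 1" by linarith+
  ultimately show ?thesis by linarith
qed

lemma sum_linear_tooth_sites: "(\<Sum>y\<in>tooth_sites h. real_of_int y) = 0"
proof -
  have "(\<Sum>y\<in>tooth_sites h. real_of_int y) = (\<Sum>y\<in>tooth_sites h. real_of_int (- y))"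
    by (rule sum.reindex_bij_witness[of _ uminus uminus]) (auto simp: tooth_sites_def)
  then show ?thesis by (simp add: sum_negf)
qed

lemma sum_abs_symmetric_interval:
  "(\<Sum>y\<in>{- int j..int j}. \<bar>real_of_int y\<bar>) = real j * (real j + 1)"
proof (induction j)
  case (Suc j)
  have "{- int (Suc j)..int (Suc j)} = insert (- int (Suc j)) (insert (int (Suc j)) {- int j..int j})"
    by auto
  then show ?case using Suc by (simp add: algebra_simps)
qed simp

text \<open>
  With \<open>k = \<lceil>h\<rceil> - 1\<close> the sum is \<open>k * (k + 1)\<close>, and \<open>h - 1 \<le> k < h\<close>.
\<close>

lemma sum_abs_tooth_sites:
  assumes "h > 0"
  shows "\<bar>(\<Sum>y\<in>tooth_sites h. \<bar>real_of_int y\<bar>) - h\<^sup>2\<bar> \<le> h"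
proof -
  define j where "j = nat (\<lceil>h\<rceil> - 1)"
  have j: "int j = \<lceil>h\<rceil> - 1" using assms by (simp add: j_def)
  have J: "real j < h" "h \<le> real j + 1"
    using j by linarith+
  have "tooth_sites h = {- int j..int j}" using j by (simp add: tooth_sites_eq[OF assms])
  then have e: "(\<Sum>y\<in>tooth_sites h. \<bar>real_of_int y\<bar>) = real j * (real j + 1)"
    by (simp add: sum_abs_symmetric_interval)
  have "real j * (real j + 1) \<le> h * (h + 1)" using J by (intro mult_mono) auto
  moreover have "real j * (real j + 1) \<ge> (h - 1) * h"
  proof (cases "h \<ge> 1")
    case True
    then show ?thesis using J by (intro mult_mono) auto
  next
    case False
    then have "(h - 1) * h \<le> 0" using assms by (simp add: mult_nonpos_nonneg)
    moreover have "0 \<le> real j * (real j + 1)" by simp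
    ultimately show ?thesis by linarith
  qed
  ultimately show ?thesis unfolding e by (simp add: power2_eq_square algebra_simps abs_le_iff)
qed

definition tooth_height :: "real \<Rightarrow> int \<Rightarrow> real" where
  "tooth_height \<rho> x = (max 0 (\<rho> - \<bar>real_of_int x\<bar>))\<^sup>2 / 3"

lemma tooth_height_nonneg [simp]: "tooth_height \<rho> x \<ge> 0"
  by (simp add: tooth_height_def)

lemma \<D>_eq_Sigma:
  "\<D> \<rho> = Sigma {x. \<bar>real_of_int x\<bar> < \<rho>} (\<lambda>x. tooth_sites (tooth_height \<rho> x))"
  by (auto simp: \<D>_def tooth_sites_def tooth_height_def max_def)

lemma finite_abs_less: "finite {x. \<bar>real_of_int x\<bar> < \<rho>}"
  using finite_tooth_sites[of \<rho>] by (simp add: tooth_sites_def)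

lemma sum_\<D>:
  "(\<Sum>v\<in>\<D> \<rho>. f v) = (\<Sum>x | \<bar>real_of_int x\<bar> < \<rho>. \<Sum>y\<in>tooth_sites (tooth_height \<rho> x). f (x, y))"
  unfolding \<D>_eq_Sigma by (subst sum.Sigma) (auto simp: finite_abs_less split_beta)

text \<open>
  The slope \<open>c\<close> drops out by symmetry, and what remains is twice the integral of a linear function.
\<close>

lemma sum_tooth_comb_harmonic:
  assumes "h > 0"
  shows "\<bar>(\<Sum>y\<in>tooth_sites h. comb_harmonic p c (x, y)) - (2 * h * p x - h\<^sup>2 * laplace p x / 2)\<bar>
    \<le> \<bar>p x\<bar> + h * \<bar>laplace p x\<bar>"
proof -
  let ?K = "real (card (tooth_sites h))" and ?S = "\<Sum>y\<in>tooth_sites h. \<bar>real_of_int y\<bar>"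
  have "(\<Sum>y\<in>tooth_sites h. comb_harmonic p c (x, y)) =
      ?K * p x + c x * (\<Sum>y\<in>tooth_sites h. real_of_int y) - ?S * (laplace p x / 2)"
    by (simp add: comb_harmonic_def sum.distrib sum_subtractf sum_distrib_left sum_distrib_right)
  then have "(\<Sum>y\<in>tooth_sites h. comb_harmonic p c (x, y)) - (2 * h * p x - h\<^sup>2 * laplace p x / 2) =
      (?K - 2 * h) * p x - (?S - h\<^sup>2) * (laplace p x / 2)"
    by (simp add: sum_linear_tooth_sites algebra_simps)
  also have "\<bar>\<dots>\<bar> \<le> \<bar>(?K - 2 * h) * p x\<bar> + \<bar>(?S - h\<^sup>2) * (laplace p x / 2)\<bar>"
    by linarith
  also have "\<dots> \<le> 1 * \<bar>p x\<bar> + h * \<bar>laplace p x\<bar>"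
    unfolding abs_mult using card_tooth_sites[OF assms] sum_abs_tooth_sites[OF assms] assms
    by (intro add_mono mult_mono) auto
  finally show ?thesis by simp
qed

lemma summation_by_parts_laplace:
  fixes q p :: "int \<Rightarrow> real"
  assumes q: "\<And>x. \<bar>x\<bar> \<ge> M \<Longrightarrow> q x = 0"
  shows "(\<Sum>x\<in>{-M..M}. q x * laplace p x) = (\<Sum>x\<in>{-M..M}. p x * laplace q x)"
proof (cases "M \<ge> 0")
  case M: True
  have up: "(\<Sum>x\<in>{-M..M}. q x * p (x + 1)) = (\<Sum>x\<in>{-M..M}. q (x - 1) * p x)"
  proof -
    have "(\<Sum>x\<in>{-M..M}. q x * p (x + 1)) = (\<Sum>x\<in>{-M..M-1}. q x * p (x + 1))"
      using M q by (intro sum.mono_neutral_right) auto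
    also have "\<dots> = (\<Sum>x\<in>{-M+1..M}. q (x - 1) * p x)"
      by (rule sum.reindex_bij_witness[of _ "\<lambda>x. x - 1" "\<lambda>x. x + 1"]) auto
    also have "\<dots> = (\<Sum>x\<in>{-M..M}. q (x - 1) * p x)"
      using M q by (intro sum.mono_neutral_left) auto
    finally show ?thesis .
  qed
  have down: "(\<Sum>x\<in>{-M..M}. q x * p (x - 1)) = (\<Sum>x\<in>{-M..M}. q (x + 1) * p x)"
  proof -
    have "(\<Sum>x\<in>{-M..M}. q x * p (x - 1)) = (\<Sum>x\<in>{-M+1..M}. q x * p (x - 1))"
      using M q by (intro sum.mono_neutral_right) auto
    also have "\<dots> = (\<Sum>x\<in>{-M..M-1}. q (x + 1) * p x)"
      by (rule sum.reindex_bij_witness[of _ "\<lambda>x. x + 1" "\<lambda>x. x - 1"]) auto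
    also have "\<dots> = (\<Sum>x\<in>{-M..M}. q (x + 1) * p x)"
      using M q by (intro sum.mono_neutral_left) auto
    finally show ?thesis .
  qed
  have "(\<Sum>x\<in>{-M..M}. q x * laplace p x) =
      (\<Sum>x\<in>{-M..M}. q x * p (x + 1)) + (\<Sum>x\<in>{-M..M}. q x * p (x - 1)) - (\<Sum>x\<in>{-M..M}. 2 * (q x * p x))"
    by (simp add: laplace_def algebra_simps sum.distrib sum_subtractf)
  also have "\<dots> = (\<Sum>x\<in>{-M..M}. p x * laplace q x)"
    unfolding up down by (simp add: laplace_def algebra_simps sum.distrib sum_subtractf)
  finally show ?thesis .
qed simp

text \<open>
  The fourth power satisfies \<open>(r + 1) ^ 4 + (r - 1) ^ 4 - 2 * r ^ 4 = 12 * r\<^sup>2 + 2\<close>, which is exactly what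
  makes the profile \<open>r\<^sup>2 / 3\<close> the right one; the truncation at \<open>0\<close> only matters for \<open>r < 1\<close>.
\<close>

lemma quartic_defect:
  fixes r :: real
  shows "\<bar>2 * ((max 0 r)\<^sup>2 / 3) - (((max 0 (r + 1))\<^sup>2 / 3)\<^sup>2 + ((max 0 (r - 1))\<^sup>2 / 3)\<^sup>2
     - 2 * ((max 0 r)\<^sup>2 / 3)\<^sup>2) / 2\<bar> \<le> 1"
proof -
  consider "r \<ge> 1" | "0 \<le> r" "r < 1" | "-1 \<le> r" "r < 0" | "r < -1" by linarith
  then show ?thesis
  proof cases
    case 1
    then have "2 * ((max 0 r)\<^sup>2 / 3) - (((max 0 (r + 1))\<^sup>2 / 3)\<^sup>2 + ((max 0 (r - 1))\<^sup>2 / 3)\<^sup>2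
     - 2 * ((max 0 r)\<^sup>2 / 3)\<^sup>2) / 2 = 2 * (r\<^sup>2 / 3) - (((r + 1)\<^sup>2 / 3)\<^sup>2 + ((r - 1)\<^sup>2 / 3)\<^sup>2 - 2 * (r\<^sup>2 / 3)\<^sup>2) / 2"
      by (simp add: max_def)
    also have "\<dots> = - 1 / 9" by (simp add: power2_eq_square field_simps)
    finally show ?thesis by simp
  next
    case 2
    have a: "r\<^sup>2 \<le> 1" using 2 by (simp add: power_le_one)
    then have b: "(r\<^sup>2)\<^sup>2 \<le> 1" by (rule power_le_one[OF zero_le_power2])
    have "(r + 1)\<^sup>2 \<le> 2\<^sup>2" using 2 by (intro power_mono) auto
    then have "((r + 1)\<^sup>2)\<^sup>2 \<le> (2\<^sup>2)\<^sup>2" by (rule power_mono[OF _ zero_le_power2])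
    then have c: "((r + 1)\<^sup>2)\<^sup>2 \<le> 16" by simp
    have n: "0 \<le> (r + 1) ^ 4" "0 \<le> r ^ 4" "0 \<le> r\<^sup>2" by simp_all
    have "\<bar>2 * (r\<^sup>2 / 3) - ((r + 1) ^ 4 / 9 - 2 * (r ^ 4 / 9)) / 2\<bar> \<le> 1"
    proof -
      have "(r + 1) ^ 4 \<le> 16" "r ^ 4 \<le> 1" using c b by simp_all
      moreover have "\<bar>2 * (w / 3) - (u / 9 - 2 * (v / 9)) / 2\<bar> \<le> 1"
        if "0 \<le> u" "u \<le> 16" "0 \<le> v" "v \<le> 1" "0 \<le> w" "w \<le> 1" for u v w :: real
        using that by (simp add: abs_le_iff diff_divide_distrib)
      ultimately show ?thesis using n a by blast
    qed
    then show ?thesis using 2 by (simp add: max_def power_divide)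
  next
    case 3
    have "(r + 1)\<^sup>2 \<le> 1" using 3 by (simp add: power_le_one)
    then have "((r + 1)\<^sup>2)\<^sup>2 \<le> 1" by (rule power_le_one[OF zero_le_power2])
    moreover have n: "0 \<le> (r + 1) ^ 4" by simp
    ultimately have "\<bar>(r + 1) ^ 4 / 9 / 2\<bar> \<le> 1" by simp
    then show ?thesis using 3 by (simp add: max_def power_divide)
  qed (simp add: max_def)
qed

text \<open>
  The discrete form of \<open>2 * h = (h\<^sup>2)'' / 2\<close>, the equation that characterises the limit shape.
\<close>

lemma laplace_tooth_height_sq:
  assumes "x \<noteq> 0"
  shows "\<bar>2 * tooth_height \<rho> x - laplace (\<lambda>x. (tooth_height \<rho> x)\<^sup>2) x / 2\<bar> \<le> 1"
proof -
  define r where "r = \<rho> - \<bar>real_of_int x\<bar>"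
  consider "x \<ge> 1" | "x \<le> -1" using assms by linarith
  then have "(\<rho> - \<bar>real_of_int (x + 1)\<bar> = r - 1 \<and> \<rho> - \<bar>real_of_int (x - 1)\<bar> = r + 1) \<or>
      (\<rho> - \<bar>real_of_int (x + 1)\<bar> = r + 1 \<and> \<rho> - \<bar>real_of_int (x - 1)\<bar> = r - 1)"
    by cases (auto simp: r_def)
  then show ?thesis
    using quartic_defect[of r] unfolding laplace_def tooth_height_def r_def[symmetric]
    by (auto simp: algebra_simps)
qed

text \<open>
  The corner of \<open>h\<^sup>2\<close> at the origin concentrates the whole mass of the domain there.
\<close>

lemma laplace_tooth_height_sq_0:
  assumes "\<rho> \<ge> 1"
  shows "2 * tooth_height \<rho> 0 - laplace (\<lambda>x. (tooth_height \<rho> x)\<^sup>2) 0 / 2 = 4 / 9 * \<rho> ^ 3 + (4 * \<rho> - 1) / 9"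
  using assms by (simp add: laplace_def tooth_height_def max_def power2_eq_square power3_eq_cube field_simps)

text \<open>
  Summing along the teeth gives \<open>2 * h * p - h\<^sup>2 * laplace p / 2\<close>; summation by parts moves the
  Laplacian onto \<open>h\<^sup>2\<close>, where it cancels except at the origin. The range of summation reaches beyond the
  domain because the Laplacian of \<open>h\<^sup>2\<close> need not vanish just outside.
\<close>

lemma comb_quadrature:
  fixes p c :: "int \<Rightarrow> real"
  assumes \<rho>: "\<rho> \<ge> 1"
  defines "M \<equiv> \<lceil>\<rho>\<rceil> + 1"
  shows "\<bar>(\<Sum>v\<in>\<D> \<rho>. comb_harmonic p c v) - 4 / 9 * \<rho> ^ 3 * p 0\<bar>
    \<le> \<rho> * \<bar>p 0\<bar> + (\<Sum>x\<in>{-M..M}. 2 * \<bar>p x\<bar> + tooth_height \<rho> x * \<bar>laplace p x\<bar>)"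
proof -
  let ?h = "tooth_height \<rho>" and ?X = "{x. \<bar>real_of_int x\<bar> < \<rho>}"
  let ?T = "\<lambda>x. 2 * ?h x * p x - (?h x)\<^sup>2 * laplace p x / 2"
  have X: "?X \<subseteq> {-M..M}" unfolding M_def by (auto simp: abs_less_iff) linarith+
  have out: "?h x = 0" if "x \<notin> ?X" for x using that by (simp add: tooth_height_def)
  have M1: "M \<ge> 1" "real_of_int M \<ge> \<rho>" unfolding M_def using \<rho> by linarith+
  have "\<bar>(\<Sum>v\<in>\<D> \<rho>. comb_harmonic p c v) - (\<Sum>x\<in>?X. ?T x)\<bar> \<le>
      (\<Sum>x\<in>?X. \<bar>p x\<bar> + ?h x * \<bar>laplace p x\<bar>)"
    unfolding sum_\<D> sum_subtractf[symmetric]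
    by (rule order_trans[OF sum_abs], rule sum_mono, rule sum_tooth_comb_harmonic)
      (simp add: tooth_height_def)
  also have "\<dots> \<le> (\<Sum>x\<in>{-M..M}. \<bar>p x\<bar> + ?h x * \<bar>laplace p x\<bar>)"
    using X by (intro sum_mono2) auto
  finally have 1: "\<bar>(\<Sum>v\<in>\<D> \<rho>. comb_harmonic p c v) - (\<Sum>x\<in>?X. ?T x)\<bar> \<le>
      (\<Sum>x\<in>{-M..M}. \<bar>p x\<bar> + ?h x * \<bar>laplace p x\<bar>)" .
  have "(\<Sum>x\<in>?X. ?T x) = (\<Sum>x\<in>{-M..M}. ?T x)"
    using X out by (intro sum.mono_neutral_left) auto
  also have "\<dots> = (\<Sum>x\<in>{-M..M}. 2 * ?h x * p x) - (\<Sum>x\<in>{-M..M}. (?h x)\<^sup>2 * laplace p x) / 2"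
    by (simp add: sum_subtractf sum_divide_distrib)
  also have "(\<Sum>x\<in>{-M..M}. (?h x)\<^sup>2 * laplace p x) = (\<Sum>x\<in>{-M..M}. p x * laplace (\<lambda>x. (?h x)\<^sup>2) x)"
  proof (rule summation_by_parts_laplace)
    fix x :: int assume "\<bar>x\<bar> \<ge> M"
    then have "real_of_int M \<le> \<bar>real_of_int x\<bar>" by linarith
    then have "x \<notin> ?X" using M1 by simp
    then show "(?h x)\<^sup>2 = 0" by (simp add: out)
  qed
  finally have "(\<Sum>x\<in>?X. ?T x) = (\<Sum>x\<in>{-M..M}. p x * (2 * ?h x - laplace (\<lambda>x. (?h x)\<^sup>2) x / 2))"
    by (simp add: sum_subtractf sum_divide_distrib algebra_simps)
  also have "\<dots> = p 0 * (4 / 9 * \<rho> ^ 3 + (4 * \<rho> - 1) / 9) +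
      (\<Sum>x\<in>{-M..M} - {0}. p x * (2 * ?h x - laplace (\<lambda>x. (?h x)\<^sup>2) x / 2))"
    using M1 by (subst sum.remove[of _ 0]) (auto simp: laplace_tooth_height_sq_0[OF \<rho>])
  finally have 2: "(\<Sum>x\<in>?X. ?T x) - 4 / 9 * \<rho> ^ 3 * p 0 = p 0 * ((4 * \<rho> - 1) / 9) +
      (\<Sum>x\<in>{-M..M} - {0}. p x * (2 * ?h x - laplace (\<lambda>x. (?h x)\<^sup>2) x / 2))"
    by (simp add: algebra_simps)
  have 3: "\<bar>\<Sum>x\<in>{-M..M} - {0}. p x * (2 * ?h x - laplace (\<lambda>x. (?h x)\<^sup>2) x / 2)\<bar> \<le> (\<Sum>x\<in>{-M..M}. \<bar>p x\<bar>)"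
  proof -
    have "\<bar>\<Sum>x\<in>{-M..M} - {0}. p x * (2 * ?h x - laplace (\<lambda>x. (?h x)\<^sup>2) x / 2)\<bar> \<le> (\<Sum>x\<in>{-M..M} - {0}. \<bar>p x\<bar> * 1)"
      by (rule order_trans[OF sum_abs], rule sum_mono, unfold abs_mult,
          rule mult_left_mono[OF laplace_tooth_height_sq]) auto
    also have "\<dots> \<le> (\<Sum>x\<in>{-M..M}. \<bar>p x\<bar>)" by (simp, intro sum_mono2) auto
    finally show ?thesis .
  qed
  have 4: "\<bar>p 0 * ((4 * \<rho> - 1) / 9)\<bar> \<le> \<rho> * \<bar>p 0\<bar>"
    unfolding abs_mult using \<rho> by (subst mult.commute, intro mult_right_mono) auto
  have "(\<Sum>x\<in>{-M..M}. 2 * \<bar>p x\<bar> + ?h x * \<bar>laplace p x\<bar>) =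
      (\<Sum>x\<in>{-M..M}. \<bar>p x\<bar> + ?h x * \<bar>laplace p x\<bar>) + (\<Sum>x\<in>{-M..M}. \<bar>p x\<bar>)"
    by (simp add: sum.distrib[symmetric])
  then show ?thesis using 1 2 3 4 by linarith
qed

text \<open>
  Quadrature applied to a constant.
\<close>

lemma num_sites_cubic:
  assumes "n \<ge> 1"
  shows "\<bar>real (num_sites n) - 4 / 9 * real n ^ 3\<bar> \<le> 11 * real n"
proof -
  have "(\<Sum>v\<in>\<D> (real n). comb_harmonic (\<lambda>_. 1) (\<lambda>_. 0) v) = real (num_sites n)"
    by (simp add: comb_harmonic_def laplace_def num_sites_def)
  then show ?thesis
    using comb_quadrature[of "real n" "\<lambda>_. 1" "\<lambda>_. 0"] assms
    by (simp add: laplace_def)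
qed

section \<open>A potential with its pole at the tip of a tooth\<close>

text \<open>
  The errors of quadrature are concentrated near the two ends of the domain on the backbone. This weight
  dominates them, and its sum is bounded uniformly in \<open>\<rho>\<close>.
\<close>

definition edge_weight :: "real \<Rightarrow> int \<Rightarrow> real" where
  "edge_weight \<rho> x = 1 / (1 + \<bar>real_of_int x - \<rho>\<bar>)\<^sup>2 + 1 / (1 + \<bar>real_of_int x + \<rho>\<bar>)\<^sup>2"

text \<open>
  The map \<open>z / (1 + \<bar>z\<bar>)\<close> increases from \<open>-1\<close> to \<open>1\<close> and its increments dominate the
  inverse squares, so their sum over all integer translates is at most \<open>4\<close>.
\<close>

lemma inverse_square_telescope:
  fixes z :: real
  shows "1 / (1 + \<bar>z\<bar>)\<^sup>2 \<le> 2 * ((z + 1) / (1 + \<bar>z + 1\<bar>) - z / (1 + \<bar>z\<bar>))"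
proof -
  consider "z \<ge> 0" | "z \<le> -1" | "-1 < z" "z < 0" by linarith
  then show ?thesis
  proof cases
    case 1
    have "1 / (1 + \<bar>z\<bar>)\<^sup>2 = 2 / ((1 + z) * (2 * (1 + z)))"
      using 1 by (simp add: power2_eq_square divide_simps)
    also have "\<dots> \<le> 2 / ((1 + z) * (2 + z))"
      using 1 by (intro divide_left_mono mult_left_mono mult_pos_pos) auto
    also have "\<dots> = 2 * ((z + 1) / (1 + \<bar>z + 1\<bar>) - z / (1 + \<bar>z\<bar>))"
      using 1 by (simp add: field_simps)
    finally show ?thesis .
  next
    case 2
    define u where "u = - z"
    have u: "u \<ge> 1" "z = - u" using 2 by (auto simp: u_def)
    have "2 * ((z + 1) / (1 + \<bar>z + 1\<bar>) - z / (1 + \<bar>z\<bar>)) = 2 / (u * (1 + u))"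
      using u by (simp add: field_simps)
    also have "\<dots> \<ge> 1 / ((1 + u) * (1 + u))"
      using u by (intro frac_le mult_mono mult_pos_pos) auto
    finally show ?thesis using u by (simp add: power2_eq_square)
  next
    case 3
    define u where "u = - z"
    have u: "0 < u" "u < 1" "z = - u" using 3 by (auto simp: u_def)
    have "2 * ((z + 1) / (1 + \<bar>z + 1\<bar>) - z / (1 + \<bar>z\<bar>)) = 2 * ((1 - u) / (2 - u) + u / (1 + u))"
      using u by (simp add: field_simps)
    also have "(1 - u) / (2 - u) + u / (1 + u) = (1 + 2 * u - 2 * u\<^sup>2) / ((2 - u) * (1 + u))"
      using u by (simp add: field_simps power2_eq_square)
    also have "2 * \<dots> = 2 * (1 + 2 * u - 2 * u\<^sup>2) * (1 + u) / ((2 - u) * (1 + u)\<^sup>2)"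
    proof -
      have *: "2 * (a / (b * c)) = 2 * a * c / (b * c\<^sup>2)" if "c \<noteq> 0" for a b c :: real
        using that by (simp add: power2_eq_square)
      show ?thesis by (rule *) (use u in simp)
    qed
    also have "\<dots> \<ge> (2 - u) / ((2 - u) * (1 + u)\<^sup>2)"
    proof (rule divide_right_mono)
      have "u\<^sup>2 \<le> u" using u by (simp add: power2_eq_square)
      then have "1 + 2 * u - 2 * u\<^sup>2 \<ge> 1" by simp
      then have "2 * (1 + 2 * u - 2 * u\<^sup>2) * (1 + u) \<ge> 2 * 1 * 1" using u by (intro mult_mono) auto
      then show "2 - u \<le> 2 * (1 + 2 * u - 2 * u\<^sup>2) * (1 + u)" using u by linarith
    qed (use u in simp)
    finally show ?thesis using u by simp
  qed
qed

lemma sum_inverse_square_le: "(\<Sum>x\<in>{a..b}. 1 / (1 + \<bar>real_of_int x - \<rho>\<bar>)\<^sup>2) \<le> 4"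
proof -
  define \<phi> :: "real \<Rightarrow> real" where "\<phi> = (\<lambda>z. z / (1 + \<bar>z\<bar>))"
  have bound: "\<bar>\<phi> z\<bar> \<le> 1" for z by (simp add: \<phi>_def)
  have part: "(\<Sum>j<k. 1 / (1 + \<bar>real_of_int (a + int j) - \<rho>\<bar>)\<^sup>2) \<le>
      2 * (\<phi> (real_of_int a + real k - \<rho>) - \<phi> (real_of_int a - \<rho>))" for k
  proof (induction k)
    case (Suc k)
    have "1 / (1 + \<bar>real_of_int (a + int k) - \<rho>\<bar>)\<^sup>2 \<le>
        2 * (\<phi> (real_of_int a + real k - \<rho> + 1) - \<phi> (real_of_int a + real k - \<rho>))"
      unfolding \<phi>_def using inverse_square_telescope[of "real_of_int a + real k - \<rho>"] by simp
    then show ?case using Suc by (simp add: algebra_simps)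
  qed simp
  have "(\<Sum>x\<in>{a..b}. 1 / (1 + \<bar>real_of_int x - \<rho>\<bar>)\<^sup>2) =
      (\<Sum>j<nat (b + 1 - a). 1 / (1 + \<bar>real_of_int (a + int j) - \<rho>\<bar>)\<^sup>2)"
    by (rule sum.reindex_bij_witness[of _ "\<lambda>j. a + int j" "\<lambda>x. nat (x - a)"]) auto
  also have "\<dots> \<le> 4"
  proof -
    have "2 * (\<phi> u - \<phi> v) \<le> 2 * 2" for u v
    proof (rule mult_left_mono)
      show "\<phi> u - \<phi> v \<le> 2" using bound[of u] bound[of v] by (simp add: abs_le_iff)
    qed simp
    then have "2 * (\<phi> u - \<phi> v) \<le> 4" for u v by (metis mult_2 numeral_Bit0)
    then show ?thesis using part order_trans by blast
  qed
  finally show ?thesis .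
qed

lemma sum_edge_weight_le: "(\<Sum>x\<in>{a..b}. edge_weight \<rho> x) \<le> 8"
  using sum_inverse_square_le[of \<rho> a b] sum_inverse_square_le[of "- \<rho>" a b]
  by (simp add: edge_weight_def sum.distrib)

lemma edge_weight_nonneg [simp]: "edge_weight \<rho> x \<ge> 0"
  by (simp add: edge_weight_def)

lemma edge_weight_ge: "1 / (1 + \<bar>\<rho> - \<bar>real_of_int x\<bar>\<bar>)\<^sup>2 \<le> edge_weight \<rho> x"
proof (cases "x \<ge> 0")
  case True
  then have "\<bar>\<rho> - \<bar>real_of_int x\<bar>\<bar> = \<bar>real_of_int x - \<rho>\<bar>" by auto
  then show ?thesis by (simp add: edge_weight_def)
next
  case False
  then have "\<bar>\<rho> - \<bar>real_of_int x\<bar>\<bar> = \<bar>real_of_int x + \<rho>\<bar>" by (auto simp: abs_if)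
  then show ?thesis by (simp add: edge_weight_def)
qed

lemma le_edge_weight:
  assumes r: "r = \<rho> - \<bar>real_of_int x\<bar>" "r \<ge> 0" and u: "u \<le> 1" "r\<^sup>2 * u \<le> 1"
  shows "u \<le> 4 * edge_weight \<rho> x"
proof -
  have "u \<le> 4 / (1 + r)\<^sup>2"
  proof (cases "r \<ge> 1")
    case True
    have "(1 + r)\<^sup>2 \<le> (2 * r)\<^sup>2" using True by (intro power_mono) auto
    then have "(1 + r)\<^sup>2 * max 0 u \<le> (4 * r\<^sup>2) * max 0 u"
      by (intro mult_right_mono) (auto simp: power_mult_distrib)
    also have "\<dots> \<le> 4" using u by (simp add: max_def)
    finally have "(1 + r)\<^sup>2 * max 0 u \<le> 4" .
    moreover have "(1 + r)\<^sup>2 * u \<le> (1 + r)\<^sup>2 * max 0 u" by (intro mult_left_mono) auto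
    ultimately have "u * (1 + r)\<^sup>2 \<le> 4" by (simp add: mult.commute)
    then show ?thesis using r(2) by (simp add: le_divide_eq)
  next
    case False
    then have "(1 + r)\<^sup>2 \<le> 2\<^sup>2" using r(2) by (intro power_mono) auto
    then have "1 \<le> 4 / (1 + r)\<^sup>2" using r(2) by (simp add: le_divide_eq)
    then show ?thesis using u by linarith
  qed
  then show ?thesis using edge_weight_ge[of \<rho> x] r by simp
qed

lemma cube_over_fifth:
  fixes a c :: real
  assumes "a \<noteq> 0"
  shows "c / a ^ 5 * a ^ 3 = c / a\<^sup>2"
  using assms by (simp add: field_simps flip: power_add)

text \<open>
  The backbone values of the potential for the tooth at \<open>xt\<close>, with \<open>r\<close> the distance to the end of the
  domain. To vanish at the end of each tooth the profile must solve \<open>p'' = 6 * p / r\<^sup>2\<close>, whose solutions are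
  spanned by \<open>r ^ 3\<close> and \<open>1 / r\<^sup>2\<close>. Beyond \<open>xt\<close> and on the left, where the profile has to vanish at
  the end of the backbone, only \<open>r ^ 3\<close> is allowed. The coefficient \<open>1 / 6\<close> makes the derivatives match at
  the origin; the correction \<open>1 / \<rho>\<close> gives the discrete profile enough convexity there for the
  potential to be nonpositive at the end of the central tooth.
\<close>

definition inner_profile :: "real \<Rightarrow> int \<Rightarrow> int \<Rightarrow> real" where
  "inner_profile \<rho> xt x =
     (if x \<le> 0 then (1 - (1 / 6 + 1 / \<rho>)) / \<rho> ^ 5 * (\<rho> + x) ^ 3
      else if x \<le> xt then 1 / (\<rho> - x)\<^sup>2 - (1 / 6 + 1 / \<rho>) / \<rho> ^ 5 * (\<rho> - x) ^ 3
      else (1 / (\<rho> - xt) ^ 5 - (1 / 6 + 1 / \<rho>) / \<rho> ^ 5) * (\<rho> - x) ^ 3)"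

text \<open>
  The tooth at \<open>xt\<close> is the target. It is enough to treat \<open>xt \<ge> 0\<close> and the upper half of the tooth, by
  reflection.
\<close>

locale inner_tooth =
  fixes \<rho> :: real and xt :: int
  assumes rho: "\<rho> \<ge> 10" and xt: "xt \<ge> 0" and depth: "\<rho> - xt \<ge> 4"
begin

definition t :: real where "t = \<rho> - real_of_int xt"
definition B :: real where "B = 1 / 6 + 1 / \<rho>"
abbreviation "p \<equiv> inner_profile \<rho> xt"
abbreviation "h \<equiv> tooth_height \<rho>"

lemma B: "0 \<le> B" "B \<le> 1 / 2" using rho by (auto simp: B_def field_simps)

lemma t: "t \<le> \<rho>" "4 \<le> t" using xt depth by (auto simp: t_def)

lemma p_left: "x \<le> 0 \<Longrightarrow> p x = (1 - B) / \<rho> ^ 5 * (\<rho> + x) ^ 3"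
  by (simp add: inner_profile_def B_def)

lemma p_mid:
  assumes "0 \<le> x" "x \<le> xt"
  shows "p x = 1 / (\<rho> - x)\<^sup>2 - B / \<rho> ^ 5 * (\<rho> - x) ^ 3"
proof (cases "x = 0")
  case True
  have r: "\<rho> \<noteq> 0" using rho by simp
  have "p x = (1 - B) / \<rho> ^ 5 * \<rho> ^ 3" using p_left[of 0] True by simp
  also have "\<dots> = 1 / \<rho>\<^sup>2 - B / \<rho> ^ 5 * \<rho> ^ 3"
    unfolding cube_over_fifth[OF r] by (simp add: diff_divide_distrib)
  finally show ?thesis using True by simp
qed (use assms in \<open>simp add: inner_profile_def B_def\<close>)

lemma p_right:
  assumes "xt \<le> x"
  shows "p x = (1 / t ^ 5 - B / \<rho> ^ 5) * (\<rho> - x) ^ 3"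
proof (cases "x = xt")
  case True
  have "\<rho> - real_of_int xt = t" by (simp add: t_def)
  have e: "1 / t ^ 5 * t ^ 3 = 1 / t\<^sup>2" by (rule cube_over_fifth) (use t in simp)
  show ?thesis unfolding True left_diff_distrib
    using p_mid[of xt] xt unfolding t_def[symmetric] e by simp
next
  case False
  then show ?thesis using assms xt by (simp add: inner_profile_def B_def t_def)
qed

lemma p0: "p 0 = (1 - B) / \<rho>\<^sup>2"
  using p_left[of 0] rho cube_over_fifth[of \<rho> "1 - B"] by simp

lemma p0_bounds: "1 / (2 * \<rho>\<^sup>2) \<le> p 0" "p 0 \<le> 1 / \<rho>\<^sup>2"
  using B rho unfolding p0 by (auto simp: field_simps)

lemma right_coeff: "0 \<le> 1 / t ^ 5 - B / \<rho> ^ 5" "1 / t ^ 5 - B / \<rho> ^ 5 \<le> 1 / t ^ 5"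
proof -
  have "t ^ 5 \<le> \<rho> ^ 5" using t by (intro power_mono) auto
  then have "1 / \<rho> ^ 5 \<le> 1 / t ^ 5" using t rho by (intro divide_left_mono mult_pos_pos zero_less_power) auto
  moreover have "B / \<rho> ^ 5 \<le> 1 / \<rho> ^ 5" using B rho by (intro divide_right_mono) auto
  ultimately show "0 \<le> 1 / t ^ 5 - B / \<rho> ^ 5" by linarith
  show "1 / t ^ 5 - B / \<rho> ^ 5 \<le> 1 / t ^ 5" using B rho by simp
qed

lemma p_nonneg:
  assumes "\<bar>real_of_int x\<bar> < \<rho>"
  shows "0 \<le> p x"
proof -
  consider "x \<le> 0" | "0 \<le> x" "x \<le> xt" | "xt \<le> x" by linarith
  then show ?thesis
  proof cases
    case 1
    then show ?thesis using assms B rho by (simp add: p_left)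
  next
    case 2
    let ?r = "\<rho> - real_of_int x"
    have r: "?r \<ge> 4" "?r \<le> \<rho>" using 2 depth by auto
    have "B / \<rho> ^ 5 * ?r ^ 3 \<le> 1 / ?r ^ 5 * ?r ^ 3"
    proof (rule mult_right_mono)
      have "?r ^ 5 \<le> \<rho> ^ 5" using r by (intro power_mono) auto
      then show "B / \<rho> ^ 5 \<le> 1 / ?r ^ 5" using B r by (intro frac_le) auto
    qed (use r in simp)
    also have "1 / ?r ^ 5 * ?r ^ 3 = 1 / ?r\<^sup>2"
      by (rule cube_over_fifth) (use r in simp)
    finally show ?thesis using 2 by (simp add: p_mid)
  next
    case 3
    then show ?thesis using assms right_coeff by (simp add: p_right abs_less_iff)
  qed
qed

lemma p_le:
  assumes "\<bar>real_of_int x\<bar> < \<rho>"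
  shows "p x * (\<rho> - \<bar>real_of_int x\<bar>)\<^sup>2 \<le> 1" "p x \<le> 1 / t\<^sup>2"
proof -
  let ?r = "\<rho> - \<bar>real_of_int x\<bar>"
  have r0: "?r > 0" using assms by simp
  have "p x * ?r\<^sup>2 \<le> 1 \<and> p x \<le> 1 / t\<^sup>2"
  proof -
    consider "x \<le> 0" | "0 \<le> x" "x \<le> xt" | "xt \<le> x" by linarith
    then show ?thesis
    proof cases
      case 1
      then have r: "?r = \<rho> + x" "?r \<le> \<rho>" by auto
      have "p x * ?r\<^sup>2 = (1 - B) * (?r / \<rho>) ^ 5"
        using 1 r by (simp add: p_left power_divide power2_eq_square power3_eq_cube eval_nat_numeral)
      also have "\<dots> \<le> 1 * 1" using B r r0 by (intro mult_mono power_le_one) auto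
      finally have a: "p x * ?r\<^sup>2 \<le> 1" by simp
      have "p x \<le> (1 - B) / \<rho> ^ 5 * \<rho> ^ 3"
        unfolding p_left[OF 1] using r r0 B rho by (intro mult_left_mono power_mono) auto
      also have "\<dots> = (1 - B) / \<rho>\<^sup>2" by (rule cube_over_fifth) (use rho in simp)
      also have "\<dots> \<le> 1 / t\<^sup>2" using B t by (intro frac_le power_mono) auto
      finally show ?thesis using a by simp
    next
      case 2
      then have r: "?r = \<rho> - x" "?r \<ge> t" by (auto simp: t_def)
      have "p x \<le> 1 / ?r\<^sup>2" using 2 r r0 B rho by (simp add: p_mid)
      moreover have "1 / ?r\<^sup>2 \<le> 1 / t\<^sup>2" using r t by (intro frac_le power_mono) auto
      moreover have "p x * ?r\<^sup>2 \<le> 1" using calculation(1) r0 by (simp add: le_divide_eq)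
      ultimately show ?thesis by linarith
    next
      case 3
      then have r: "?r = \<rho> - x" "?r \<le> t" using xt by (auto simp: t_def)
      have le: "p x \<le> 1 / t ^ 5 * ?r ^ 3"
        unfolding p_right[OF 3] r(1) using right_coeff r r0 by (intro mult_right_mono) auto
      have "p x * ?r\<^sup>2 \<le> 1 / t ^ 5 * ?r ^ 3 * ?r\<^sup>2" using le by (intro mult_right_mono) auto
      also have "\<dots> = (?r / t) ^ 5" by (simp add: power_divide eval_nat_numeral)
      also have "\<dots> \<le> 1" using r r0 t by (intro power_le_one) auto
      finally have a: "p x * ?r\<^sup>2 \<le> 1" .
      have "1 / t ^ 5 * ?r ^ 3 \<le> 1 / t ^ 5 * t ^ 3" using r r0 t by (intro mult_left_mono power_mono) auto
      also have "\<dots> = 1 / t\<^sup>2" by (rule cube_over_fifth) (use t in simp)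
      finally show ?thesis using a le by simp
    qed
  qed
  then show "p x * ?r\<^sup>2 \<le> 1" "p x \<le> 1 / t\<^sup>2" by auto
qed

lemma p_outside:
  assumes "\<rho> \<le> \<bar>real_of_int x\<bar>" "\<bar>real_of_int x\<bar> \<le> \<rho> + 2"
  shows "p x \<le> 0" "\<bar>p x\<bar> \<le> 8"
proof -
  have *: "u * r ^ 3 \<le> 0 \<and> \<bar>u * r ^ 3\<bar> \<le> 8" if "0 \<le> u" "u \<le> 1" "r \<le> 0" "-2 \<le> r" for u r :: real
  proof -
    have r: "r ^ 3 \<le> 0" using that by (simp add: power_le_zero_eq)
    have "\<bar>r\<bar> ^ 3 \<le> 2 ^ 3" using that by (intro power_mono) auto
    then have "\<bar>u * r ^ 3\<bar> \<le> 1 * 8" unfolding abs_mult power_abs using that by (intro mult_mono) auto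
    then show ?thesis using r that by (simp add: mult_nonneg_nonpos)
  qed
  have "p x \<le> 0 \<and> \<bar>p x\<bar> \<le> 8"
  proof (cases "x \<le> 0")
    case True
    have "\<rho> ^ 5 \<ge> 1" using rho by simp
    then have "(1 - B) / \<rho> ^ 5 \<le> 1 / 1" using B by (intro frac_le) auto
    then have "(1 - B) / \<rho> ^ 5 \<le> 1" by simp
    then show ?thesis unfolding p_left[OF True] using B rho assms True
      by (intro *) auto
  next
    case False
    have "t ^ 5 \<ge> 1" using t by simp
    then have "1 / t ^ 5 \<le> 1 / 1" by (intro frac_le) auto
    then have "1 / t ^ 5 \<le> 1" by simp
    moreover have "xt \<le> x" using False assms depth by linarith
    ultimately show ?thesis using right_coeff assms False unfolding p_right[OF \<open>xt \<le> x\<close>]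
      by (intro *) auto
  qed
  then show "p x \<le> 0" "\<bar>p x\<bar> \<le> 8" by auto
qed

lemma laplace_cube: "c * (u + 1) ^ 3 + c * (u - 1) ^ 3 - 2 * (c * u ^ 3) = 6 * c * (u :: real)"
  by (simp add: algebra_simps power3_eq_cube)

lemma laplace_left:
  assumes "x < 0"
  shows "laplace p x = 6 * ((1 - B) / \<rho> ^ 5) * (\<rho> + x)"
proof -
  have e: "\<rho> + real_of_int (x + 1) = (\<rho> + x) + 1" "\<rho> + real_of_int (x - 1) = (\<rho> + x) - 1" by auto
  have "p (x + 1) = (1 - B) / \<rho> ^ 5 * ((\<rho> + x) + 1) ^ 3" "p (x - 1) = (1 - B) / \<rho> ^ 5 * ((\<rho> + x) - 1) ^ 3"
    using assms e by (simp_all only: p_left)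
  then show ?thesis using assms laplace_cube[of "(1 - B) / \<rho> ^ 5" "\<rho> + x"]
    unfolding laplace_def by (simp only: p_left)
qed

lemma laplace_right:
  assumes "xt < x"
  shows "laplace p x = 6 * (1 / t ^ 5 - B / \<rho> ^ 5) * (\<rho> - x)"
proof -
  have e: "\<rho> - real_of_int (x + 1) = (\<rho> - x) - 1" "\<rho> - real_of_int (x - 1) = (\<rho> - x) + 1" by auto
  have "p (x + 1) = (1 / t ^ 5 - B / \<rho> ^ 5) * ((\<rho> - x) - 1) ^ 3"
    "p (x - 1) = (1 / t ^ 5 - B / \<rho> ^ 5) * ((\<rho> - x) + 1) ^ 3"
    using assms e by (simp_all only: p_right)
  then show ?thesis using assms laplace_cube[of "1 / t ^ 5 - B / \<rho> ^ 5" "\<rho> - x"]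
    unfolding laplace_def by (simp only: p_right)
qed

lemma laplace_mid:
  assumes "0 < x" "x < xt"
  defines "r \<equiv> \<rho> - real_of_int x"
  shows "laplace p x = 1 / (r - 1)\<^sup>2 + 1 / (r + 1)\<^sup>2 - 2 / r\<^sup>2 - 6 * (B / \<rho> ^ 5) * r"
proof -
  have e: "\<rho> - real_of_int (x + 1) = r - 1" "\<rho> - real_of_int (x - 1) = r + 1" "\<rho> - real_of_int x = r"
    by (auto simp: r_def)
  define b where "b = B / \<rho> ^ 5"
  have "laplace p x = (1 / (r - 1)\<^sup>2 - b * (r - 1) ^ 3) + (1 / (r + 1)\<^sup>2 - b * (r + 1) ^ 3)
      - 2 * (1 / r\<^sup>2 - b * r ^ 3)"
    using assms unfolding laplace_def b_def by (simp only: p_mid[of "x + 1"] p_mid[of "x - 1"] p_mid[of x] e)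
  also have "\<dots> = 1 / (r - 1)\<^sup>2 + 1 / (r + 1)\<^sup>2 - 2 / r\<^sup>2 - 6 * b * r"
    by (simp add: algebra_simps power3_eq_cube)
  finally show ?thesis by (simp add: b_def)
qed

end

text \<open>
  The function \<open>1 / r\<^sup>2\<close> solves the differential equation of the profile exactly, so its second
  difference solves it up to a fourth-order error; that error has the favourable sign.
\<close>

lemma inverse_square_second_difference:
  fixes r :: real
  assumes "r \<ge> 2"
  defines "e \<equiv> 1 / r\<^sup>2 - r\<^sup>2 / 6 * (1 / (r - 1)\<^sup>2 + 1 / (r + 1)\<^sup>2 - 2 / r\<^sup>2)"
  shows "e \<le> 0" "- (3 / r ^ 4) \<le> e"
proof -
  define w where "w = r\<^sup>2"
  have r4: "w \<ge> 4" using assms(1) power_mono[of 2 r 2] by (simp add: w_def)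
  have pos: "(r - 1)\<^sup>2 > 0" "(r + 1)\<^sup>2 > 0" "(w - 1)\<^sup>2 > 0" using assms r4 by auto
  have v: "(r - 1)\<^sup>2 * (r + 1)\<^sup>2 = (w - 1)\<^sup>2"
    unfolding power_mult_distrib[symmetric] w_def by (simp add: power2_eq_square algebra_simps)
  have "1 / (r - 1)\<^sup>2 + 1 / (r + 1)\<^sup>2 = ((r + 1)\<^sup>2 + (r - 1)\<^sup>2) / ((r - 1)\<^sup>2 * (r + 1)\<^sup>2)"
    using pos by (simp add: add_divide_eq_iff divide_add_eq_iff)
  also have "\<dots> = (2 * w + 2) / (w - 1)\<^sup>2"
    unfolding v by (simp add: w_def power2_eq_square algebra_simps)
  finally have "e = 1 / w - w / 6 * ((2 * w + 2) / (w - 1)\<^sup>2 - 2 / w)"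
    by (simp add: e_def w_def)
  also have "\<dots> = - (5 / 3 * w - 1) / (w * (w - 1)\<^sup>2)"
  proof -
    define V where "V = (w - 1)\<^sup>2"
    have V: "V \<noteq> 0" "w \<noteq> 0" using pos r4 by (auto simp: V_def)
    have "w / 6 * ((2 * w + 2) / V - 2 / w) = (w * w + w) / (3 * V) - 1 / 3"
      using V by (simp add: field_simps)
    then have "1 / w - w / 6 * ((2 * w + 2) / V - 2 / w) = 1 / w - ((w * w + w) / (3 * V) - 1 / 3)"
      by (simp only:)
    also have "\<dots> = 1 / w - (w * w + w) / (3 * V) + 1 / 3" by simp
    also have "\<dots> = (3 * V - (w * w + w) * w + w * V) / (3 * (w * V))"
      using V by (simp add: field_simps)
    also have "3 * V - (w * w + w) * w + w * V = - 3 * (5 / 3 * w - 1)"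
      unfolding V_def by (simp add: power2_eq_square algebra_simps)
    also have "- 3 * (5 / 3 * w - 1) / (3 * (w * V)) = - (5 / 3 * w - 1) / (w * V)"
    proof -
      have "- 3 * X / (3 * Y) = - X / Y" for X Y :: real by simp
      then show ?thesis .
    qed
    finally show ?thesis unfolding V_def .
  qed
  finally have e: "e = - (5 / 3 * w - 1) / (w * (w - 1)\<^sup>2)" .
  show "e \<le> 0" unfolding e using r4 by (intro divide_nonpos_nonneg) auto
  have "(5 / 3 * w - 1) * w \<le> 3 * (w - 1)\<^sup>2"
  proof -
    have "0 \<le> (w - 4) * (4 / 3 * w)" using r4 by simp
    moreover have "3 * (w - 1)\<^sup>2 - (5 / 3 * w - 1) * w = (w - 4) * (4 / 3 * w) + (w / 3 + 3)"
      by (simp add: power2_eq_square field_simps)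
    ultimately show ?thesis using r4 by linarith
  qed
  then have "(5 / 3 * w - 1) * (w * w) \<le> 3 * (w * (w - 1)\<^sup>2)"
    using r4 mult_right_mono[of "(5 / 3 * w - 1) * w" "3 * (w - 1)\<^sup>2" w] by (simp add: mult_ac)
  then have "(5 / 3 * w - 1) / (w * (w - 1)\<^sup>2) \<le> 3 / (w * w)"
    using r4 pos by (simp add: frac_le_eq divide_le_eq le_divide_eq mult_ac)
  then have "- (3 / (w * w)) \<le> e" unfolding e minus_divide_left[symmetric] by (rule le_imp_neg_le)
  moreover have "w * w = r ^ 4" by (simp add: w_def eval_nat_numeral)
  ultimately show "- (3 / r ^ 4) \<le> e" by simp
qed

text \<open>
  Expansion of the second difference of the profile at the origin, with \<open>e = 1 / \<rho>\<close>; the terms of order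
  \<open>1\<close> and \<open>e\<close> cancel by the choice of the coefficient \<open>1 / 6 + e\<close>.
\<close>

lemma origin_second_difference:
  fixes e :: real
  assumes "0 < e" "e \<le> 1 / 10"
  defines "q \<equiv> (2 / 3 - 2 * e) * (1 - e) ^ 3 - 2 * (5 / 6 - e) + 1 / (1 - e)\<^sup>2"
  shows "6 * (5 / 6 - e) * e\<^sup>2 \<le> q" "q \<le> 20 * e\<^sup>2"
proof -
  have d: "0 < (1 - e)\<^sup>2" using assms by simp
  have e4: "e ^ 3 \<ge> 0" "e ^ 4 \<ge> 0" "e ^ 3 \<le> e\<^sup>2 / 10" "e ^ 4 \<le> e ^ 3 / 10" "e ^ 5 \<ge> 0" "e ^ 5 \<le> e ^ 4"
    using assms(1,2) by (auto simp: eval_nat_numeral mult_le_cancel_left1 mult_le_one)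
  have "1 + 2 * e + 3 * e\<^sup>2 \<le> 1 / (1 - e)\<^sup>2"
  proof -
    have "(1 + 2 * e + 3 * e\<^sup>2) * (1 - e)\<^sup>2 = 1 - 4 * e ^ 3 + 3 * e ^ 4"
      by (simp add: algebra_simps eval_nat_numeral)
    also have "\<dots> \<le> 1" using e4 by linarith
    finally show ?thesis using d by (simp add: le_divide_eq)
  qed
  moreover have "1 / (1 - e)\<^sup>2 \<le> 1 + 2 * e + 3 * e\<^sup>2 + 6 * e ^ 3"
  proof -
    have "(1 + 2 * e + 3 * e\<^sup>2 + 6 * e ^ 3) * (1 - e)\<^sup>2 = 1 + 2 * e ^ 3 - 9 * e ^ 4 + 6 * e ^ 5"
      by (simp add: algebra_simps eval_nat_numeral)
    also have "\<dots> \<ge> 1" using e4 by linarith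
    finally show ?thesis using d by (simp add: divide_le_eq)
  qed
  moreover have "(2 / 3 - 2 * e) * (1 - e) ^ 3 - 2 * (5 / 6 - e) =
      - 1 - 2 * e + 8 * e\<^sup>2 - 20 / 3 * e ^ 3 + 2 * e ^ 4"
    by (simp add: algebra_simps eval_nat_numeral)
  moreover have "6 * (5 / 6 - e) * e\<^sup>2 = 5 * e\<^sup>2 - 6 * e ^ 3"
    by (simp add: algebra_simps eval_nat_numeral)
  ultimately show "6 * (5 / 6 - e) * e\<^sup>2 \<le> q" "q \<le> 20 * e\<^sup>2"
    unfolding q_def using e4 by linarith+
qed

lemma square_over_fifth:
  fixes a c d :: real
  assumes "a \<noteq> 0"
  shows "c / a ^ 5 * (d * a\<^sup>2) = c * d / a ^ 3"
  using assms by (simp add: field_simps flip: power_add)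

context inner_tooth begin

text \<open>
  A bound on how far below zero the potential can be at the ends of the other teeth.
\<close>

definition defect :: "int \<Rightarrow> real" where
  "defect x = (if x = 0 then 4 / \<rho>\<^sup>2 else if 0 < x \<and> x < xt then 3 / (\<rho> - x) ^ 4 else 0)"

lemma tooth_height_eq: "\<bar>real_of_int x\<bar> < \<rho> \<Longrightarrow> h x = (\<rho> - \<bar>real_of_int x\<bar>)\<^sup>2 / 3"
  by (simp add: tooth_height_def)

lemma laplace_origin:
  assumes "0 < xt"
  shows "laplace p 0 = ((2 / 3 - 2 * (1 / \<rho>)) * (1 - 1 / \<rho>) ^ 3 - 2 * (5 / 6 - 1 / \<rho>) + 1 / (1 - 1 / \<rho>)\<^sup>2) / \<rho>\<^sup>2"
proof -
  define e where "e = 1 / \<rho>"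
  have re: "\<rho> * e = 1" "e > 0" "e < 1" using rho by (auto simp: e_def)
  have "\<rho> - 1 = \<rho> * (1 - e)" using re by (simp add: algebra_simps)
  then have m: "(\<rho> - 1) ^ 3 = \<rho> ^ 3 * (1 - e) ^ 3" "(\<rho> - 1)\<^sup>2 = \<rho>\<^sup>2 * (1 - e)\<^sup>2"
    by (simp_all add: power_mult_distrib)
  have c: "u / \<rho> ^ 5 * (\<rho> ^ 3 * w) = u * w / \<rho>\<^sup>2" for u w
    using cube_over_fifth[of \<rho> u] rho by (simp add: mult.assoc[symmetric])
  have "p 1 = 1 / (\<rho> - 1)\<^sup>2 - B / \<rho> ^ 5 * (\<rho> - 1) ^ 3" using assms p_mid[of 1] by simp
  also have "\<dots> = (1 / (1 - e)\<^sup>2 - B * (1 - e) ^ 3) / \<rho>\<^sup>2"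
    unfolding m c by (simp add: diff_divide_distrib mult.commute)
  finally have p1: "p 1 = (1 / (1 - e)\<^sup>2 - B * (1 - e) ^ 3) / \<rho>\<^sup>2" .
  have "p (-1) = (1 - B) / \<rho> ^ 5 * (\<rho> - 1) ^ 3" using p_left[of "-1"] by simp
  also have "\<dots> = (1 - B) * (1 - e) ^ 3 / \<rho>\<^sup>2" unfolding m c ..
  finally have pm: "p (-1) = (1 - B) * (1 - e) ^ 3 / \<rho>\<^sup>2" .
  have "laplace p 0 = ((1 / (1 - e)\<^sup>2 - B * (1 - e) ^ 3) + (1 - B) * (1 - e) ^ 3 - 2 * (1 - B)) / \<rho>\<^sup>2"
    unfolding laplace_def by (simp add: p0 p1 pm add_divide_distrib diff_divide_distrib)
  also have "(1 / (1 - e)\<^sup>2 - B * (1 - e) ^ 3) + (1 - B) * (1 - e) ^ 3 - 2 * (1 - B) =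
      (2 / 3 - 2 * e) * (1 - e) ^ 3 - 2 * (5 / 6 - e) + 1 / (1 - e)\<^sup>2"
    unfolding B_def e_def[symmetric] by (simp add: algebra_simps)
  finally show ?thesis by (simp add: e_def)
qed

text \<open>
  The value of the potential at the (noninteger) end of a tooth. A cubic profile gives exactly zero.
\<close>

lemma tooth_end:
  assumes x: "x \<noteq> xt" "\<bar>real_of_int x\<bar> < \<rho>"
  shows "p x - h x * laplace p x / 2 \<le> 0" "- defect x \<le> p x - h x * laplace p x / 2"
proof -
  have cube: "c * u ^ 3 - u\<^sup>2 / 3 * (6 * c * u) / 2 = 0" for c u :: real
    by (simp add: power2_eq_square power3_eq_cube)
  have "p x - h x * laplace p x / 2 \<le> 0 \<and> - defect x \<le> p x - h x * laplace p x / 2"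
  proof -
    consider "x < 0" | "x = 0" | "0 < x" "x < xt" | "x > xt" using x by linarith
    then show ?thesis
    proof cases
      case 1
      then have "p x - h x * laplace p x / 2 = 0"
        unfolding tooth_height_eq[OF x(2)] laplace_left[OF 1] p_left[OF less_imp_le[OF 1]]
        using cube[of "(1 - B) / \<rho> ^ 5" "\<rho> + x"] by simp
      then show ?thesis using 1 by (simp add: defect_def)
    next
      case 2
      then have xt: "0 < xt" using x xt by simp
      define e where "e = 1 / \<rho>"
      define q where "q = (2 / 3 - 2 * e) * (1 - e) ^ 3 - 2 * (5 / 6 - e) + 1 / (1 - e)\<^sup>2"
      have e: "0 < e" "e \<le> 1 / 10" using rho by (auto simp: e_def field_simps)
      have q: "6 * (5 / 6 - e) * e\<^sup>2 \<le> q" "q \<le> 20 * e\<^sup>2"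
        unfolding q_def by (rule origin_second_difference[OF e])+
      have re: "\<rho>\<^sup>2 * e\<^sup>2 = 1" using rho by (simp add: e_def power_divide)
      have eq: "p x - h x * laplace p x / 2 = ((5 / 6 - e) - \<rho>\<^sup>2 * q / 6) / \<rho>\<^sup>2"
        unfolding 2 p0 laplace_origin[OF xt] e_def[symmetric] q_def[symmetric]
        using rho by (simp add: tooth_height_def B_def e_def field_simps)
      have "\<rho>\<^sup>2 * (6 * (5 / 6 - e) * e\<^sup>2) \<le> \<rho>\<^sup>2 * q" "\<rho>\<^sup>2 * q \<le> \<rho>\<^sup>2 * (20 * e\<^sup>2)"
        using q by (intro mult_left_mono; simp)+
      moreover have "\<rho>\<^sup>2 * (6 * (5 / 6 - e) * e\<^sup>2) = 6 * (5 / 6 - e)"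
        "\<rho>\<^sup>2 * (20 * e\<^sup>2) = 20"
      proof -
        have "\<rho>\<^sup>2 * (6 * (5 / 6 - e) * e\<^sup>2) = 6 * (5 / 6 - e) * (\<rho>\<^sup>2 * e\<^sup>2)" by (simp only: mult_ac)
        then show "\<rho>\<^sup>2 * (6 * (5 / 6 - e) * e\<^sup>2) = 6 * (5 / 6 - e)" by (simp only: re mult_1_right)
        have "\<rho>\<^sup>2 * (20 * e\<^sup>2) = 20 * (\<rho>\<^sup>2 * e\<^sup>2)" by (simp only: mult_ac)
        then show "\<rho>\<^sup>2 * (20 * e\<^sup>2) = 20" by (simp only: re mult_1_right)
      qed
      ultimately have "6 * (5 / 6 - e) \<le> \<rho>\<^sup>2 * q" "\<rho>\<^sup>2 * q \<le> 20"
        by (simp_all only:)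
      then have "(5 / 6 - e) - \<rho>\<^sup>2 * q / 6 \<le> 0" "-4 \<le> (5 / 6 - e) - \<rho>\<^sup>2 * q / 6"
        using e by (simp_all add: field_simps)
      then have "((5 / 6 - e) - \<rho>\<^sup>2 * q / 6) / \<rho>\<^sup>2 \<le> 0"
        "-4 / \<rho>\<^sup>2 \<le> ((5 / 6 - e) - \<rho>\<^sup>2 * q / 6) / \<rho>\<^sup>2"
        using divide_nonpos_nonneg divide_right_mono[of "-4" _ "\<rho>\<^sup>2"] zero_le_power2 by blast+
      then show ?thesis unfolding eq by (simp add: 2 defect_def)
    next
      case 3
      define r where "r = \<rho> - real_of_int x"
      have r: "r \<ge> 2" "h x = r\<^sup>2 / 3" using 3 depth x by (auto simp: r_def tooth_height_eq)
      have b: "B / \<rho> ^ 5 * r ^ 3 = r\<^sup>2 / 6 * (6 * (B / \<rho> ^ 5) * r)"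
        by (simp add: power2_eq_square power3_eq_cube)
      have "p x - h x * laplace p x / 2 =
          1 / r\<^sup>2 - r\<^sup>2 / 6 * (1 / (r - 1)\<^sup>2 + 1 / (r + 1)\<^sup>2 - 2 / r\<^sup>2)"
        unfolding laplace_mid[OF 3] p_mid[OF less_imp_le[OF 3(1)] less_imp_le[OF 3(2)]] r_def[symmetric] r(2) b
      proof -
        have gen: "a - k / 6 * m - k / 3 * (S - m) / 2 = a - k / 6 * S" for a k m S :: real
          by (simp add: field_simps)
        show "1 / r\<^sup>2 - r\<^sup>2 / 6 * (6 * (B / \<rho> ^ 5) * r) - r\<^sup>2 / 3 *
            (1 / (r - 1)\<^sup>2 + 1 / (r + 1)\<^sup>2 - 2 / r\<^sup>2 - 6 * (B / \<rho> ^ 5) * r) / 2 =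
            1 / r\<^sup>2 - r\<^sup>2 / 6 * (1 / (r - 1)\<^sup>2 + 1 / (r + 1)\<^sup>2 - 2 / r\<^sup>2)"
          by (rule gen)
      qed
      then show ?thesis
        using inverse_square_second_difference[OF r(1)] 3 by (simp add: defect_def r_def)
    next
      case 4
      then have "p x - h x * laplace p x / 2 = 0"
        unfolding tooth_height_eq[OF x(2)] laplace_right[OF 4] p_right[OF less_imp_le[OF 4]]
        using cube[of "1 / t ^ 5 - B / \<rho> ^ 5" "\<rho> - x"] xt by simp
      then show ?thesis using 4 xt by (simp add: defect_def)
    qed
  qed
  then show "p x - h x * laplace p x / 2 \<le> 0" "- defect x \<le> p x - h x * laplace p x / 2" by auto
qed

lemma h_pos: "\<bar>real_of_int x\<bar> < \<rho> \<Longrightarrow> h x > 0"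
  by (simp add: tooth_height_eq)

lemma laplace_nonneg:
  assumes x: "x \<noteq> xt" "\<bar>real_of_int x\<bar> < \<rho>"
  shows "0 \<le> laplace p x"
proof -
  have "0 \<le> h x * laplace p x" using tooth_end(1)[OF x] p_nonneg[OF x(2)] by linarith
  then show ?thesis using h_pos[OF x(2)] by (simp add: zero_le_mult_iff)
qed

lemma xt_inside: "\<bar>real_of_int xt\<bar> < \<rho>" using xt depth by simp

text \<open>
  At the target the profile has a concave corner, from \<open>1 / r\<^sup>2\<close> increasing to \<open>r ^ 3\<close> decreasing.
  This is where the potential gets its pole: on the target tooth it increases away from the backbone.
\<close>

lemma laplace_target: "laplace p xt \<le> 0" "- (12 / t ^ 3) \<le> laplace p xt"
proof -
  have one: "0 \<le> u * t ^ 3 - u * (t - 1) ^ 3 \<and> u * t ^ 3 - u * (t - 1) ^ 3 \<le> 3 / t ^ 3"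
    if u: "0 \<le> u" "u \<le> 1 / t ^ 5" for u
  proof -
    have d: "t ^ 3 - (t - 1) ^ 3 = 3 * t\<^sup>2 - 3 * t + 1"
      by (simp add: algebra_simps power2_eq_square power3_eq_cube)
    have "t \<le> t\<^sup>2" using t by (simp add: power2_eq_square)
    then have d0: "0 \<le> 3 * t\<^sup>2 - 3 * t + 1" "3 * t\<^sup>2 - 3 * t + 1 \<le> 3 * t\<^sup>2"
      using t by linarith+
    have "u * (3 * t\<^sup>2 - 3 * t + 1) \<le> 1 / t ^ 5 * (3 * t\<^sup>2)"
      using u d0 t by (intro mult_mono) auto
    also have "\<dots> = 3 / t ^ 3" using square_over_fifth[of t 1 3] t by simp
    finally show ?thesis using u d0 unfolding right_diff_distrib[symmetric] d by simp
  qed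
  have right: "0 \<le> p xt - p (xt + 1) \<and> p xt - p (xt + 1) \<le> 3 / t ^ 3"
  proof -
    have "p xt = (1 / t ^ 5 - B / \<rho> ^ 5) * t ^ 3" using p_right[of xt] by (simp add: t_def)
    moreover have "p (xt + 1) = (1 / t ^ 5 - B / \<rho> ^ 5) * (t - 1) ^ 3"
      using p_right[of "xt + 1"] by (simp add: t_def algebra_simps)
    ultimately show ?thesis using one right_coeff by simp
  qed
  have left: "0 \<le> p xt - p (xt - 1) \<and> p xt - p (xt - 1) \<le> 9 / t ^ 3"
  proof (cases "xt = 0")
    case True
    have "t = \<rho> - real_of_int xt" by (rule t_def)
    also have "\<dots> = \<rho>" using True by simp
    finally have tr: "t = \<rho>" .
    have "p xt = (1 - B) / t ^ 5 * t ^ 3" using p_left[of 0] True tr by simp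
    moreover have "p (xt - 1) = (1 - B) / t ^ 5 * (t - 1) ^ 3" using p_left[of "-1"] True tr by simp
    moreover have u: "0 \<le> (1 - B) / t ^ 5" "(1 - B) / t ^ 5 \<le> 1 / t ^ 5"
      using B t by (simp_all add: divide_right_mono)
    ultimately have "0 \<le> p xt - p (xt - 1) \<and> p xt - p (xt - 1) \<le> 3 / t ^ 3"
      using one[OF u] by (simp only:)
    moreover have "3 / t ^ 3 \<le> 9 / t ^ 3" using t by (simp add: divide_right_mono)
    ultimately show ?thesis by linarith
  next
    case False
    then have pos: "0 < xt" using xt by simp
    define b where "b = B / \<rho> ^ 5"
    have b: "0 \<le> b" "b \<le> 1 / t ^ 5"
      unfolding b_def using B rho right_coeff(1) by auto
    have px: "p xt = 1 / t\<^sup>2 - b * t ^ 3" using p_mid[of xt] xt by (simp add: t_def b_def)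
    have pm: "p (xt - 1) = 1 / (t + 1)\<^sup>2 - b * (t + 1) ^ 3"
      using p_mid[of "xt - 1"] pos by (simp add: t_def b_def algebra_simps)
    have s: "1 / t\<^sup>2 - 1 / (t + 1)\<^sup>2 \<ge> 0" "1 / t\<^sup>2 - 1 / (t + 1)\<^sup>2 \<le> 2 / t ^ 3"
    proof -
      show "1 / t\<^sup>2 - 1 / (t + 1)\<^sup>2 \<ge> 0" using t by (simp add: frac_le power_mono)
      have "1 / t\<^sup>2 - 1 / (t + 1)\<^sup>2 = ((t + 1)\<^sup>2 - t\<^sup>2) / (t\<^sup>2 * (t + 1)\<^sup>2)"
        using t by (simp add: diff_frac_eq)
      also have "(t + 1)\<^sup>2 - t\<^sup>2 = 2 * t + 1" by (simp add: power2_eq_square algebra_simps)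
      finally have "1 / t\<^sup>2 - 1 / (t + 1)\<^sup>2 = (2 * t + 1) / (t\<^sup>2 * (t + 1)\<^sup>2)" .
      also have "\<dots> \<le> 2 / t ^ 3"
      proof -
        have "(2 * t + 1) * t ^ 3 = ((2 * t + 1) * t) * t\<^sup>2" by (simp add: power2_eq_square power3_eq_cube)
        also have "\<dots> \<le> (2 * (t + 1)\<^sup>2) * t\<^sup>2"
          using t by (intro mult_right_mono) (auto simp: power2_eq_square algebra_simps)
        finally show ?thesis using t by (intro divide_le_eq[THEN iffD2]) (auto simp: field_simps)
      qed
      finally show "1 / t\<^sup>2 - 1 / (t + 1)\<^sup>2 \<le> 2 / t ^ 3" .
    qed
    have c: "0 \<le> b * ((t + 1) ^ 3 - t ^ 3)" "b * ((t + 1) ^ 3 - t ^ 3) \<le> 7 / t ^ 3"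
    proof -
      have d: "(t + 1) ^ 3 - t ^ 3 = 3 * t\<^sup>2 + 3 * t + 1"
        by (simp add: algebra_simps power2_eq_square power3_eq_cube)
      show "0 \<le> b * ((t + 1) ^ 3 - t ^ 3)" unfolding d using b t by simp
      have tt: "t \<le> t\<^sup>2" using t by (simp add: power2_eq_square)
      then have "1 \<le> t\<^sup>2" using t by linarith
      with tt have "b * ((t + 1) ^ 3 - t ^ 3) \<le> 1 / t ^ 5 * (7 * t\<^sup>2)"
        unfolding d using b t by (intro mult_mono) auto
      also have "\<dots> = 7 / t ^ 3" using square_over_fifth[of t 1 7] t by simp
      finally show "b * ((t + 1) ^ 3 - t ^ 3) \<le> 7 / t ^ 3" .
    qed
    have "p xt - p (xt - 1) = (1 / t\<^sup>2 - 1 / (t + 1)\<^sup>2) + b * ((t + 1) ^ 3 - t ^ 3)"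
      unfolding px pm by (simp add: algebra_simps)
    moreover have "2 / t ^ 3 + 7 / t ^ 3 = 9 / t ^ 3" by (simp add: add_divide_distrib[symmetric])
    ultimately show ?thesis using s c by linarith
  qed
  have "3 / t ^ 3 + 9 / t ^ 3 = 12 / t ^ 3" by (simp add: add_divide_distrib[symmetric])
  then show "laplace p xt \<le> 0" "- (12 / t ^ 3) \<le> laplace p xt"
    unfolding laplace_def using right left by linarith+
qed

end

lemma sum_single_le:
  fixes c :: real
  assumes "finite A" "c \<ge> 0"
  shows "(\<Sum>x\<in>A. if x = a then c else 0) \<le> c"
  using assms by (simp add: sum.delta)

context inner_tooth begin

text \<open>
  On the target tooth the free slope is chosen such that the potential vanishes at the lower end. All of the
  growth caused by the concave corner is thereby put on the upper half, towards the pole.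
\<close>

abbreviation "F \<equiv> comb_harmonic p (\<lambda>x. if x = xt then p xt / h xt - laplace p xt / 2 else 0)"

lemma F_off_target:
  assumes "x \<noteq> xt"
  shows "F (x, y) = p x - \<bar>real_of_int y\<bar> * laplace p x / 2"
  using assms by (simp add: comb_harmonic_def)

lemma F_target_neg: "y \<le> 0 \<Longrightarrow> F (xt, y) = p xt * (1 - \<bar>real_of_int y\<bar> / h xt)"
  by (simp add: comb_harmonic_def algebra_simps abs_if)

lemma F_target_pos: "y \<ge> 0 \<Longrightarrow> F (xt, y) = p xt + real_of_int y * (p xt / h xt - laplace p xt)"
  by (simp add: comb_harmonic_def algebra_simps)

lemma h_target: "h xt = t\<^sup>2 / 3" using tooth_height_eq[OF xt_inside] xt by (simp add: t_def)

lemma F_off_target_le: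
  assumes "x \<noteq> xt" "\<bar>real_of_int x\<bar> < \<rho>"
  shows "F (x, y) \<le> p x"
  using laplace_nonneg[OF assms] by (simp add: F_off_target[OF assms(1)])

lemma F_target_le:
  assumes "\<bar>real_of_int y\<bar> < h xt + 1"
  shows "F (xt, y) \<le> 9 / t"
proof -
  have p: "0 \<le> p xt" "p xt \<le> 1 / t\<^sup>2" using p_nonneg[OF xt_inside] p_le[OF xt_inside] by auto
  have t16: "t\<^sup>2 \<ge> 16" using t power_mono[of 4 t 2] by simp
  have hpos: "h xt > 0" using h_target t16 by simp
  have tt: "1 / t\<^sup>2 \<le> 1 / (4 * t)" using t by (intro divide_left_mono) (auto simp: power2_eq_square)
  have t9: "1 / (4 * t) \<le> 9 / t" "3 * (1 / (4 * t)) \<le> 1 / t" using t by (simp_all add: field_simps)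
  have t98: "9 / t = 8 / t + 1 / t" by (simp add: add_divide_distrib[symmetric])
  show ?thesis
  proof (cases "y \<le> 0")
    case True
    have "p xt * (1 - \<bar>real_of_int y\<bar> / h xt) \<le> p xt * 1"
      using p hpos by (intro mult_left_mono) auto
    also have "\<dots> \<le> 9 / t" using p tt t9 by linarith
    finally show ?thesis using True by (simp add: F_target_neg)
  next
    case False
    have y: "real_of_int y \<le> 2 * h xt" using assms False t16 unfolding h_target by simp
    have "real_of_int y * (p xt / h xt - laplace p xt) \<le> (2 * h xt) * (p xt / h xt + 12 / t ^ 3)"
    proof (intro mult_mono)
      have q: "0 \<le> p xt / h xt" using p hpos by simp
      show "p xt / h xt - laplace p xt \<le> p xt / h xt + 12 / t ^ 3" using laplace_target by linarith
      show "0 \<le> p xt / h xt - laplace p xt" using laplace_target q by linarith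
    qed (use y hpos in auto)
    also have "\<dots> = 2 * p xt + 24 * h xt / t ^ 3" using hpos by (simp add: field_simps)
    also have "24 * h xt / t ^ 3 = 8 / t" unfolding h_target using t by (simp add: power2_eq_square power3_eq_cube)
    finally have "F (xt, y) \<le> 3 * p xt + 8 / t" using False by (simp add: F_target_pos)
    also have "\<dots> \<le> 9 / t" using p tt t9 t98 by linarith
    finally show ?thesis .
  qed
qed

lemma F_target_nonneg:
  assumes "\<bar>real_of_int y\<bar> < h xt"
  shows "0 \<le> F (xt, y)"
proof (cases "y \<le> 0")
  case True
  have "\<bar>real_of_int y\<bar> / h xt \<le> 1" using assms h_pos[OF xt_inside] by simp
  then show ?thesis unfolding F_target_neg[OF True] using p_nonneg[OF xt_inside] by simp
next
  case False
  have "0 \<le> p xt / h xt" using p_nonneg[OF xt_inside] by simp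
  then have "0 \<le> p xt / h xt - laplace p xt" using laplace_target by linarith
  then show ?thesis
    using p_nonneg[OF xt_inside] False by (simp add: F_target_pos)
qed

text \<open>
  The height of the pole; it limits how large the parameter \<open>\<theta>\<close> of the product may be.
\<close>

lemma F_le:
  assumes "v \<in> \<D> \<rho> \<or> v = (xt, \<lceil>h xt\<rceil>)"
  shows "F v \<le> 9 / t"
proof (cases v)
  case (Pair x y)
  show ?thesis
  proof (cases "x = xt")
    case True
    have "\<bar>real_of_int y\<bar> < h xt + 1"
      using assms True by (auto simp: Pair \<D>_eq_Sigma tooth_sites_def)
        (use tooth_height_nonneg[of \<rho> xt] in linarith)+
    then show ?thesis using F_target_le True by (simp add: Pair)
  next
    case False
    then have x: "\<bar>real_of_int x\<bar> < \<rho>" using assms by (auto simp: Pair \<D>_eq_Sigma)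
    have "1 / t\<^sup>2 \<le> 9 / t" using t by (simp add: field_simps power2_eq_square)
    then show ?thesis using F_off_target_le[OF False x, of y] p_le(2)[OF x] by (simp add: Pair)
  qed
qed

text \<open>
  Off the target tooth, and on its lower half, the potential is nonincreasing away from the backbone and
  nonpositive at the end of the tooth, hence nonpositive at the first site outside. At the two ends of the backbone the profile itself is nonpositive.
\<close>

lemma F_exit:
  assumes "u \<in> \<D> \<rho>" "comb_adj u v" "v \<notin> \<D> \<rho>" "v \<noteq> (xt, \<lceil>h xt\<rceil>)"
  shows "F v \<le> 0"
proof (cases v)
  case (Pair x y)
  obtain x' y' where u: "u = (x', y')" by force
  have x': "\<bar>real_of_int x'\<bar> < \<rho>" "\<bar>real_of_int y'\<bar> < h x'"
    using assms(1) by (auto simp: u \<D>_eq_Sigma tooth_sites_def)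
  have adj: "x' = x \<and> \<bar>y' - y\<bar> = 1 \<or> y' = 0 \<and> y = 0 \<and> \<bar>x' - x\<bar> = 1"
    using assms(2) by (simp add: u Pair comb_adj_def)
  show ?thesis
  proof (cases "\<bar>real_of_int x\<bar> < \<rho>")
    case False
    then have "x' \<noteq> x" using x' by auto
    then have y: "y = 0" "\<bar>x' - x\<bar> = 1" using adj by auto
    then have "\<bar>real_of_int x\<bar> \<le> \<rho> + 2" using x'(1) by linarith
    then show ?thesis using p_outside(1)[of x] False y by (simp add: Pair comb_harmonic_def)
  next
    case True
    then have y: "h x \<le> \<bar>real_of_int y\<bar>"
      using assms(3) by (auto simp: Pair \<D>_eq_Sigma tooth_sites_def)
    show ?thesis
    proof (cases "x = xt")
      case False
      have "h x * laplace p x \<le> \<bar>real_of_int y\<bar> * laplace p x"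
        using laplace_nonneg[OF False True] y by (intro mult_right_mono)
      then show ?thesis using tooth_end(1)[OF False True] by (simp add: Pair F_off_target[OF False])
    next
      case eq: True
      show ?thesis
      proof (cases "y \<le> 0")
        case neg: True
        have "1 \<le> \<bar>real_of_int y\<bar> / h xt" using y h_pos[OF xt_inside] eq by simp
        then show ?thesis using p_nonneg[OF xt_inside] F_target_neg[OF neg] eq
          by (simp add: Pair mult_nonneg_nonpos)
      next
        case False
        then have "x' = x" "\<bar>y' - y\<bar> = 1" using adj by auto
        then have "y - 1 \<le> y'" "h x' = h xt" using eq by auto
        then have "real_of_int y - 1 < h xt" using x'(2) by linarith
        moreover have "h xt \<le> real_of_int y" using y eq False by simp
        ultimately have "y = \<lceil>h xt\<rceil>" by linarith
        then show ?thesis using assms(4) eq by (simp add: Pair)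
      qed
    qed
  qed
qed

lemma F_origin: "F (0, 0) = p 0" by (simp add: comb_harmonic_def)

lemma p_edge_weight: "\<bar>real_of_int x\<bar> < \<rho> \<Longrightarrow> p x \<le> 4 * edge_weight \<rho> x"
proof -
  assume x: "\<bar>real_of_int x\<bar> < \<rho>"
  have "1 / t\<^sup>2 \<le> 1" using t by (simp add: power2_eq_square divide_le_eq mult_ge1_I)
  then show ?thesis
    using p_le[OF x] x by (intro le_edge_weight[OF refl]) (auto simp: mult.commute)
qed

lemma defect_edge_weight:
  assumes "\<bar>real_of_int x\<bar> < \<rho>"
  shows "0 \<le> defect x" "(2 * h x + 1) * defect x \<le> 12 * edge_weight \<rho> x + (if x = 0 then 4 else 0)"
    "defect x \<le> 12 * edge_weight \<rho> x + (if x = 0 then 4 else 0)"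
proof -
  show d0: "0 \<le> defect x" using assms by (auto simp: defect_def)
  show *: "(2 * h x + 1) * defect x \<le> 12 * edge_weight \<rho> x + (if x = 0 then 4 else 0)"
  proof -
    consider "x = 0" | "0 < x" "x < xt" | "x < 0 \<or> x \<ge> xt \<and> x \<noteq> 0" by linarith
    then show ?thesis
    proof cases
      case 1
      have "\<rho>\<^sup>2 \<ge> 100" using rho power_mono[of 10 \<rho> 2] by simp
      then have "(2 * (\<rho>\<^sup>2 / 3) + 1) * (4 / \<rho>\<^sup>2) \<le> \<rho>\<^sup>2 * (4 / \<rho>\<^sup>2)"
        by (intro mult_right_mono) auto
      also have "\<dots> = 4" using rho by simp
      finally have "(2 * (\<rho>\<^sup>2 / 3) + 1) * (4 / \<rho>\<^sup>2) \<le> 4" .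
      moreover have "(2 * h x + 1) * defect x = (2 * (\<rho>\<^sup>2 / 3) + 1) * (4 / \<rho>\<^sup>2)"
        using 1 rho by (simp add: defect_def tooth_height_def)
      moreover have "(if x = 0 then 4 else 0 :: real) = 4" using 1 by simp
      ultimately show ?thesis using edge_weight_nonneg[of \<rho> x] by linarith
    next
      case 2
      define r where "r = \<rho> - real_of_int x"
      have r: "r \<ge> 4" using 2 depth by (simp add: r_def)
      have r2: "r\<^sup>2 \<ge> 16" using r power_mono[of 4 r 2] by simp
      have "1 / r\<^sup>2 \<le> 4 * edge_weight \<rho> x"
        using 2 r r2 by (intro le_edge_weight[of r]) (auto simp: r_def divide_le_eq)
      moreover have "(2 * h x + 1) * defect x \<le> r\<^sup>2 * (3 / r ^ 4)"
      proof -
        have "defect x = 3 / r ^ 4" "h x = r\<^sup>2 / 3" using 2 r by (auto simp: defect_def r_def tooth_height_def)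
        moreover have "(2 * (r\<^sup>2 / 3) + 1) * (3 / r ^ 4) \<le> r\<^sup>2 * (3 / r ^ 4)"
          using r2 by (intro mult_right_mono) auto
        ultimately show ?thesis by (simp only:)
      qed
      moreover have "r\<^sup>2 * (3 / r ^ 4) = 3 * (1 / r\<^sup>2)" using r by (simp add: eval_nat_numeral)
      ultimately show ?thesis using 2 by simp
    next
      case 3
      then have "defect x = 0" by (auto simp: defect_def)
      then show ?thesis using edge_weight_nonneg[of \<rho> x] by simp
    qed
  qed
  have "1 * defect x \<le> (2 * h x + 1) * defect x" using d0 by (intro mult_right_mono) auto
  then show "defect x \<le> 12 * edge_weight \<rho> x + (if x = 0 then 4 else 0)" using * by simp
qed

lemma card_tooth_le: "\<bar>real_of_int x\<bar> < \<rho> \<Longrightarrow> real (card (tooth_sites (h x))) \<le> 2 * h x + 1"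
  using card_tooth_sites[OF h_pos, of x] by linarith

lemma sum_over_inside_le:
  fixes f g :: "int \<Rightarrow> real"
  assumes "\<And>x. \<bar>real_of_int x\<bar> < \<rho> \<Longrightarrow> f x \<le> g x" "\<And>x. 0 \<le> g x"
  shows "(\<Sum>x | \<bar>real_of_int x\<bar> < \<rho>. f x) \<le> (\<Sum>x\<in>{-(\<lceil>\<rho>\<rceil> + 1)..\<lceil>\<rho>\<rceil> + 1}. g x)"
proof -
  have sub: "{x. \<bar>real_of_int x\<bar> < \<rho>} \<subseteq> {-(\<lceil>\<rho>\<rceil> + 1)..\<lceil>\<rho>\<rceil> + 1}"
    by (auto simp: abs_less_iff) linarith+
  have "(\<Sum>x | \<bar>real_of_int x\<bar> < \<rho>. f x) \<le> (\<Sum>x | \<bar>real_of_int x\<bar> < \<rho>. g x)"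
    using assms by (intro sum_mono) auto
  also have "\<dots> \<le> (\<Sum>x\<in>{-(\<lceil>\<rho>\<rceil> + 1)..\<lceil>\<rho>\<rceil> + 1}. g x)"
    using sub assms by (intro sum_mono2) auto
  finally show ?thesis .
qed

text \<open>
  Quadrature; the error terms are dominated by \<open>edge_weight\<close>, apart from the origin and the target.
\<close>

lemma sum_F_le: "(\<Sum>v\<in>\<D> \<rho>. F v) \<le> 4 / 9 * \<rho> ^ 3 * p 0 + 1500"
proof -
  let ?M = "\<lceil>\<rho>\<rceil> + 1"
  have err: "2 * \<bar>p x\<bar> + h x * \<bar>laplace p x\<bar> \<le>
      176 * edge_weight \<rho> x + (if x = 0 then 8 else 0) + (if x = xt then 1 else 0)"
    if x: "x \<in> {-?M..?M}" for x
  proof (cases "\<bar>real_of_int x\<bar> < \<rho>")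
    case True
    have p: "0 \<le> p x" "p x \<le> 4 * edge_weight \<rho> x" using p_nonneg p_edge_weight True by auto
    show ?thesis
    proof (cases "x = xt")
      case False
      have "h x * \<bar>laplace p x\<bar> = h x * laplace p x" using laplace_nonneg[OF False True] by simp
      then show ?thesis
        using tooth_end(2)[OF False True] defect_edge_weight(3)[OF True] p False edge_weight_nonneg[of \<rho> x]
        by (auto split: if_splits)
    next
      case eq: True
      have "h x * \<bar>laplace p x\<bar> \<le> t\<^sup>2 / 3 * (12 / t ^ 3)"
        unfolding eq h_target using laplace_target t by (intro mult_left_mono) auto
      also have "\<dots> = 4 / t" using t by (simp add: power2_eq_square power3_eq_cube)
      also have "\<dots> \<le> 1" using t by simp
      finally show ?thesis using p edge_weight_nonneg[of \<rho> x] eq by auto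
    qed
  next
    case False
    have x2: "\<bar>real_of_int x\<bar> \<le> \<rho> + 2" using x by (simp add: abs_le_iff) linarith
    have "\<bar>p x\<bar> \<le> 8" using p_outside(2) False x2 by simp
    moreover have "1 / 9 \<le> edge_weight \<rho> x"
    proof -
      have "(1 + \<bar>\<rho> - \<bar>real_of_int x\<bar>\<bar>)\<^sup>2 \<le> 3\<^sup>2" using False x2 by (intro power_mono) auto
      then have "1 / 9 \<le> 1 / (1 + \<bar>\<rho> - \<bar>real_of_int x\<bar>\<bar>)\<^sup>2"
        by (intro divide_left_mono) (auto intro!: mult_pos_pos simp: zero_less_power2)
      then show ?thesis using edge_weight_ge[of \<rho> x] by linarith
    qed
    moreover have "h x = 0" using False by (simp add: tooth_height_def)
    ultimately show ?thesis by auto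
  qed
  have "\<bar>(\<Sum>v\<in>\<D> \<rho>. F v) - 4 / 9 * \<rho> ^ 3 * p 0\<bar> \<le>
      \<rho> * \<bar>p 0\<bar> + (\<Sum>x\<in>{-?M..?M}. 2 * \<bar>p x\<bar> + h x * \<bar>laplace p x\<bar>)"
    using comb_quadrature[of \<rho>] rho by simp
  also have "(\<Sum>x\<in>{-?M..?M}. 2 * \<bar>p x\<bar> + h x * \<bar>laplace p x\<bar>) \<le>
      (\<Sum>x\<in>{-?M..?M}. 176 * edge_weight \<rho> x + (if x = 0 then 8 else 0) + (if x = xt then 1 else 0))"
    by (rule sum_mono[OF err])
  also have "\<dots> = 176 * (\<Sum>x\<in>{-?M..?M}. edge_weight \<rho> x) + (\<Sum>x\<in>{-?M..?M}. if x = 0 then 8 else 0)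
      + (\<Sum>x\<in>{-?M..?M}. if x = xt then 1 else 0)"
    by (simp add: sum.distrib sum_distrib_left)
  also have "\<dots> \<le> 176 * 8 + 8 + 1"
    using sum_edge_weight_le by (intro add_mono mult_left_mono sum_single_le) auto
  finally have "\<bar>(\<Sum>v\<in>\<D> \<rho>. F v) - 4 / 9 * \<rho> ^ 3 * p 0\<bar> \<le> \<rho> * \<bar>p 0\<bar> + 1417" by simp
  moreover have "\<rho> * \<bar>p 0\<bar> \<le> 1"
  proof -
    have "\<rho> * \<bar>p 0\<bar> \<le> \<rho> * (1 / \<rho>\<^sup>2)" using p0_bounds p_nonneg[of 0] rho by (intro mult_left_mono) auto
    also have "\<dots> \<le> 1" using rho by (simp add: power2_eq_square)
    finally show ?thesis .
  qed
  ultimately show ?thesis by linarith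
qed

text \<open>
  Negative values occur only near the ends of the teeth and are at least \<open>- defect x\<close>, so truncating them
  costs little.
\<close>

lemma sum_pos_F_le: "(\<Sum>v\<in>\<D> \<rho>. max 0 (F v)) \<le> 4 / 9 * \<rho> ^ 3 * p 0 + 1600"
proof -
  let ?M = "\<lceil>\<rho>\<rceil> + 1"
  have neg: "max 0 (F (x, y)) \<le> F (x, y) + defect x"
    if x: "\<bar>real_of_int x\<bar> < \<rho>" and y: "y \<in> tooth_sites (h x)" for x y
  proof (cases "x = xt")
    case True
    have "\<bar>real_of_int y\<bar> < h xt" using y True by (simp add: tooth_sites_def)
    then show ?thesis using F_target_nonneg defect_edge_weight(1)[OF x] True by simp
  next
    case False
    have "\<bar>real_of_int y\<bar> * laplace p x \<le> h x * laplace p x"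
      using laplace_nonneg[OF False x] y by (intro mult_right_mono) (auto simp: tooth_sites_def)
    then have "- defect x \<le> F (x, y)" using tooth_end(2)[OF False x] by (simp add: F_off_target[OF False])
    then show ?thesis using defect_edge_weight(1)[OF x] by auto
  qed
  have "(\<Sum>v\<in>\<D> \<rho>. max 0 (F v)) \<le> (\<Sum>v\<in>\<D> \<rho>. F v) + (\<Sum>x | \<bar>real_of_int x\<bar> < \<rho>. (2 * h x + 1) * defect x)"
  proof -
    have "(\<Sum>v\<in>\<D> \<rho>. max 0 (F v)) \<le> (\<Sum>x | \<bar>real_of_int x\<bar> < \<rho>. \<Sum>y\<in>tooth_sites (h x). F (x, y) + defect x)"
      unfolding sum_\<D> by (intro sum_mono neg) auto
    also have "\<dots> = (\<Sum>v\<in>\<D> \<rho>. F v) + (\<Sum>x | \<bar>real_of_int x\<bar> < \<rho>. real (card (tooth_sites (h x))) * defect x)"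
      unfolding sum_\<D> by (simp add: sum.distrib)
    also have "\<dots> \<le> (\<Sum>v\<in>\<D> \<rho>. F v) + (\<Sum>x | \<bar>real_of_int x\<bar> < \<rho>. (2 * h x + 1) * defect x)"
      using card_tooth_le defect_edge_weight(1) by (intro add_left_mono sum_mono mult_right_mono) auto
    finally show ?thesis .
  qed
  also have "(\<Sum>x | \<bar>real_of_int x\<bar> < \<rho>. (2 * h x + 1) * defect x) \<le>
      (\<Sum>x\<in>{-?M..?M}. 12 * edge_weight \<rho> x + (if x = 0 then 4 else 0))"
    by (rule sum_over_inside_le[OF defect_edge_weight(2)]) auto
  also have "\<dots> = 12 * (\<Sum>x\<in>{-?M..?M}. edge_weight \<rho> x) + (\<Sum>x\<in>{-?M..?M}. if x = 0 then 4 else 0)"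
    by (simp add: sum.distrib sum_distrib_left)
  also have "\<dots> \<le> 12 * 8 + 4"
    using sum_edge_weight_le by (intro add_mono mult_left_mono sum_single_le) auto
  finally show ?thesis using sum_F_le by linarith
qed

text \<open>
  Away from the target \<open>F \<le> p\<close> and \<open>h * p \<le> 1 / 3\<close>, so the squares sum to a multiple of the sum of \<open>p\<close>;
  on the target there are \<open>O(t\<^sup>2)\<close> sites with values \<open>O(1 / t)\<close>.
\<close>

lemma sum_sq_F_le: "(\<Sum>v\<in>\<D> \<rho>. (max 0 (F v))\<^sup>2) \<le> 200"
proof -
  let ?M = "\<lceil>\<rho>\<rceil> + 1"
  have row: "(\<Sum>y\<in>tooth_sites (h x). (max 0 (F (x, y)))\<^sup>2) \<le> 8 * edge_weight \<rho> x + (if x = xt then 81 else 0)"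
    if x: "\<bar>real_of_int x\<bar> < \<rho>" for x
  proof (cases "x = xt")
    case True
    have "(\<Sum>y\<in>tooth_sites (h x). (max 0 (F (x, y)))\<^sup>2) \<le> (\<Sum>y\<in>tooth_sites (h x). (9 / t)\<^sup>2)"
      using F_target_le t True by (intro sum_mono power_mono) (auto simp: tooth_sites_def)
    also have "\<dots> \<le> (2 * (t\<^sup>2 / 3) + 1) * (9 / t)\<^sup>2"
      using card_tooth_le[OF x] by (simp add: True h_target mult_right_mono)
    also have "\<dots> \<le> t\<^sup>2 * (9 / t)\<^sup>2"
      using t power_mono[of 4 t 2] by (intro mult_right_mono) auto
    also have "\<dots> = 81" using t by (simp add: power_divide)
    finally show ?thesis using True by (simp add: add_increasing)
  next
    case False
    have p: "0 \<le> p x" "p x \<le> 1" using p_nonneg[OF x] p_le(2)[OF x] t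
      by (auto simp: power2_eq_square divide_le_eq mult_ge1_I intro: order_trans)
    have hp: "h x * p x \<le> 1 / 3" using p_le(1)[OF x] by (simp add: tooth_height_eq[OF x] mult.commute)
    have "(\<Sum>y\<in>tooth_sites (h x). (max 0 (F (x, y)))\<^sup>2) \<le> (\<Sum>y\<in>tooth_sites (h x). (p x)\<^sup>2)"
      using F_off_target_le[OF False x] p by (intro sum_mono power_mono) auto
    also have "\<dots> \<le> (2 * h x + 1) * (p x)\<^sup>2" using card_tooth_le[OF x] by (simp add: mult_right_mono)
    also have "\<dots> = 2 * (h x * p x) * p x + p x * p x" by (simp add: power2_eq_square algebra_simps)
    also have "\<dots> \<le> 2 * (1 / 3) * p x + 1 * p x"
      using p hp by (intro add_mono mult_right_mono mult_left_mono) auto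
    also have "\<dots> \<le> 2 * p x" using p by simp
    also have "\<dots> \<le> 8 * edge_weight \<rho> x" using p_edge_weight[OF x] by simp
    finally show ?thesis using False by simp
  qed
  have "(\<Sum>v\<in>\<D> \<rho>. (max 0 (F v))\<^sup>2) \<le> (\<Sum>x\<in>{-?M..?M}. 8 * edge_weight \<rho> x + (if x = xt then 81 else 0))"
    unfolding sum_\<D> by (rule sum_over_inside_le) (use row in auto)
  also have "\<dots> = 8 * (\<Sum>x\<in>{-?M..?M}. edge_weight \<rho> x) + (\<Sum>x\<in>{-?M..?M}. if x = xt then 81 else 0)"
    by (simp add: sum.distrib sum_distrib_left)
  also have "\<dots> \<le> 8 * 8 + 81"
    using sum_edge_weight_le by (intro add_mono mult_left_mono sum_single_le) auto
  finally show ?thesis by simp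
qed

end

section \<open>The inner bound\<close>

definition reflect :: "int \<Rightarrow> int \<Rightarrow> int \<times> int \<Rightarrow> int \<times> int" where
  "reflect \<sigma> \<tau> v = (\<sigma> * fst v, \<tau> * snd v)"

lemma sign_cases: "\<bar>\<sigma>\<bar> = (1::int) \<Longrightarrow> \<sigma> = 1 \<or> \<sigma> = -1" by auto

lemma reflect_reflect: "\<bar>\<sigma>\<bar> = 1 \<Longrightarrow> \<bar>\<tau>\<bar> = 1 \<Longrightarrow> reflect \<sigma> \<tau> (reflect \<sigma> \<tau> v) = v"
  by (auto simp: reflect_def dest!: sign_cases)

lemma comb_adj_reflect: "\<bar>\<sigma>\<bar> = 1 \<Longrightarrow> \<bar>\<tau>\<bar> = 1 \<Longrightarrow> comb_adj (reflect \<sigma> \<tau> u) (reflect \<sigma> \<tau> v) = comb_adj u v"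
  by (auto simp: reflect_def comb_adj_def abs_minus_commute dest!: sign_cases)

lemma reflect_\<D>: "\<bar>\<sigma>\<bar> = 1 \<Longrightarrow> \<bar>\<tau>\<bar> = 1 \<Longrightarrow> reflect \<sigma> \<tau> v \<in> \<D> \<rho> \<longleftrightarrow> v \<in> \<D> \<rho>"
  by (cases v) (auto simp: reflect_def \<D>_def dest!: sign_cases)

lemma sum_reflect_\<D>:
  assumes "\<bar>\<sigma>\<bar> = 1" "\<bar>\<tau>\<bar> = 1"
  shows "(\<Sum>v\<in>\<D> \<rho>. f (reflect \<sigma> \<tau> v)) = (\<Sum>v\<in>\<D> \<rho>. f v)"
  by (rule sum.reindex_bij_witness[of _ "reflect \<sigma> \<tau>" "reflect \<sigma> \<tau>"])
    (use assms in \<open>auto simp: reflect_reflect reflect_\<D>\<close>)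

lemma nbr_mean_reflect:
  assumes "\<bar>\<sigma>\<bar> = 1" "\<bar>\<tau>\<bar> = 1"
  shows "nbr_mean (\<lambda>v. H (reflect \<sigma> \<tau> v)) v = nbr_mean H (reflect \<sigma> \<tau> v)"
proof -
  have inj: "inj_on (reflect \<sigma> \<tau>) A" for A
    using reflect_reflect[OF assms] by (metis inj_on_inverseI)
  have img: "comb_nbrs (reflect \<sigma> \<tau> v) = reflect \<sigma> \<tau> ` comb_nbrs v"
  proof (intro equalityI subsetI)
    fix w assume "w \<in> comb_nbrs (reflect \<sigma> \<tau> v)"
    then have "reflect \<sigma> \<tau> w \<in> comb_nbrs v"
      using comb_adj_reflect[OF assms, of "reflect \<sigma> \<tau> v" w] by (simp add: comb_nbrs_def reflect_reflect assms)
    then show "w \<in> reflect \<sigma> \<tau> ` comb_nbrs v"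
      using reflect_reflect[OF assms] by (metis image_eqI)
  qed (auto simp: comb_nbrs_def comb_adj_reflect assms)
  show ?thesis unfolding nbr_mean_def img by (simp add: sum.reindex[OF inj] card_image[OF inj])
qed

text \<open>
  A walk that is already outside the larger set when it leaves the smaller one leaves both at the same moment.
\<close>

lemma first_outside_superset:
  assumes "proper_path w" "finite S" "S \<subseteq> S'" "first_outside S w \<notin> S'"
  shows "first_outside S' w = first_outside S w"
proof -
  obtain \<tau> where t: "first_outside S w = w \<tau>" "w \<tau> \<notin> S" "\<And>t. t < \<tau> \<Longrightarrow> w t \<in> S"
    using first_outside_facts[OF assms(1,2)] by blast
  have "(LEAST t. w t \<notin> S') = \<tau>"
    using t assms(3,4) by (intro Least_equality) (auto simp: not_less[symmetric])
  then show ?thesis using t by (simp add: first_outside_def)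
qed

lemma one_plus_ge_exp:
  fixes x :: real
  assumes "\<bar>x\<bar> \<le> 1 / 2"
  shows "exp (x - 2 * x\<^sup>2) \<le> 1 + x"
proof -
  have "x - 2 * x\<^sup>2 \<le> ln (1 + x)"
    using abs_ln_one_plus_x_minus_x_bound[OF assms] by linarith
  moreover have "1 + x > 0" using assms by linarith
  ultimately show ?thesis using ln_ge_iff by blast
qed

lemma explorer_product_ge_exp:
  assumes "\<And>j. j < k \<Longrightarrow> exp (f j) \<le> \<Psi> (frozen_idla R \<omega> j) (first_outside (S (frozen_idla R \<omega> j)) (\<omega> j))"
  shows "ennreal (exp (\<Sum>j<k. f j)) \<le> explorer_product R S \<Psi> k \<omega>"
proof -
  have "ennreal (exp (\<Sum>j<k. f j)) = (\<Prod>j<k. ennreal (exp (f j)))"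
    by (simp add: exp_sum prod_ennreal)
  also have "\<dots> \<le> explorer_product R S \<Psi> k \<omega>"
    unfolding explorer_product_def using assms by (intro prod_mono_ennreal ennreal_leI) auto
  finally show ?thesis .
qed

text \<open>
  The exceptional event is existentially quantified so that \<open>Q\<close> need not be shown measurable.
  The restriction to proper paths keeps null sets out of the later arguments.
\<close>

definition fails_within :: "real \<Rightarrow> ((nat \<Rightarrow> nat \<Rightarrow> int \<times> int) \<Rightarrow> bool) \<Rightarrow> bool" where
  "fails_within q Q \<longleftrightarrow> (\<exists>E\<in>sets explorers_law. measure explorers_law E \<le> q \<and>
     (\<forall>\<omega>. (\<forall>k. proper_path (\<omega> k)) \<longrightarrow> \<omega> \<notin> E \<longrightarrow> Q \<omega>))"

lemma fails_within_Ball: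
  assumes "finite I" "\<And>i. i \<in> I \<Longrightarrow> fails_within q (Q i)"
  shows "fails_within (real (card I) * q) (\<lambda>\<omega>. \<forall>i\<in>I. Q i \<omega>)"
proof -
  have "\<forall>i\<in>I. \<exists>E. E \<in> sets explorers_law \<and> measure explorers_law E \<le> q \<and>
     (\<forall>\<omega>. (\<forall>k. proper_path (\<omega> k)) \<longrightarrow> \<omega> \<notin> E \<longrightarrow> Q i \<omega>)"
    using assms(2) unfolding fails_within_def by blast
  then obtain E where E: "\<And>i. i \<in> I \<Longrightarrow> E i \<in> sets explorers_law"
    "\<And>i. i \<in> I \<Longrightarrow> measure explorers_law (E i) \<le> q"
    "\<And>i \<omega>. i \<in> I \<Longrightarrow> (\<forall>k. proper_path (\<omega> k)) \<Longrightarrow> \<omega> \<notin> E i \<Longrightarrow> Q i \<omega>"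
    by metis
  have "measure explorers_law (\<Union>i\<in>I. E i) \<le> (\<Sum>i\<in>I. measure explorers_law (E i))"
    using E assms(1) by (intro EP.finite_measure_subadditive_finite) auto
  also have "\<dots> \<le> (\<Sum>i\<in>I. q)" by (intro sum_mono E)
  finally have "measure explorers_law (\<Union>i\<in>I. E i) \<le> real (card I) * q" by simp
  moreover have "(\<Union>i\<in>I. E i) \<in> sets explorers_law" using E assms(1) by auto
  ultimately show ?thesis unfolding fails_within_def using E(3) by blast
qed

lemma fails_within_mono:
  assumes "fails_within q Q" "q \<le> q'" "\<And>\<omega>. (\<forall>k. proper_path (\<omega> k)) \<Longrightarrow> Q \<omega> \<Longrightarrow> Q' \<omega>"
  shows "fails_within q' Q'"
  using assms unfolding fails_within_def by (meson order_trans)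

lemma fails_within_weaken: "fails_within q Q \<Longrightarrow> (\<And>\<omega>. Q \<omega> \<Longrightarrow> Q' \<omega>) \<Longrightarrow> fails_within q Q'"
  by (erule fails_within_mono) auto

lemma fails_within_conj:
  assumes "fails_within q P" "fails_within r Q"
  shows "fails_within (q + r) (\<lambda>\<omega>. P \<omega> \<and> Q \<omega>)"
proof -
  obtain E E' where E: "E \<in> sets explorers_law" "measure explorers_law E \<le> q"
      "\<And>\<omega>. (\<forall>k. proper_path (\<omega> k)) \<Longrightarrow> \<omega> \<notin> E \<Longrightarrow> P \<omega>"
    and E': "E' \<in> sets explorers_law" "measure explorers_law E' \<le> r"
      "\<And>\<omega>. (\<forall>k. proper_path (\<omega> k)) \<Longrightarrow> \<omega> \<notin> E' \<Longrightarrow> Q \<omega>"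
    using assms unfolding fails_within_def by blast
  have "measure explorers_law (E \<union> E') \<le> q + r"
    using measure_Un_le[OF E(1) E'(1)] E(2) E'(2) by linarith
  then show ?thesis unfolding fails_within_def using E E' by (intro bexI[of _ "E \<union> E'"]) auto
qed

context inner_tooth begin

text \<open>
  The product of \<open>1 + \<theta> * (p 0 - F)\<close>. As long as the pole is missed, an explorer either settles at a new site
  of \<open>\<D> \<rho>\<close> or leaves at a boundary point where \<open>F \<le> 0\<close>. The sum of \<open>F\<close> over the exit
  points is then at most the sum of its positive part over \<open>\<D> \<rho>\<close>, about
  \<open>4 / 9 * \<rho> ^ 3 * p 0\<close>, which falls short of the mean \<open>N * p 0\<close>. The last two terms of
  \<open>K\<close> bound the quadratic error of \<open>ln (1 + x)\<close>.
\<close>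

lemma tip_reached:
  fixes \<sigma> \<tau> :: int and \<theta> :: real and R :: "(int \<times> int) set" and N :: nat
  assumes sgn: "\<bar>\<sigma>\<bar> = 1" "\<bar>\<tau>\<bar> = 1" and lam: "0 < \<theta>" "36 * \<theta> \<le> t" "4 * \<theta> \<le> \<rho>\<^sup>2" and R: "\<D> \<rho> \<subseteq> R"
  defines "K \<equiv> \<theta> * (p 0 * (real N - 4 / 9 * \<rho> ^ 3) - 1600) - 4 * \<theta>\<^sup>2 * (p 0)\<^sup>2 * real N - 800 * \<theta>\<^sup>2"
  shows "fails_within (exp (- K)) (\<lambda>\<omega>. (\<sigma> * xt, \<tau> * \<lceil>h xt\<rceil>) \<in> frozen_idla R \<omega> N)"
proof -
  \<comment> \<open>The reflections move the pole into the quadrant of the locale.\<close>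
  define z where "z = (\<sigma> * xt, \<tau> * \<lceil>h xt\<rceil>)"
  define H where "H = (\<lambda>v. F (reflect \<sigma> \<tau> v))"
  define S where "S = (\<lambda>A. A \<inter> \<D> \<rho>)"
  define \<Psi> :: "(int \<times> int) set \<Rightarrow> int \<times> int \<Rightarrow> real" where "\<Psi> = (\<lambda>A v. 1 + \<theta> * (p 0 - H v))"
  have p0: "0 \<le> p 0" "\<theta> * p 0 \<le> 1 / 4"
  proof -
    show "0 \<le> p 0" using p_nonneg[of 0] rho by simp
    have "\<theta> * p 0 \<le> \<theta> * (1 / \<rho>\<^sup>2)" using p0_bounds lam by (intro mult_left_mono) auto
    also have "\<dots> \<le> 1 / 4" using lam rho by (simp add: field_simps)
    finally show "\<theta> * p 0 \<le> 1 / 4" .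
  qed
  have small: "\<theta> * u \<le> 1 / 4" if "u \<le> 9 / t" for u
  proof -
    have "\<theta> * u \<le> \<theta> * (9 / t)" using that lam by (intro mult_left_mono) auto
    also have "\<dots> \<le> 1 / 4" using lam t by (simp add: field_simps)
    finally show ?thesis .
  qed
  have zrefl: "reflect \<sigma> \<tau> v = (xt, \<lceil>h xt\<rceil>) \<longleftrightarrow> v = z" for v
    using reflect_reflect[OF sgn] unfolding z_def reflect_def by (metis fst_conv snd_conv)
  have H_le: "H v \<le> 9 / t" if "v \<in> \<D> \<rho> \<or> v = z" for v
    unfolding H_def using that by (intro F_le) (auto simp: reflect_\<D> sgn zrefl)
  have H_exit: "H v \<le> 0" if "u \<in> \<D> \<rho>" "comb_adj u v" "v \<notin> \<D> \<rho>" "v \<noteq> z" for u v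
    unfolding H_def using that
    by (intro F_exit[of "reflect \<sigma> \<tau> u"]) (auto simp: reflect_\<D> sgn zrefl comb_adj_reflect)
  have H0: "H (0, 0) = p 0" by (simp add: H_def reflect_def F_origin)
  have O: "(0, 0) \<in> \<D> \<rho>" using rho by (simp add: \<D>_def)
  have mean: "nbr_mean (\<Psi> A) v = \<Psi> A v" for A v
  proof -
    have H: "nbr_mean H v = H v"
      unfolding H_def nbr_mean_reflect[OF sgn] by (rule nbr_mean_comb_harmonic)
    have c: "card (comb_nbrs v) \<noteq> 0" using finite_comb_nbrs comb_nbrs_nonempty by simp
    have "nbr_mean (\<Psi> A) v = 1 + \<theta> * (p 0 - nbr_mean H v)"
      unfolding nbr_mean_def \<Psi>_def using c
      by (simp add: sum.distrib sum_subtractf field_simps flip: sum_distrib_left)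
    then show ?thesis by (simp add: H \<Psi>_def)
  qed
  have nonneg: "0 \<le> \<Psi> A v" if cl: "v \<in> comb_closure (S A)" for A v
  proof -
    have "\<theta> * H v \<le> 1 / 4"
    proof (cases "v \<in> \<D> \<rho> \<or> v = z")
      case True
      then show ?thesis by (intro small H_le)
    next
      case False
      then obtain u where "u \<in> \<D> \<rho>" "comb_adj u v"
        using cl O by (auto simp: comb_closure_def S_def comb_nbrs_def)
      then have "H v \<le> 0" using H_exit False by blast
      then show ?thesis using small[of "H v"] t by (simp add: order_trans)
    qed
    moreover have "0 \<le> \<theta> * p 0" using p0 lam by simp
    ultimately show ?thesis unfolding \<Psi>_def right_diff_distrib by linarith
  qed
  let ?E = "{\<omega>. ennreal (exp K) \<le> explorer_product R S \<Psi> N \<omega>}"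
  have E: "?E \<in> sets explorers_law" "measure explorers_law ?E \<le> 1 / exp K"
  proof -
    have 1: "finite A \<Longrightarrow> finite (S A)" for A by (simp add: S_def)
    have 2: "finite A \<Longrightarrow> v \<in> S A \<Longrightarrow> nbr_mean (\<Psi> A) v \<le> \<Psi> A v" for A v by (simp add: mean)
    have 4: "finite A \<Longrightarrow> \<Psi> A (0, 0) \<le> 1" for A by (simp add: \<Psi>_def H0)
    show "?E \<in> sets explorers_law" "measure explorers_law ?E \<le> 1 / exp K"
      by (rule explorer_product_markov[OF 1 2 nonneg 4]; simp)+
  qed
  have "z \<in> frozen_idla R \<omega> N" if proper: "\<forall>k. proper_path (\<omega> k)" and nE: "\<omega> \<notin> ?E" for \<omega>
  proof (rule ccontr)
    assume nz: "z \<notin> frozen_idla R \<omega> N"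
    let ?A = "frozen_idla R \<omega>"
    define Y where "Y = (\<lambda>j. first_outside (S (?A j)) (\<omega> j))"
    have finS: "finite (S (?A j))" for j by (simp add: S_def)
    have Y1: "Y j \<notin> S (?A j)" for j
      unfolding Y_def using first_outside_cases(1)[OF _ finS] proper by blast
    \<comment> \<open>An exit at an unoccupied site is where the explorer settles, since \<open>\<D> \<rho> \<subseteq> R\<close>.\<close>
    have settle: "Y j \<in> ?A (Suc j)" if "Y j \<notin> ?A j" for j
    proof -
      have "first_outside (?A j \<inter> R) (\<omega> j) = Y j"
        unfolding Y_def using proper R that finS
        by (intro first_outside_superset) (auto simp: S_def Y_def)
      then show ?thesis by simp
    qed
    have Ynz: "Y j \<noteq> z" if "j < N" for j
    proof
      assume "Y j = z"
      moreover have "z \<notin> ?A j" "z \<notin> ?A (Suc j)"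
        using nz that frozen_idla_mono[of j N R \<omega>] frozen_idla_mono[of "Suc j" N R \<omega>] by auto
      ultimately show False using settle by auto
    qed
    have Yexit: "H (Y j) \<le> 0" if j: "j < N" "Y j \<notin> \<D> \<rho>" for j
    proof -
      have "Y j = (0, 0) \<or> (\<exists>u\<in>S (?A j). comb_adj u (Y j))"
        unfolding Y_def using first_outside_cases(2)[OF _ finS] proper by blast
      then obtain u where "u \<in> \<D> \<rho>" "comb_adj u (Y j)" using j O by (auto simp: S_def)
      then show ?thesis using H_exit j Ynz by blast
    qed
    \<comment> \<open>Exits outside \<open>\<D> \<rho>\<close> have \<open>H \<le> 0\<close> and cost nothing; the others are charged to distinct sites.\<close>
    define G where "G = (\<lambda>v. max 0 (H v))"
    define cost where "cost = (\<lambda>v. \<theta> * G v + 4 * \<theta>\<^sup>2 * (G v)\<^sup>2)"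
    define f where "f = (\<lambda>j. (\<theta> * p 0 - 4 * \<theta>\<^sup>2 * (p 0)\<^sup>2) - (if Y j \<in> \<D> \<rho> then cost (Y j) else 0))"
    have factor: "exp (f j) \<le> \<Psi> (?A j) (Y j)" if j: "j < N" for j
    proof -
      define g where "g = (if Y j \<in> \<D> \<rho> then G (Y j) else 0)"
      have g: "0 \<le> g" "H (Y j) \<le> g" "\<theta> * g \<le> 1 / 4"
        using Yexit[OF j] small[OF H_le, of "Y j"] lam by (auto simp: g_def G_def max_def)
      define x where "x = \<theta> * (p 0 - g)"
      have lg: "0 \<le> \<theta> * g" "0 \<le> \<theta> * p 0" using g p0 lam by auto
      have x: "\<bar>x\<bar> \<le> 1 / 2" unfolding x_def right_diff_distrib using lg g p0 by linarith
      have "2 * x\<^sup>2 \<le> 4 * \<theta>\<^sup>2 * (p 0)\<^sup>2 + 4 * \<theta>\<^sup>2 * g\<^sup>2"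
      proof -
        have "0 \<le> 2 * (\<theta> * p 0 + \<theta> * g)\<^sup>2" by simp
        then show ?thesis by (simp add: x_def power2_eq_square algebra_simps)
      qed
      moreover have "f j = x - (4 * \<theta>\<^sup>2 * (p 0)\<^sup>2 + 4 * \<theta>\<^sup>2 * g\<^sup>2)"
        by (simp add: f_def g_def cost_def x_def algebra_simps)
      ultimately have "exp (f j) \<le> exp (x - 2 * x\<^sup>2)" by simp
      also have "\<dots> \<le> 1 + x" by (rule one_plus_ge_exp[OF x])
      also have "\<dots> \<le> \<Psi> (?A j) (Y j)"
        unfolding \<Psi>_def x_def using g lam by (intro add_left_mono mult_left_mono) auto
      finally show ?thesis .
    qed
    have "K \<le> (\<Sum>j<N. f j)"
    proof -
      have inj: "inj_on Y {j\<in>{..<N}. Y j \<in> \<D> \<rho>}"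
      proof -
        have "Y i \<noteq> Y j" if "i < j" "j < N" "Y i \<in> \<D> \<rho>" "Y j \<in> \<D> \<rho>" for i j
        proof -
          have "Y i \<in> ?A (Suc i)" using Y1[of i] that settle[of i] by (auto simp: S_def)
          then have "Y i \<in> ?A j" using frozen_idla_mono[of "Suc i" j R \<omega>] that by auto
          moreover have "Y j \<notin> ?A j" using Y1[of j] that by (auto simp: S_def)
          ultimately show ?thesis by auto
        qed
        then show ?thesis by (auto intro!: linorder_inj_onI)
      qed
      have c0: "0 \<le> cost v" for v using lam by (simp add: cost_def G_def)
      have "(\<Sum>j<N. if Y j \<in> \<D> \<rho> then cost (Y j) else 0) = (\<Sum>j\<in>{j\<in>{..<N}. Y j \<in> \<D> \<rho>}. cost (Y j))"
        by (rule sum.inter_filter[symmetric]) simp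
      also have "\<dots> = (\<Sum>v\<in>Y ` {j\<in>{..<N}. Y j \<in> \<D> \<rho>}. cost v)"
        by (subst sum.reindex[OF inj]) simp
      also have "\<dots> \<le> (\<Sum>v\<in>\<D> \<rho>. cost v)"
        using c0 finite_\<D> by (intro sum_mono2) auto
      also have "\<dots> = \<theta> * (\<Sum>v\<in>\<D> \<rho>. G v) + 4 * \<theta>\<^sup>2 * (\<Sum>v\<in>\<D> \<rho>. (G v)\<^sup>2)"
        by (simp add: cost_def sum.distrib sum_distrib_left)
      also have "\<dots> \<le> \<theta> * (4 / 9 * \<rho> ^ 3 * p 0 + 1600) + 4 * \<theta>\<^sup>2 * 200"
      proof (intro add_mono mult_left_mono)
        show "(\<Sum>v\<in>\<D> \<rho>. G v) \<le> 4 / 9 * \<rho> ^ 3 * p 0 + 1600"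
          using sum_pos_F_le unfolding G_def H_def
          by (subst sum_reflect_\<D>[OF sgn, of "\<lambda>v. max 0 (F v)"]) simp
        show "(\<Sum>v\<in>\<D> \<rho>. (G v)\<^sup>2) \<le> 200"
          using sum_sq_F_le unfolding G_def H_def
          by (subst sum_reflect_\<D>[OF sgn, of "\<lambda>v. (max 0 (F v))\<^sup>2"]) simp
      qed (use lam in auto)
      finally have "(\<Sum>j<N. if Y j \<in> \<D> \<rho> then cost (Y j) else 0) \<le>
          \<theta> * (4 / 9 * \<rho> ^ 3 * p 0 + 1600) + 800 * \<theta>\<^sup>2" by simp
      moreover have "(\<Sum>j<N. f j) = real N * (\<theta> * p 0 - 4 * \<theta>\<^sup>2 * (p 0)\<^sup>2) -
          (\<Sum>j<N. if Y j \<in> \<D> \<rho> then cost (Y j) else 0)"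
        by (simp add: f_def sum_subtractf)
      moreover have "K = real N * (\<theta> * p 0 - 4 * \<theta>\<^sup>2 * (p 0)\<^sup>2) -
          (\<theta> * (4 / 9 * \<rho> ^ 3 * p 0 + 1600) + 800 * \<theta>\<^sup>2)"
        by (simp add: K_def algebra_simps)
      ultimately show ?thesis by linarith
    qed
    then have "ennreal (exp K) \<le> ennreal (exp (\<Sum>j<N. f j))" by (intro ennreal_leI) simp
    also have "\<dots> \<le> explorer_product R S \<Psi> N \<omega>"
      by (rule explorer_product_ge_exp) (use factor in \<open>simp add: Y_def\<close>)
    finally show False using nE by simp
  qed
  then show ?thesis using E unfolding z_def fails_within_def
    by (intro bexI[of _ ?E]) (auto simp: exp_minus inverse_eq_divide)
qed

end

text \<open>
  The number of explorers exceeds the number of sites of \<open>\<D> \<rho>\<close> by about \<open>4 / 9 * 3 * 11200 * s * n\<^sup>2\<close>,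
  and \<open>p 0\<close> is of order \<open>1 / n\<^sup>2\<close>, so the linear gain is a multiple of \<open>s\<^sup>2\<close>. The constant \<open>11200\<close>
  is large enough for it to dominate \<open>1600 * s\<close> and \<open>800 * s\<^sup>2\<close>.
\<close>

lemma inner_gain:
  fixes n s \<rho> p0 N :: real
  assumes s: "1 \<le> s" "22400 * s \<le> n" and \<rho>: "\<rho> = n - 11200 * s"
    and p0: "1 / (2 * \<rho>\<^sup>2) \<le> p0" "p0 \<le> 1 / \<rho>\<^sup>2" and N: "\<bar>N - 4 / 9 * n ^ 3\<bar> \<le> 11 * n"
  shows "4 * s\<^sup>2 \<le> s * (p0 * (N - 4 / 9 * \<rho> ^ 3) - 1600) - 4 * s\<^sup>2 * p0\<^sup>2 * N - 800 * s\<^sup>2"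
proof -
  have n: "n \<ge> 22400" "\<rho> \<ge> n / 2" "\<rho> \<le> n" "\<rho> > 0" using s \<rho> by linarith+
  have cube: "n ^ 3 - \<rho> ^ 3 = (n - \<rho>) * (n\<^sup>2 + n * \<rho> + \<rho>\<^sup>2)"
    by (simp add: algebra_simps power2_eq_square power3_eq_cube)
  have "11200 * s * n\<^sup>2 \<le> (n - \<rho>) * (n\<^sup>2 + n * \<rho> + \<rho>\<^sup>2)"
    using n s \<rho> by (intro mult_mono) auto
  then have d: "4 / 9 * (11200 * s * n\<^sup>2) - 11 * n \<le> N - 4 / 9 * \<rho> ^ 3"
    using N cube by linarith
  have nn: "n \<le> s * n\<^sup>2"
  proof -
    have "1 * n \<le> (s * n) * n" using n s mult_mono[of 1 s 1 n] by (intro mult_right_mono) auto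
    then show ?thesis by (simp add: power2_eq_square mult.assoc)
  qed
  have d2: "4900 * (s * n\<^sup>2) \<le> N - 4 / 9 * \<rho> ^ 3" 
  proof -
    have "4 / 9 * (11200 * s * n\<^sup>2) = 44800 / 9 * (s * n\<^sup>2)" by simp
    then show ?thesis using d nn n by linarith
  qed
  have "1 / (2 * n\<^sup>2) * (4900 * (s * n\<^sup>2)) \<le> p0 * (N - 4 / 9 * \<rho> ^ 3)"
  proof (intro mult_mono)
    have "1 / (2 * n\<^sup>2) \<le> 1 / (2 * \<rho>\<^sup>2)" using n by (intro divide_left_mono mult_left_mono power_mono) auto
    then show "1 / (2 * n\<^sup>2) \<le> p0" using p0 by linarith
    then show "0 \<le> p0" using n by (meson order_trans zero_le_divide_1_iff zero_le_mult_iff zero_le_numeral zero_le_power2)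
  qed (use d2 s in auto)
  then have g: "2450 * s \<le> p0 * (N - 4 / 9 * \<rho> ^ 3)" using n by simp
  have "4 * s\<^sup>2 * p0\<^sup>2 * N \<le> 16 * s\<^sup>2"
  proof -
    have p00: "0 \<le> p0" using p0 n by (meson order_trans zero_le_divide_1_iff zero_le_mult_iff zero_le_numeral zero_le_power2)
    have "p0 \<le> 1 / (n / 2)\<^sup>2"
      using p0(2) n by (intro order_trans[OF p0(2)] divide_left_mono power_mono) auto
    then have "p0\<^sup>2 \<le> (1 / (n / 2)\<^sup>2)\<^sup>2" using p00 by (intro power_mono)
    also have "\<dots> = 16 / n ^ 4" by (simp add: power_divide eval_nat_numeral)
    finally have a: "p0\<^sup>2 \<le> 16 / n ^ 4" .
    have "n * 1 \<le> n * n\<^sup>2" using n by (intro mult_left_mono) (auto simp: power2_eq_square mult_ge1_I)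
    then have "11 * n \<le> 11 * n ^ 3" by (simp add: power2_eq_square power3_eq_cube)
    then have b: "N \<le> 12 * n ^ 3" using N n by linarith
    have "p0\<^sup>2 * N \<le> 16 / n ^ 4 * (12 * n ^ 3)"
    proof (cases "N \<ge> 0")
      case True
      then show ?thesis using a b by (intro mult_mono) auto
    next
      case False
      then have "p0\<^sup>2 * N \<le> 0" by (simp add: mult_nonneg_nonpos)
      also have "0 \<le> 16 / n ^ 4 * (12 * n ^ 3)" using n by simp
      finally show ?thesis .
    qed
    also have "\<dots> = 192 / n" using n by (simp add: eval_nat_numeral)
    also have "\<dots> \<le> 4" using n by (simp add: field_simps)
    finally have "4 * s\<^sup>2 * (p0\<^sup>2 * N) \<le> 4 * s\<^sup>2 * 4" by (intro mult_left_mono) auto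
    then show ?thesis by (simp add: mult.assoc)
  qed
  moreover have "s * (850 * s) \<le> s * (p0 * (N - 4 / 9 * \<rho> ^ 3) - 1600)"
    using g s by (intro mult_left_mono) auto
  then have "850 * s\<^sup>2 \<le> s * (p0 * (N - 4 / 9 * \<rho> ^ 3) - 1600)" by (simp add: power2_eq_square)
  moreover have "0 \<le> s\<^sup>2" by simp
  ultimately show ?thesis by linarith
qed

text \<open>
  All tips with \<open>\<bar>x\<bar> \<le> \<rho> - 36 * s\<close> are reached simultaneously; a reached tip brings its whole half tooth
  with it. The loss of \<open>36 * s\<close> is the depth that the bound \<open>9 / t\<close> on the height of the pole requires for
  \<open>\<theta> = s\<close>.
\<close>

lemma inner_bound:
  fixes n :: nat and s :: real
  assumes s: "s = sqrt (ln (real n))" "1 \<le> s" "22400 * s \<le> real n"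
    and R: "\<D> (real n - 11200 * s) \<subseteq> R"
  shows "fails_within (8 / real n ^ 3) (\<lambda>\<omega>. \<D> (real n - 11236 * s) \<subseteq> frozen_idla R \<omega> (num_sites n))"
proof -
  define \<rho> where "\<rho> = real n - 11200 * s"
  have n: "real n \<ge> 22400" "\<rho> \<ge> 11200" "\<rho> \<le> real n"
    using s(2,3) unfolding \<rho>_def by linarith+
  define I where "I = {0..\<lfloor>\<rho> - 36 * s\<rfloor>} \<times> {1, -1 :: int} \<times> {1, -1 :: int}"
  define Q where "Q = (\<lambda>(x, \<sigma>, \<tau>) \<omega>. (\<sigma> * x, \<tau> * \<lceil>tooth_height \<rho> x\<rceil>) \<in> frozen_idla R \<omega> (num_sites n))"
  have lnn: "s\<^sup>2 = ln (real n)" using s n by simp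
  have "fails_within (exp (- (4 * s\<^sup>2))) (Q i)" if "i \<in> I" for i
  proof -
    obtain x \<sigma> \<tau> where i: "i = (x, \<sigma>, \<tau>)" using prod_cases3 by blast
    have x: "0 \<le> x" "real_of_int x \<le> \<rho> - 36 * s" and sg: "\<bar>\<sigma>\<bar> = 1" "\<bar>\<tau>\<bar> = 1"
      using that by (auto simp: i I_def le_floor_iff)
    interpret inner_tooth \<rho> x by unfold_locales (use n x s(2) in linarith)+
    have t36: "36 * s \<le> t" using x(2) unfolding t_def by linarith
    have "4 * s \<le> \<rho>\<^sup>2"
    proof -
      have "4 * s \<le> \<rho> * 1" using s n by (simp add: \<rho>_def)
      also have "\<dots> \<le> \<rho> * \<rho>" using n by (intro mult_left_mono) auto
      finally show ?thesis by (simp add: power2_eq_square)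
    qed
    then have "fails_within (exp (- (s * (p 0 * (real (num_sites n) - 4 / 9 * \<rho> ^ 3) - 1600)
        - 4 * s\<^sup>2 * (p 0)\<^sup>2 * real (num_sites n) - 800 * s\<^sup>2)))
        (\<lambda>\<omega>. (\<sigma> * x, \<tau> * \<lceil>h x\<rceil>) \<in> frozen_idla R \<omega> (num_sites n))"
      using s(2) t36 R[folded \<rho>_def] sg by (intro tip_reached) auto
    moreover have "4 * s\<^sup>2 \<le> s * (p 0 * (real (num_sites n) - 4 / 9 * \<rho> ^ 3) - 1600)
        - 4 * s\<^sup>2 * (p 0)\<^sup>2 * real (num_sites n) - 800 * s\<^sup>2"
    proof (rule inner_gain[of s "real n"])
      show "\<bar>real (num_sites n) - 4 / 9 * real n ^ 3\<bar> \<le> 11 * real n"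
        using n by (intro num_sites_cubic) simp
    qed (use s(2,3) p0_bounds \<rho>_def in auto)
    ultimately show ?thesis
      by (elim fails_within_mono) (auto simp: Q_def i)
  qed
  then have "fails_within (real (card I) * exp (- (4 * s\<^sup>2))) (\<lambda>\<omega>. \<forall>i\<in>I. Q i \<omega>)"
    by (intro fails_within_Ball) (auto simp: I_def)
  then show ?thesis
  proof (rule fails_within_mono)
    have e: "exp (- (4 * s\<^sup>2)) = 1 / real n ^ 4"
    proof -
      have "exp (4 * s\<^sup>2) = real n ^ 4" unfolding lnn using n exp_of_nat_mult[of 4 "ln (real n)"] by simp
      then show ?thesis by (simp add: exp_minus inverse_eq_divide)
    qed
    have c: "real (card I) \<le> 8 * real n"
    proof -
      have "real (card I) = 4 * real (nat (\<lfloor>\<rho> - 36 * s\<rfloor> + 1))" by (simp add: I_def card_cartesian_product)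
      moreover have "real (nat (\<lfloor>\<rho> - 36 * s\<rfloor> + 1)) \<le> real n + 1"
        using n s by linarith
      ultimately show ?thesis using n by linarith
    qed
    have "real (card I) * exp (- (4 * s\<^sup>2)) \<le> 8 * real n * (1 / real n ^ 4)"
      unfolding e using c by (rule mult_right_mono) simp
    also have "\<dots> = 8 / real n ^ 3"
    proof -
      have "8 * u * (1 / u ^ 4) = 8 / u ^ 3" if "u \<noteq> 0" for u :: real
        using that by (simp add: field_simps flip: power_Suc)
      then show ?thesis using n by simp
    qed
    finally show "real (card I) * exp (- (4 * s\<^sup>2)) \<le> 8 / real n ^ 3" .
  next
    fix \<omega> assume proper: "\<forall>k. proper_path (\<omega> k)" and Q: "\<forall>i\<in>I. Q i \<omega>"
    let ?A = "frozen_idla R \<omega> (num_sites n)"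
    have star: "star_closed ?A" using proper by (intro star_closed_frozen_idla) auto
    show "\<D> (real n - 11236 * s) \<subseteq> ?A"
    proof
      fix v assume "v \<in> \<D> (real n - 11236 * s)"
      then obtain x y where v: "v = (x, y)" and x: "\<bar>real_of_int x\<bar> < \<rho> - 36 * s"
        and y: "\<bar>real_of_int y\<bar> < (\<rho> - 36 * s - \<bar>real_of_int x\<bar>)\<^sup>2 / 3"
        by (auto simp: \<D>_def \<rho>_def)
      define \<sigma> :: int where "\<sigma> = (if x \<ge> 0 then 1 else -1)"
      define \<tau> :: int where "\<tau> = (if y \<ge> 0 then 1 else -1)"
      have "(\<bar>x\<bar>, \<sigma>, \<tau>) \<in> I" using x by (auto simp: I_def \<sigma>_def \<tau>_def le_floor_iff)
      then have A: "(x, \<tau> * \<lceil>tooth_height \<rho> x\<rceil>) \<in> ?A"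
        using Q by (fastforce simp: Q_def \<sigma>_def tooth_height_def abs_if split: if_splits)
      have "(\<rho> - 36 * s - \<bar>real_of_int x\<bar>)\<^sup>2 \<le> (\<rho> - \<bar>real_of_int x\<bar>)\<^sup>2"
        using x s(2) by (intro power_mono) linarith+
      then have "\<bar>real_of_int y\<bar> \<le> (\<rho> - \<bar>real_of_int x\<bar>)\<^sup>2 / 3" using y by linarith
      moreover have "max 0 (\<rho> - \<bar>real_of_int x\<bar>) = \<rho> - \<bar>real_of_int x\<bar>" using x s(2) by linarith
      ultimately have "\<bar>real_of_int y\<bar> \<le> tooth_height \<rho> x" by (simp only: tooth_height_def)
      then have yh: "\<bar>y\<bar> \<le> \<lceil>tooth_height \<rho> x\<rceil>" by linarith
      show "v \<in> ?A"
      proof (cases "y \<ge> 0")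
        case True
        then show ?thesis using star_closed_tooth_pos[OF star A, of y] yh by (simp add: v \<tau>_def)
      next
        case False
        then show ?thesis using star_closed_tooth_neg[OF star A, of y] yh by (simp add: v \<tau>_def)
      qed
    qed
  qed
qed

section \<open>A potential that grows towards one end of the comb\<close>

text \<open>
  Near the ends of the domain the teeth are allowed a constant height \<open>T\<close>, up to \<open>\<bar>x\<bar> = x1\<close>. Beyond
  \<open>x1\<close> there is no constraint: the potentials below are constant there, so no control is needed.
\<close>

definition outer_region :: "int \<Rightarrow> real \<Rightarrow> int \<Rightarrow> real \<Rightarrow> (int \<times> int) set" where
  "outer_region x0 m x1 T = {(x, y). (\<bar>x\<bar> \<le> x0 \<longrightarrow> \<bar>real_of_int y\<bar> < (x0 + m - 1 - \<bar>real_of_int x\<bar>)\<^sup>2 / 3) \<and>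
     (x0 < \<bar>x\<bar> \<and> \<bar>x\<bar> \<le> x1 \<longrightarrow> \<bar>real_of_int y\<bar> < T)}"

text \<open>
  The solution \<open>1 / r\<^sup>2\<close> of the equation for the profile, now with \<open>r\<close> the distance to
  \<open>x0 + m\<close>, made constant to the left of \<open>- x0\<close> and to the right of the target \<open>xt\<close>. If the target lies
  beyond \<open>x0\<close>, the profile continues linearly with the small slope \<open>\<kappa>\<close>. At the target the profile has a
  concave corner, so the potential increases along the target tooth in both directions.
\<close>

definition outer_profile :: "int \<Rightarrow> real \<Rightarrow> int \<Rightarrow> real \<Rightarrow> int \<Rightarrow> real" where
  "outer_profile x0 m xt \<kappa> x =
     1 / (real_of_int x0 + m - real_of_int (max (- x0) (min x (min xt x0))))\<^sup>2
     + \<kappa> * real_of_int (max 0 (min x xt - x0))"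

text \<open>
  The hypothesis \<open>small\<close> bounds \<open>s\<close> times the potential on the region and its boundary; the product
  method needs this to replace \<open>1 + x\<close> by \<open>exp (x - 2 * x\<^sup>2)\<close>.
\<close>

locale outer_tooth =
  fixes x0 xt x1 :: int and m \<kappa> T s :: real
  assumes m: "m \<ge> 100" and x0: "4 * m\<^sup>2 \<le> x0" and xt: "0 \<le> xt" "xt \<le> x1" and x1: "x0 \<le> x1"
    and kappa: "0 \<le> \<kappa>" "\<kappa> \<le> 1 / m ^ 3" and T: "0 < T" and s: "0 < s"
    and small: "8 * s * (1 / m + 1 / m\<^sup>2 + \<kappa> * (x1 - x0) + (T + 1) * \<kappa>) \<le> 1"
begin

abbreviation "R \<equiv> outer_region x0 m x1 T"
abbreviation "q \<equiv> outer_profile x0 m xt \<kappa>"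
definition \<rho> :: real where "\<rho> = real_of_int x0 + m"
abbreviation "H \<equiv> comb_harmonic q (\<lambda>_. 0)"

lemma x0_ge: "x0 \<ge> 40000"
proof -
  have "m\<^sup>2 \<ge> 100\<^sup>2" using m by (intro power_mono) auto
  then have "real_of_int x0 \<ge> 40000" using x0 by simp
  then show ?thesis by simp
qed

lemma clamp_le: "max (- x0) (min x (min xt x0)) \<le> x0"
  using x0_ge by (simp add: min_def max_def)

lemma H_eq: "H (x, y) = q x - \<bar>real_of_int y\<bar> * laplace q x / 2"
  by (simp add: comb_harmonic_def)

lemma q_left: "x \<le> - x0 \<Longrightarrow> q x = 1 / (\<rho> + x0)\<^sup>2"
proof -
  assume x: "x \<le> - x0"
  have "max (- x0) (min x (min xt x0)) = - x0" "max 0 (min x xt - x0) = 0"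
    using x xt x0_ge by linarith+
  then show ?thesis by (simp only: outer_profile_def \<rho>_def) (simp add: algebra_simps)
qed

lemma q_mid: "- x0 \<le> x \<Longrightarrow> x \<le> xt \<Longrightarrow> x \<le> x0 \<Longrightarrow> q x = 1 / (\<rho> - x)\<^sup>2"
  using xt x0_ge by (simp add: outer_profile_def \<rho>_def min_def max_def)

lemma q_right: "xt \<le> x0 \<Longrightarrow> xt \<le> x \<Longrightarrow> q x = 1 / (\<rho> - xt)\<^sup>2"
  using xt x0_ge by (simp add: outer_profile_def \<rho>_def min_def max_def)

lemma q_far: "x0 \<le> xt \<Longrightarrow> x0 \<le> x \<Longrightarrow> q x = 1 / m\<^sup>2 + \<kappa> * real_of_int (min x xt - x0)"
  using xt x0_ge by (auto simp: outer_profile_def \<rho>_def min_def max_def)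

lemma q0: "q 0 = 1 / \<rho>\<^sup>2"
  using q_mid[of 0] xt x0_ge by simp

lemma q_pos: "0 < q x"
proof -
  have "0 < 1 / (real_of_int x0 + m - real_of_int (max (- x0) (min x (min xt x0))))\<^sup>2"
  proof -
    have "real_of_int (max (- x0) (min x (min xt x0))) \<le> x0" using clamp_le[of x] by (simp only: of_int_le_iff)
    then have "0 < real_of_int x0 + m - real_of_int (max (- x0) (min x (min xt x0)))" using m by linarith
    then show ?thesis by (intro divide_pos_pos zero_less_power) auto
  qed
  moreover have "0 \<le> \<kappa> * real_of_int (max 0 (min x xt - x0))" using kappa by simp
  ultimately show ?thesis unfolding outer_profile_def by linarith
qed

lemma q_le: "q x \<le> 1 / m\<^sup>2 + \<kappa> * (x1 - x0)"
proof -
  have "1 / (real_of_int x0 + m - real_of_int (max (- x0) (min x (min xt x0))))\<^sup>2 \<le> 1 / m\<^sup>2"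
  proof (rule divide_left_mono)
    have "real_of_int (max (- x0) (min x (min xt x0))) \<le> x0" using clamp_le[of x] by (simp only: of_int_le_iff)
    then have le: "m \<le> real_of_int x0 + m - real_of_int (max (- x0) (min x (min xt x0)))" by linarith
    then show "m\<^sup>2 \<le> (real_of_int x0 + m - real_of_int (max (- x0) (min x (min xt x0))))\<^sup>2"
      using m by (intro power_mono) auto
    show "0 < (real_of_int x0 + m - real_of_int (max (- x0) (min x (min xt x0))))\<^sup>2 * m\<^sup>2"
      using le m by (intro mult_pos_pos zero_less_power) linarith+
  qed simp
  moreover have "\<kappa> * real_of_int (max 0 (min x xt - x0)) \<le> \<kappa> * (x1 - x0)"
    using kappa xt x1 by (intro mult_left_mono) (auto simp: min_def max_def)
  ultimately show ?thesis unfolding outer_profile_def by linarith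
qed

lemma laplace_left_edge: "laplace q (- x0) = 1 / (\<rho> + x0 - 1)\<^sup>2 - 1 / (\<rho> + x0)\<^sup>2"
  using q_left[of "- x0"] q_left[of "- x0 - 1"] q_mid[of "- x0 + 1"] xt x0_ge
  by (simp add: laplace_def) (simp add: algebra_simps)

lemma laplace_mid:
  assumes "- x0 < x" "x < xt" "x < x0"
  shows "laplace q x = 1 / (\<rho> - x - 1)\<^sup>2 + 1 / (\<rho> - x + 1)\<^sup>2 - 2 / (\<rho> - x)\<^sup>2"
proof -
  have "\<rho> - real_of_int (x + 1) = \<rho> - x - 1" "\<rho> - real_of_int (x - 1) = \<rho> - x + 1" by auto
  moreover have "q (x + 1) = 1 / (\<rho> - real_of_int (x + 1))\<^sup>2" "q (x - 1) = 1 / (\<rho> - real_of_int (x - 1))\<^sup>2"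
    "q x = 1 / (\<rho> - x)\<^sup>2"
    using assms by (intro q_mid; simp)+
  ultimately show ?thesis by (simp only: laplace_def)
qed

lemma laplace_target:
  assumes "xt \<le> x0"
  shows "laplace q xt = 1 / (\<rho> - xt + 1)\<^sup>2 - 1 / (\<rho> - xt)\<^sup>2"
  using q_right[OF assms, of xt] q_right[OF assms, of "xt + 1"] q_mid[of "xt - 1"] xt x0_ge assms
  by (simp add: laplace_def) (simp add: algebra_simps)

lemma laplace_bend:
  assumes "x0 < xt"
  shows "laplace q x0 = 1 / (m + 1)\<^sup>2 - 1 / m\<^sup>2 + \<kappa>"
  using q_far[of x0] q_far[of "x0 + 1"] q_mid[of "x0 - 1"] assms x0_ge
  by (simp add: laplace_def \<rho>_def)

lemma laplace_zero:
  assumes "x < - x0 \<or> xt < x \<or> x0 < x \<and> x < xt"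
  shows "laplace q x = 0"
proof -
  consider "x < - x0" | "xt < x" "xt \<le> x0" | "xt < x" "x0 < xt" | "x0 < x" "x < xt" using assms by linarith
  then show ?thesis
  proof cases
    case 1
    then show ?thesis by (simp add: laplace_def q_left)
  next
    case 2
    then show ?thesis by (simp add: laplace_def q_right)
  next
    case 3
    then show ?thesis by (simp add: laplace_def q_far min_def)
  next
    case 4
    then show ?thesis by (simp add: laplace_def q_far min_def algebra_simps)
  qed
qed

lemma laplace_far_target:
  assumes "x0 < xt"
  shows "laplace q xt = - \<kappa>"
  using assms by (simp add: laplace_def q_far min_def algebra_simps)

lemma inverse_square_step:
  fixes r :: real
  assumes "r > 0"
  shows "1 / r ^ 3 \<le> 1 / r\<^sup>2 - 1 / (r + 1)\<^sup>2 \<or> r < 2" "1 / r\<^sup>2 - 1 / (r + 1)\<^sup>2 \<le> 2 / r ^ 3"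
proof -
  have e: "1 / r\<^sup>2 - 1 / (r + 1)\<^sup>2 = (2 * r + 1) / (r\<^sup>2 * (r + 1)\<^sup>2)"
  proof -
    have "1 / r\<^sup>2 - 1 / (r + 1)\<^sup>2 = ((r + 1)\<^sup>2 - r\<^sup>2) / (r\<^sup>2 * (r + 1)\<^sup>2)"
      using assms by (simp add: diff_frac_eq)
    then show ?thesis by (simp add: power2_eq_square algebra_simps)
  qed
  have c: "r ^ 3 = r * r\<^sup>2" by (simp add: power2_eq_square power3_eq_cube)
  have pos: "0 < r\<^sup>2 * (r + 1)\<^sup>2" "0 < r ^ 3" using assms by auto
  show "1 / r\<^sup>2 - 1 / (r + 1)\<^sup>2 \<le> 2 / r ^ 3"
  proof -
    have "(2 * r + 1) * r \<le> 2 * (r + 1)\<^sup>2" using assms by (simp add: power2_eq_square algebra_simps)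
    then have "(2 * r + 1) * r * r\<^sup>2 \<le> 2 * (r + 1)\<^sup>2 * r\<^sup>2" by (intro mult_right_mono) auto
    then have "(2 * r + 1) * r ^ 3 \<le> 2 * (r\<^sup>2 * (r + 1)\<^sup>2)" by (simp add: c mult_ac)
    then show ?thesis unfolding e using pos by (simp add: pos_divide_le_eq pos_le_divide_eq)
  qed
  show "1 / r ^ 3 \<le> 1 / r\<^sup>2 - 1 / (r + 1)\<^sup>2 \<or> r < 2"
  proof (cases "r < 2")
    case False
    have "2 * r \<le> r * r" using False by (intro mult_right_mono) auto
    then have "1 + r \<le> r * r" using False by linarith
    then have "(r + 1)\<^sup>2 \<le> (2 * r + 1) * r" by (simp add: power2_eq_square algebra_simps)
    then have "(r + 1)\<^sup>2 * r\<^sup>2 \<le> (2 * r + 1) * r * r\<^sup>2" by (intro mult_right_mono) auto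
    then have "r\<^sup>2 * (r + 1)\<^sup>2 \<le> (2 * r + 1) * r ^ 3" by (simp add: c mult_ac)
    then show ?thesis unfolding e using pos by (simp add: pos_divide_le_eq pos_le_divide_eq)
  qed simp
qed

text \<open>
  With teeth shorter by the shift from \<open>r\<close> to \<open>r - 1\<close>, the potential stays nonnegative even one site
  beyond the end of a tooth.
\<close>

lemma mid_second_difference:
  fixes r :: real
  assumes "r \<ge> 4"
  defines "d \<equiv> 1 / (r - 1)\<^sup>2 + 1 / (r + 1)\<^sup>2 - 2 / r\<^sup>2"
  shows "0 \<le> d" "((r - 1)\<^sup>2 / 3 + 1) * d \<le> 2 * (1 / r\<^sup>2)"
proof -
  define w where "w = r\<^sup>2"
  have w: "w \<ge> 16" using assms(1) power_mono[of 4 r 2] by (simp add: w_def)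
  define V where "V = (w - 1)\<^sup>2"
  have V: "V > 0" using w by (simp add: V_def)
  have pos: "(r - 1)\<^sup>2 > 0" "(r + 1)\<^sup>2 > 0" using assms by auto
  have v: "(r - 1)\<^sup>2 * (r + 1)\<^sup>2 = V"
    unfolding power_mult_distrib[symmetric] w_def V_def by (simp add: power2_eq_square algebra_simps)
  have "1 / (r - 1)\<^sup>2 + 1 / (r + 1)\<^sup>2 = ((r + 1)\<^sup>2 + (r - 1)\<^sup>2) / ((r - 1)\<^sup>2 * (r + 1)\<^sup>2)"
    using pos by (simp add: add_divide_eq_iff divide_add_eq_iff)
  also have "\<dots> = (2 * w + 2) / V"
    unfolding v by (simp add: w_def power2_eq_square algebra_simps)
  finally have "d = (2 * w + 2) / V - 2 / w" by (simp add: d_def w_def)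
  also have "\<dots> = ((2 * w + 2) * w - 2 * V) / (V * w)" using V w by (simp add: diff_frac_eq)
  also have "(2 * w + 2) * w - 2 * V = 6 * w - 2" unfolding V_def by (simp add: power2_eq_square algebra_simps)
  finally have d: "d = (6 * w - 2) / (V * w)" .
  show "0 \<le> d" unfolding d using V w by simp
  have "((r - 1)\<^sup>2 / 3 + 1) * (6 * w - 2) \<le> 2 * V"
  proof -
    have "6 * V - (((r - 1)\<^sup>2 + 3) * (6 * w - 2)) = 12 * r ^ 3 - 34 * r\<^sup>2 - 4 * r + 14"
      unfolding V_def w_def by (simp add: power2_eq_square power3_eq_cube algebra_simps)
    also have "\<dots> \<ge> 0"
    proof -
      have "34 * r\<^sup>2 + 4 * r \<le> 48 * r\<^sup>2"
      proof -
        have "4 * r \<le> r * r" using assms by (intro mult_right_mono) auto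
        then show ?thesis using w by (simp add: power2_eq_square w_def)
      qed
      moreover have "12 * (4 * r\<^sup>2) \<le> 12 * (r * r\<^sup>2)" using assms by (intro mult_left_mono mult_right_mono) auto
      moreover have "r * r\<^sup>2 = r ^ 3" by (simp add: power2_eq_square power3_eq_cube)
      ultimately show ?thesis by linarith
    qed
    finally have "((r - 1)\<^sup>2 + 3) * (6 * w - 2) \<le> 6 * V" by simp
    moreover have "((r - 1)\<^sup>2 / 3 + 1) * (6 * w - 2) = ((r - 1)\<^sup>2 + 3) * (6 * w - 2) / 3"
      by (simp add: field_simps)
    ultimately show ?thesis by linarith
  qed
  then have "((r - 1)\<^sup>2 / 3 + 1) * (6 * w - 2) / (V * w) \<le> 2 * V / (V * w)"
    using V w by (intro divide_right_mono) auto
  then show "((r - 1)\<^sup>2 / 3 + 1) * d \<le> 2 * (1 / r\<^sup>2)" unfolding d using V by (simp add: w_def)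
qed

definition height :: "int \<Rightarrow> real" where
  "height x = (\<rho> - 1 - \<bar>real_of_int x\<bar>)\<^sup>2 / 3"

lemma laplace_nonpos:
  assumes "min xt x0 \<le> x"
  shows "laplace q x \<le> 0"
proof -
  consider "x = xt" "xt \<le> x0" | "x = x0" "x0 < xt" | "x = xt" "x0 < xt" | "xt < x \<or> x0 < x \<and> x < xt"
    using assms by linarith
  then show ?thesis
  proof cases
    case 1
    have "1 / (\<rho> - xt + 1)\<^sup>2 \<le> 1 / (\<rho> - xt)\<^sup>2"
      using 1 m by (intro divide_left_mono power_mono mult_pos_pos) (auto simp: \<rho>_def)
    then show ?thesis using laplace_target 1 by simp
  next
    case 2
    have "1 / m ^ 3 \<le> 1 / m\<^sup>2 - 1 / (m + 1)\<^sup>2" using inverse_square_step(1)[of m] m by auto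
    then show ?thesis using laplace_bend 2 kappa by simp
  next
    case 3
    then show ?thesis using laplace_far_target kappa by simp
  qed (use laplace_zero in auto)
qed

lemma laplace_le:
  assumes "\<bar>x\<bar> \<le> x0"
  shows "(height x + 1) * laplace q x \<le> 2 * q x"
proof -
  consider "min xt x0 \<le> x" | "x = - x0" | "- x0 < x" "x < xt" "x < x0" using assms by linarith
  then show ?thesis
  proof cases
    case 1
    have "(height x + 1) * laplace q x \<le> 0"
      using laplace_nonpos[OF 1] by (intro mult_nonneg_nonpos) (auto simp: height_def)
    then show ?thesis using q_pos[of x] by linarith
  next
    case 2
    define r where "r = \<rho> + x0 - 1"
    have r: "r \<ge> 4 * m\<^sup>2" "r > 0" using x0 x0_ge m by (auto simp: r_def \<rho>_def)
    have h: "height x + 1 \<le> m\<^sup>2"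
    proof -
      have "(m - 1)\<^sup>2 / 3 + 1 \<le> m\<^sup>2" using m power_mono[of 100 m 2] by (simp add: power2_eq_square field_simps)
      then show ?thesis using 2 x0_ge by (simp add: height_def \<rho>_def)
    qed
    have "laplace q x \<le> 2 / r ^ 3"
      using inverse_square_step(2)[OF r(2)] laplace_left_edge 2 by (simp add: r_def)
    moreover have "0 \<le> 2 / r ^ 3" using r by simp
    ultimately have "(height x + 1) * laplace q x \<le> m\<^sup>2 * (2 / r ^ 3)"
      using h by (intro order_trans[OF mult_left_mono mult_right_mono]) (auto simp: height_def)
    also have "\<dots> \<le> r / 4 * (2 / r ^ 3)" using r by (intro mult_right_mono) auto
    also have "\<dots> = 1 / (2 * r\<^sup>2)" using r by (simp add: power2_eq_square power3_eq_cube)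
    also have "\<dots> \<le> 2 * (1 / (r + 1)\<^sup>2)"
    proof -
      have "(r + 1)\<^sup>2 \<le> (2 * r)\<^sup>2" using r m power_mono[of 100 m 2] by (intro power_mono) auto
      then show ?thesis using r by (simp add: field_simps power_mult_distrib)
    qed
    also have "\<dots> = 2 * q x" using q_left[of x] 2 by (simp add: r_def)
    finally show ?thesis .
  next
    case 3
    define r where "r = \<rho> - real_of_int x"
    have r: "r \<ge> 4" using 3 m by (simp add: r_def \<rho>_def)
    have "height x \<le> (r - 1)\<^sup>2 / 3"
      unfolding height_def using assms m by (intro divide_right_mono power_mono) (auto simp: r_def \<rho>_def)
    then have "(height x + 1) * laplace q x \<le> ((r - 1)\<^sup>2 / 3 + 1) * laplace q x"
      using mid_second_difference(1)[OF r] laplace_mid[OF 3] by (intro mult_right_mono) (auto simp: r_def)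
    also have "\<dots> \<le> 2 * q x"
      using mid_second_difference(2)[OF r] laplace_mid[OF 3] q_mid[of x] 3 by (simp add: r_def)
    finally show ?thesis .
  qed
qed

lemma laplace_ge_mid:
  assumes "x < min xt x0"
  shows "0 \<le> laplace q x"
proof -
  consider "x < - x0" | "x = - x0" | "- x0 < x" "x < xt" "x < x0" using assms by linarith
  then show ?thesis
  proof cases
    case 1
    then show ?thesis by (simp add: laplace_zero)
  next
    case 2
    have "1 / (\<rho> + x0)\<^sup>2 \<le> 1 / (\<rho> + x0 - 1)\<^sup>2"
      using m x0_ge by (intro divide_left_mono power_mono mult_pos_pos) (auto simp: \<rho>_def)
    then show ?thesis using laplace_left_edge 2 by simp
  next
    case 3
    have "\<rho> - x \<ge> 4" using 3 m by (simp add: \<rho>_def)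
    then show ?thesis using mid_second_difference(1) laplace_mid[OF 3] by simp
  qed
qed

text \<open>
  Only a convex profile pulls the potential down along a tooth, and \<open>laplace_le\<close> limits the pull.
\<close>

lemma H_nonneg:
  assumes "\<bar>x\<bar> \<le> x0 \<Longrightarrow> \<bar>real_of_int y\<bar> \<le> height x + 1"
  shows "0 \<le> H (x, y)"
proof -
  have "\<bar>real_of_int y\<bar> * laplace q x \<le> 2 * q x"
  proof (cases "0 \<le> laplace q x")
    case True
    show ?thesis
    proof (cases "\<bar>x\<bar> \<le> x0")
      case in_range: True
      have "\<bar>real_of_int y\<bar> * laplace q x \<le> (height x + 1) * laplace q x"
        using True assms[OF in_range] by (intro mult_right_mono)
      then show ?thesis using laplace_le[OF in_range] by linarith
    next
      case False
      then have "laplace q x \<le> 0"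
        using laplace_nonpos[of x] laplace_zero[of x] by (cases "x < - x0") auto
      then show ?thesis using True q_pos[of x] by simp
    qed
  next
    case False
    then have "\<bar>real_of_int y\<bar> * laplace q x \<le> 0" by (intro mult_nonneg_nonpos) auto
    then show ?thesis using q_pos[of x] by linarith
  qed
  then show ?thesis by (simp add: H_eq)
qed

lemma H_ge_right: "min xt x0 \<le> x \<Longrightarrow> q x \<le> H (x, y)"
  using laplace_nonpos[of x] by (simp add: H_eq mult_nonneg_nonpos)

lemma H_le_left: "x < min xt x0 \<Longrightarrow> H (x, y) \<le> q x"
  using laplace_ge_mid[of x] by (simp add: H_eq)

lemma target_slope:
  assumes "xt \<le> x0"
  shows "1 / (\<rho> - xt) ^ 3 \<le> - laplace q xt" "- laplace q xt \<le> 2 / (\<rho> - xt) ^ 3"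
  using inverse_square_step[of "\<rho> - xt"] laplace_target[OF assms] assms m by (auto simp: \<rho>_def)

lemma H_target_le:
  assumes "xt \<le> x0" "\<bar>real_of_int y\<bar> \<le> height xt + 1"
  shows "H (xt, y) \<le> 1 / (\<rho> - xt)"
proof -
  define r where "r = \<rho> - real_of_int xt"
  have r: "r \<ge> 100" using assms m by (simp add: r_def \<rho>_def)
  have r2: "100 * r \<le> r\<^sup>2" using r by (simp add: power2_eq_square)
  have "height xt + 1 \<le> r\<^sup>2 / 2"
  proof -
    have "0 \<le> r * r" by simp
    moreover have "r\<^sup>2 / 2 - ((r - 1)\<^sup>2 / 3 + 1) = (r * r + 4 * r - 8) / 6"
      by (simp add: power2_eq_square field_simps)
    moreover have "0 \<le> (r * r + 4 * r - 8) / 6"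
      using calculation(1) r by (intro divide_nonneg_pos) linarith+
    ultimately have "(r - 1)\<^sup>2 / 3 + 1 \<le> r\<^sup>2 / 2" by linarith
    then show ?thesis using xt by (simp add: height_def r_def algebra_simps)
  qed
  then have "\<bar>real_of_int y\<bar> * (- laplace q xt) \<le> r\<^sup>2 / 2 * (2 / r ^ 3)"
    using assms target_slope[OF assms(1)] r laplace_nonpos[of xt] by (intro mult_mono) (auto simp: r_def)
  also have "\<dots> = 1 / r" using r by (simp add: power2_eq_square power3_eq_cube)
  finally have "- (\<bar>real_of_int y\<bar> * laplace q xt) \<le> 1 / r" by (simp only: mult_minus_right)
  moreover have "H (xt, y) = 1 / r\<^sup>2 - \<bar>real_of_int y\<bar> * laplace q xt / 2"
    using q_right[OF assms(1), of xt] by (simp add: H_eq r_def)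
  moreover have "g \<le> a + u / 2" if "- w \<le> u" "g = a - w / 2" for g a u w :: real
    using that by linarith
  ultimately have "H (xt, y) \<le> 1 / r\<^sup>2 + 1 / r / 2" by blast
  also have "1 / r\<^sup>2 \<le> 1 / r / 2" using r r2 by (simp add: field_simps)
  finally have "H (xt, y) \<le> 1 / r / 2 + 1 / r / 2" by simp
  then show ?thesis unfolding field_sum_of_halves r_def .
qed

text \<open>
  The four terms of \<open>small\<close> come from the target tooth inside \<open>x0\<close>, the profile at \<open>x0\<close>, its linear
  continuation, and a target tooth beyond \<open>x0\<close>.
\<close>

lemma H_le:
  assumes "\<bar>x\<bar> \<le> x0 \<Longrightarrow> \<bar>real_of_int y\<bar> \<le> height x + 1"
    "x0 < \<bar>x\<bar> \<Longrightarrow> \<bar>x\<bar> \<le> x1 \<Longrightarrow> \<bar>real_of_int y\<bar> \<le> T + 1"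
  shows "8 * s * H (x, y) \<le> 1"
proof -
  have k: "0 \<le> \<kappa> * (x1 - x0)" "0 \<le> (T + 1) * \<kappa>" "0 \<le> 1 / m\<^sup>2" "0 \<le> 1 / m"
    using kappa x1 T m by auto
  have "H (x, y) \<le> 1 / m + 1 / m\<^sup>2 + \<kappa> * (x1 - x0) + (T + 1) * \<kappa>"
  proof -
    consider "x < min xt x0" | "x = xt" "xt \<le> x0" | "x = x0" "x0 < xt" | "x = xt" "x0 < xt"
      | "xt < x \<or> x0 < x \<and> x < xt" by linarith
    then show ?thesis
    proof cases
      case 1
      then show ?thesis using H_le_left[OF 1, of y] q_le[of x] k by linarith
    next
      case 2
      have "H (xt, y) \<le> 1 / (\<rho> - xt)" using assms(1) 2 xt by (intro H_target_le) auto
      also have "\<dots> \<le> 1 / m" using 2 m by (intro divide_left_mono mult_pos_pos) (auto simp: \<rho>_def)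
      finally show ?thesis using k unfolding 2(1) by linarith
    next
      case 3
      have y: "\<bar>real_of_int y\<bar> \<le> m\<^sup>2"
      proof -
        have "(m - 1)\<^sup>2 / 3 + 1 \<le> m\<^sup>2" using m power_mono[of 100 m 2] by (simp add: power2_eq_square field_simps)
        then show ?thesis using assms(1) 3 x0_ge by (simp add: height_def \<rho>_def)
      qed
      have "- laplace q x \<le> 2 / m ^ 3"
        using laplace_bend 3 kappa inverse_square_step(2)[of m] m by simp
      then have "\<bar>real_of_int y\<bar> * (- laplace q x) \<le> m\<^sup>2 * (2 / m ^ 3)"
        using y laplace_nonpos[of x] 3 by (intro mult_mono) auto
      also have "\<dots> = 2 * (1 / m)" using m by (simp add: power2_eq_square power3_eq_cube)
      finally have "H (x, y) \<le> q x + 1 / m" by (simp add: H_eq)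
      then show ?thesis using q_le[of x] k by linarith
    next
      case 4
      have "\<bar>real_of_int y\<bar> * \<kappa> \<le> (T + 1) * \<kappa>"
        using assms(2) 4 xt x0_ge kappa by (intro mult_right_mono) auto
      moreover have "0 \<le> \<bar>real_of_int y\<bar> * \<kappa>" using kappa by simp
      moreover have "H (x, y) = q x + \<bar>real_of_int y\<bar> * \<kappa> / 2"
        using laplace_far_target 4 by (simp add: H_eq)
      ultimately show ?thesis using q_le[of x] k by linarith
    next
      case 5
      then have "H (x, y) = q x" by (simp add: H_eq laplace_zero)
      then show ?thesis using q_le[of x] k by linarith
    qed
  qed
  then have "8 * s * H (x, y) \<le> 8 * s * (1 / m + 1 / m\<^sup>2 + \<kappa> * (x1 - x0) + (T + 1) * \<kappa>)"
    using s by (intro mult_left_mono) auto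
  then show ?thesis using small by linarith
qed

end

section \<open>Sites outside the inner set\<close>

lemma frozen_idla_image:
  "frozen_idla R \<omega> k = (\<lambda>j. first_outside (frozen_idla R \<omega> j \<inter> R) (\<omega> j)) ` {..<k}"
  by (induction k) (auto simp: lessThan_Suc)

lemma card_int_interval:
  fixes a b :: real
  shows "b - a - 1 \<le> real (card {j :: int. a \<le> real_of_int j \<and> real_of_int j < b})"
proof -
  have "{j :: int. a \<le> real_of_int j \<and> real_of_int j < b} = {\<lceil>a\<rceil>..<\<lceil>b\<rceil>}"
    by (auto simp: ceiling_le_iff less_ceiling_iff)
  then have "real (card {j :: int. a \<le> real_of_int j \<and> real_of_int j < b}) = real (nat (\<lceil>b\<rceil> - \<lceil>a\<rceil>))" by simp
  moreover have "b - a - 1 \<le> real (nat (\<lceil>b\<rceil> - \<lceil>a\<rceil>))" by linarith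
  ultimately show ?thesis by simp
qed

lemma star_closed_segment:
  assumes "star_closed A" "(x, y) \<in> A" "0 \<le> j" "j \<le> \<bar>y\<bar>"
  shows "(x, (if y \<ge> 0 then j else - j)) \<in> A"
proof (cases "y \<ge> 0")
  case True
  then show ?thesis using star_closed_tooth_pos[OF assms(1,2), of j] assms(3,4) by simp
next
  case False
  then show ?thesis using star_closed_tooth_neg[OF assms(1,2), of "- j"] assms(3,4) by simp
qed

context outer_tooth begin

lemma q_inside: "\<bar>x\<bar> \<le> x0 \<Longrightarrow> q x = 1 / (\<rho> - real_of_int (min x xt))\<^sup>2"
  using q_mid[of x] q_right[of x] by (cases "x \<le> xt") (auto simp: min_def)

lemma H_closure_bounds:
  assumes sgn: "\<bar>\<sigma>\<bar> = 1" and v: "v \<in> comb_closure (A \<inter> R)"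
  shows "0 \<le> H (reflect \<sigma> 1 v)" "8 * s * H (reflect \<sigma> 1 v) \<le> 1"
proof -
  obtain x y where xy: "v = (x, y)" by force
  have R: "(\<bar>x\<bar> \<le> x0 \<longrightarrow> \<bar>real_of_int y\<bar> \<le> height x + 1) \<and>
      (x0 < \<bar>x\<bar> \<longrightarrow> \<bar>x\<bar> \<le> x1 \<longrightarrow> \<bar>real_of_int y\<bar> \<le> T + 1)"
  proof (cases "y = 0")
    case True
    then show ?thesis using T by (simp add: height_def)
  next
    case False
    then have "(x, y) \<in> R \<or> (\<exists>u\<in>R. comb_adj u (x, y))"
      using v by (auto simp: xy comb_closure_def comb_nbrs_def)
    then obtain y' where y': "(x, y') \<in> R" "\<bar>real_of_int y\<bar> \<le> \<bar>real_of_int y'\<bar> + 1"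
      using False by (force simp: comb_adj_def)
    then show ?thesis by (auto simp: outer_region_def height_def \<rho>_def)
  qed
  have a: "\<bar>\<sigma> * x\<bar> = \<bar>x\<bar>" using sgn by (simp add: abs_mult)
  have "real_of_int \<bar>\<sigma> * x\<bar> = real_of_int \<bar>x\<bar>" unfolding a ..
  then have h: "height (\<sigma> * x) = height x" by (simp add: height_def)
  show "0 \<le> H (reflect \<sigma> 1 v)" using R a h by (simp add: xy reflect_def H_nonneg)
  show "8 * s * H (reflect \<sigma> 1 v) \<le> 1" using R a h unfolding xy reflect_def by (intro H_le) auto
qed

text \<open>
  An explorer settles in the region or at a neighbour of it, even when it is frozen.
\<close>

lemma H_cluster_nonneg:
  assumes sgn: "\<bar>\<sigma>\<bar> = 1" and proper: "\<forall>k. proper_path (\<omega> k)" and v: "v \<in> frozen_idla R \<omega> N"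
  shows "0 \<le> H (reflect \<sigma> 1 v)"
proof -
  obtain j where "v = first_outside (frozen_idla R \<omega> j \<inter> R) (\<omega> j)"
    using v by (subst (asm) frozen_idla_image) auto
  then have "v \<in> comb_closure (frozen_idla R \<omega> j \<inter> R)"
    using proper first_outside_in_closure[of "\<omega> j" "frozen_idla R \<omega> j \<inter> R"] by simp
  then show ?thesis by (rule H_closure_bounds(1)[OF sgn])
qed

context
  fixes \<rho>i :: real
  assumes \<rho>i: "1 \<le> \<rho>i" "\<rho>i + 3 \<le> x0"
begin

lemma q_edge_weight:
  assumes "\<bar>real_of_int x\<bar> \<le> \<rho>i + 2"
  shows "q x \<le> 9 * edge_weight \<rho>i x" "q x \<le> 1" "\<bar>real_of_int x\<bar> < \<rho>i \<Longrightarrow> tooth_height \<rho>i x * q x \<le> 1 / 3"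
proof -
  have x: "\<bar>x\<bar> \<le> x0" using assms \<rho>i by linarith
  define r where "r = \<rho> - real_of_int (min x xt)"
  have q: "q x = 1 / r\<^sup>2" using q_inside[OF x] by (simp add: r_def)
  have r: "r \<ge> 1" "r \<ge> \<rho>i - \<bar>real_of_int x\<bar>" using x m \<rho>i unfolding r_def \<rho>_def by linarith+
  have r2: "r\<^sup>2 \<ge> 1" using r by simp
  show q1: "q x \<le> 1" using r2 r by (simp add: q)
  have rq: "(\<rho>i - \<bar>real_of_int x\<bar>)\<^sup>2 * q x \<le> 1" if "0 \<le> \<rho>i - \<bar>real_of_int x\<bar>"
  proof -
    have "(\<rho>i - \<bar>real_of_int x\<bar>)\<^sup>2 \<le> r\<^sup>2" using r that by (intro power_mono)
    then show ?thesis using r2 by (simp add: q divide_le_eq)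
  qed
  show "q x \<le> 9 * edge_weight \<rho>i x"
  proof (cases "0 \<le> \<rho>i - \<bar>real_of_int x\<bar>")
    case True
    have "q x \<le> 4 * edge_weight \<rho>i x" by (rule le_edge_weight[OF refl True q1 rq[OF True]])
    then show ?thesis using edge_weight_nonneg[of \<rho>i x] by linarith
  next
    case False
    have "(1 + \<bar>\<rho>i - \<bar>real_of_int x\<bar>\<bar>)\<^sup>2 \<le> 3\<^sup>2" using False assms by (intro power_mono) auto
    then have "1 / 9 \<le> 1 / (1 + \<bar>\<rho>i - \<bar>real_of_int x\<bar>\<bar>)\<^sup>2"
      by (intro divide_left_mono) (auto intro!: mult_pos_pos simp: zero_less_power2)
    then show ?thesis using edge_weight_ge[of \<rho>i x] q1 by linarith
  qed
  show "tooth_height \<rho>i x * q x \<le> 1 / 3" if "\<bar>real_of_int x\<bar> < \<rho>i"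
    using rq that by (simp add: tooth_height_def max_def)
qed

lemma tooth_height_le_height:
  assumes "\<bar>real_of_int x\<bar> < \<rho>i"
  shows "tooth_height \<rho>i x \<le> height x"
proof -
  have "(\<rho>i - \<bar>real_of_int x\<bar>)\<^sup>2 \<le> (\<rho> - 1 - \<bar>real_of_int x\<bar>)\<^sup>2"
    using assms \<rho>i m by (intro power_mono) (auto simp: \<rho>_def)
  then show ?thesis using assms by (simp add: tooth_height_def height_def)
qed

text \<open>
  Quadrature for the smaller domain inside the region.
\<close>

lemma sum_H_inside: "4 / 9 * \<rho>i ^ 3 * q 0 - 300 \<le> (\<Sum>v\<in>\<D> \<rho>i. H v)"
proof -
  let ?M = "\<lceil>\<rho>i\<rceil> + 1"
  have err: "2 * \<bar>q x\<bar> + tooth_height \<rho>i x * \<bar>laplace q x\<bar> \<le> 36 * edge_weight \<rho>i x + (if x = xt then 1 else 0)"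
    if x: "x \<in> {-?M..?M}" for x
  proof -
    have x2: "\<bar>real_of_int x\<bar> \<le> \<rho>i + 2" using x by (simp add: abs_le_iff) linarith
    have xx: "\<bar>x\<bar> < x0" using x2 \<rho>i by linarith
    have qx: "\<bar>q x\<bar> = q x" "q x \<le> 9 * edge_weight \<rho>i x" using q_pos[of x] q_edge_weight(1)[OF x2] by auto
    have "tooth_height \<rho>i x * \<bar>laplace q x\<bar> \<le> 2 * q x + (if x = xt then 1 else 0)"
    proof (cases "\<bar>real_of_int x\<bar> < \<rho>i")
      case False
      then have "tooth_height \<rho>i x = 0" by (simp add: tooth_height_def)
      then show ?thesis using q_pos[of x] by simp
    next
      case True
      consider "0 \<le> laplace q x" | "x = xt" "xt \<le> x0" "laplace q x < 0"
        using xx laplace_ge_mid[of x] laplace_zero[of x] by fastforce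
      then show ?thesis
      proof cases
        case 1
        have "tooth_height \<rho>i x * \<bar>laplace q x\<bar> \<le> (height x + 1) * laplace q x"
          using 1 tooth_height_le_height[OF True] by (auto intro!: mult_right_mono)
        also have "\<dots> \<le> 2 * q x" using xx by (intro laplace_le) auto
        finally show ?thesis by auto
      next
        case 2
        define r where "r = \<rho> - real_of_int xt"
        have r: "r \<ge> 100" using 2 m by (simp add: r_def \<rho>_def)
        have "tooth_height \<rho>i x \<le> r\<^sup>2 / 3"
        proof -
          have "height xt \<le> r\<^sup>2 / 3"
            unfolding height_def r_def using xt 2 m by (intro divide_right_mono power_mono) (auto simp: \<rho>_def)
          then show ?thesis using tooth_height_le_height[OF True] 2 by simp
        qed
        then have "tooth_height \<rho>i x * \<bar>laplace q x\<bar> \<le> r\<^sup>2 / 3 * (2 / r ^ 3)"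
          using 2 target_slope(2)[OF 2(2)] r by (intro mult_mono) (auto simp: r_def)
        also have "\<dots> \<le> 1" using r by (simp add: power2_eq_square power3_eq_cube)
        finally show ?thesis using 2 q_pos[of x] by simp
      qed
    qed
    then show ?thesis using qx by linarith
  qed
  have "\<bar>(\<Sum>v\<in>\<D> \<rho>i. H v) - 4 / 9 * \<rho>i ^ 3 * q 0\<bar> \<le>
      \<rho>i * \<bar>q 0\<bar> + (\<Sum>x\<in>{-?M..?M}. 2 * \<bar>q x\<bar> + tooth_height \<rho>i x * \<bar>laplace q x\<bar>)"
    using comb_quadrature[of \<rho>i] \<rho>i by simp
  also have "(\<Sum>x\<in>{-?M..?M}. 2 * \<bar>q x\<bar> + tooth_height \<rho>i x * \<bar>laplace q x\<bar>) \<le>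
      (\<Sum>x\<in>{-?M..?M}. 36 * edge_weight \<rho>i x + (if x = xt then 1 else 0))"
    by (rule sum_mono[OF err])
  also have "\<dots> = 36 * (\<Sum>x\<in>{-?M..?M}. edge_weight \<rho>i x) + (\<Sum>x\<in>{-?M..?M}. if x = xt then 1 else 0)"
    by (simp add: sum.distrib sum_distrib_left)
  also have "\<dots> \<le> 36 * 8 + 1"
    using sum_edge_weight_le by (intro add_mono mult_left_mono sum_single_le) auto
  finally have "\<bar>(\<Sum>v\<in>\<D> \<rho>i. H v) - 4 / 9 * \<rho>i ^ 3 * q 0\<bar> \<le> \<rho>i * \<bar>q 0\<bar> + 289" by simp
  moreover have "\<rho>i * \<bar>q 0\<bar> \<le> 1"
  proof -
    have \<rho>: "\<rho>i \<le> \<rho>" "\<rho> \<ge> 1" using \<rho>i m by (auto simp: \<rho>_def)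
    have "\<rho>i * \<bar>q 0\<bar> \<le> \<rho> * (1 / \<rho>\<^sup>2)" unfolding q0 using \<rho> \<rho>i by (intro mult_mono) auto
    also have "\<dots> \<le> 1" using \<rho> by (simp add: power2_eq_square)
    finally show ?thesis .
  qed
  ultimately show ?thesis by linarith
qed

lemma sum_sq_H_inside: "(\<Sum>v\<in>\<D> \<rho>i. (H v)\<^sup>2) \<le> 200"
proof -
  let ?M = "\<lceil>\<rho>i\<rceil> + 1"
  have sub: "{x. \<bar>real_of_int x\<bar> < \<rho>i} \<subseteq> {-?M..?M}"
    by (auto simp: abs_less_iff) linarith+
  have row: "(\<Sum>y\<in>tooth_sites (tooth_height \<rho>i x). (H (x, y))\<^sup>2) \<le> 18 * edge_weight \<rho>i x + (if x = xt then 1 else 0)"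
    if x: "\<bar>real_of_int x\<bar> < \<rho>i" for x
  proof -
    have xx: "\<bar>x\<bar> < x0" using x \<rho>i by linarith
    have hp: "tooth_height \<rho>i x > 0" using x by (simp add: tooth_height_def)
    have card: "real (card (tooth_sites (tooth_height \<rho>i x))) \<le> 2 * tooth_height \<rho>i x + 1"
      using card_tooth_sites[OF hp] by linarith
    have H0: "0 \<le> H (x, y)" if "y \<in> tooth_sites (tooth_height \<rho>i x)" for y
      using that tooth_height_le_height[OF x] by (intro H_nonneg) (auto simp: tooth_sites_def)
    show ?thesis
    proof (cases "x = xt")
      case True
      define r where "r = \<rho> - real_of_int xt"
      have xt0: "xt \<le> x0" using xx True by simp
      have r: "r \<ge> 100" using xt0 m by (simp add: r_def \<rho>_def)
      have "tooth_height \<rho>i x \<le> r\<^sup>2 / 3"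
      proof -
        have "height xt \<le> r\<^sup>2 / 3"
          unfolding height_def r_def using xt xt0 m by (intro divide_right_mono power_mono) (auto simp: \<rho>_def)
        then show ?thesis using tooth_height_le_height[OF x] True by simp
      qed
      then have c: "real (card (tooth_sites (tooth_height \<rho>i x))) \<le> r\<^sup>2"
        using card r power_mono[of 100 r 2] by simp
      have "(\<Sum>y\<in>tooth_sites (tooth_height \<rho>i x). (H (x, y))\<^sup>2) \<le> (\<Sum>y\<in>tooth_sites (tooth_height \<rho>i x). (1 / r)\<^sup>2)"
      proof (rule sum_mono)
        fix y assume y: "y \<in> tooth_sites (tooth_height \<rho>i x)"
        have "H (x, y) \<le> 1 / r" unfolding True r_def
          using y tooth_height_le_height[OF x] True by (intro H_target_le[OF xt0]) (auto simp: tooth_sites_def)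
        then show "(H (x, y))\<^sup>2 \<le> (1 / r)\<^sup>2" using H0[OF y] by (intro power_mono)
      qed
      also have "\<dots> \<le> r\<^sup>2 * (1 / r)\<^sup>2" using c by (simp add: mult_right_mono)
      also have "\<dots> = 1" using r by (simp add: power_divide)
      finally show ?thesis using True by (simp add: add_increasing)
    next
      case False
      have x2: "\<bar>real_of_int x\<bar> \<le> \<rho>i + 2" using x by simp
      have le: "H (x, y) \<le> q x" for y
      proof (cases "x < xt")
        case True
        then show ?thesis using xx by (intro H_le_left) auto
      next
        case f: False
        then have "laplace q x = 0" using False by (intro laplace_zero) auto
        then show ?thesis by (simp add: H_eq)
      qed
      have "(\<Sum>y\<in>tooth_sites (tooth_height \<rho>i x). (H (x, y))\<^sup>2) \<le> (\<Sum>y\<in>tooth_sites (tooth_height \<rho>i x). (q x)\<^sup>2)"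
        using H0 le by (intro sum_mono power_mono) auto
      also have "\<dots> \<le> (2 * tooth_height \<rho>i x + 1) * (q x)\<^sup>2" using card by (simp add: mult_right_mono)
      also have "\<dots> = 2 * (tooth_height \<rho>i x * q x) * q x + q x * q x" by (simp add: power2_eq_square algebra_simps)
      also have "\<dots> \<le> 2 * (1 / 3) * q x + 1 * q x"
        using q_edge_weight[OF x2] x q_pos[of x] by (intro add_mono mult_right_mono mult_left_mono) auto
      also have "\<dots> \<le> 2 * q x" using q_pos[of x] by simp
      also have "\<dots> \<le> 18 * edge_weight \<rho>i x" using q_edge_weight(1)[OF x2] by simp
      finally show ?thesis using False by simp
    qed
  qed
  have "(\<Sum>v\<in>\<D> \<rho>i. (H v)\<^sup>2) \<le> (\<Sum>x | \<bar>real_of_int x\<bar> < \<rho>i. 18 * edge_weight \<rho>i x + (if x = xt then 1 else 0))"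
    unfolding sum_\<D> by (intro sum_mono row) simp
  also have "\<dots> \<le> (\<Sum>x\<in>{-?M..?M}. 18 * edge_weight \<rho>i x + (if x = xt then 1 else 0))"
    using sub by (intro sum_mono2) auto
  also have "\<dots> = 18 * (\<Sum>x\<in>{-?M..?M}. edge_weight \<rho>i x) + (\<Sum>x\<in>{-?M..?M}. if x = xt then 1 else 0)"
    by (simp add: sum.distrib sum_distrib_left)
  also have "\<dots> \<le> 18 * 8 + 1"
    using sum_edge_weight_le by (intro add_mono mult_left_mono sum_single_le) auto
  finally show ?thesis by simp
qed

text \<open>
  The product of \<open>1 + s * (H - q 0)\<close>. Off the exceptional event the sum of \<open>H\<close> over the exit points, which
  include every site of the cluster, is at most \<open>N * q 0\<close> up to errors of order \<open>s\<close>. The sites of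
  \<open>\<D> \<rho>i\<close> take \<open>4 / 9 * \<rho>i ^ 3 * q 0\<close> of this and leave little for the others. Since
  \<open>H \<ge> 0\<close>, an explorer frozen at an occupied site can be dropped from the sum.
\<close>

lemma outer_excess:
  fixes \<sigma> :: int and N :: nat
  assumes sgn: "\<bar>\<sigma>\<bar> = 1"
  shows "fails_within (exp (- (4 * s\<^sup>2))) (\<lambda>\<omega>. \<D> \<rho>i \<subseteq> frozen_idla R \<omega> N \<longrightarrow>
    (\<Sum>v\<in>frozen_idla R \<omega> N - \<D> \<rho>i. H (reflect \<sigma> 1 v)) \<le>
      2 * (4 * s + q 0 * (real N - 4 / 9 * \<rho>i ^ 3) + 4 * s * (q 0)\<^sup>2 * real N + 300 + 800 * s))"
proof -
  have sg: "\<bar>\<sigma>\<bar> = 1" "\<bar>1 :: int\<bar> = 1" using sgn by auto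
  define H' where "H' = (\<lambda>v. H (reflect \<sigma> 1 v))"
  define S where "S = (\<lambda>A. A \<inter> R)"
  define \<Psi> :: "(int \<times> int) set \<Rightarrow> int \<times> int \<Rightarrow> real" where "\<Psi> = (\<lambda>A v. 1 + s * (H' v - q 0))"
  have cl: "0 \<le> H' v" "8 * s * H' v \<le> 1" if "v \<in> comb_closure (S A)" for v A
    using H_closure_bounds[OF sgn, of v A] that unfolding H'_def S_def by auto
  have H0: "H' (0, 0) = q 0" by (simp add: H'_def reflect_def comb_harmonic_def)
  have sq0: "0 < q 0" "s * q 0 \<le> 1 / 8"
    using q_pos[of 0] cl(2)[of "(0, 0)" "{}"] H0 by (auto simp: comb_closure_def S_def)
  have mean: "nbr_mean (\<Psi> A) v = \<Psi> A v" for A v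
  proof -
    have H: "nbr_mean H' v = H' v"
      unfolding H'_def nbr_mean_reflect[OF sg] by (rule nbr_mean_comb_harmonic)
    have c: "card (comb_nbrs v) \<noteq> 0" using finite_comb_nbrs comb_nbrs_nonempty by simp
    have "nbr_mean (\<Psi> A) v = 1 + s * (nbr_mean H' v - q 0)"
      unfolding nbr_mean_def \<Psi>_def using c
      by (simp add: sum.distrib sum_subtractf field_simps flip: sum_distrib_left)
    then show ?thesis by (simp add: H \<Psi>_def)
  qed
  have nonneg: "0 \<le> \<Psi> A v" if v: "v \<in> comb_closure (S A)" for A v
  proof -
    have "0 \<le> s * H' v" using cl(1)[OF v] s by simp
    then show ?thesis using sq0 unfolding \<Psi>_def right_diff_distrib by linarith
  qed
  let ?E = "{\<omega>. ennreal (exp (4 * s\<^sup>2)) \<le> explorer_product R S \<Psi> N \<omega>}"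
  have E: "?E \<in> sets explorers_law" "measure explorers_law ?E \<le> 1 / exp (4 * s\<^sup>2)"
  proof -
    have 1: "finite A \<Longrightarrow> finite (S A)" for A by (simp add: S_def)
    \<comment> \<open>Several explorers may be frozen at the same site, so this is only an inequality.\<close>
    have 2: "finite A \<Longrightarrow> v \<in> S A \<Longrightarrow> nbr_mean (\<Psi> A) v \<le> \<Psi> A v" for A v by (simp add: mean)
    have 4: "finite A \<Longrightarrow> \<Psi> A (0, 0) \<le> 1" for A by (simp add: \<Psi>_def H0)
    show "?E \<in> sets explorers_law" "measure explorers_law ?E \<le> 1 / exp (4 * s\<^sup>2)"
      by (rule explorer_product_markov[OF 1 2 nonneg 4]; simp)+
  qed
  have main: "(\<Sum>v\<in>frozen_idla R \<omega> N - \<D> \<rho>i. H' v) \<le>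
      2 * (4 * s + q 0 * (real N - 4 / 9 * \<rho>i ^ 3) + 4 * s * (q 0)\<^sup>2 * real N + 300 + 800 * s)"
    if proper: "\<forall>k. proper_path (\<omega> k)" and nE: "\<omega> \<notin> ?E" and D: "\<D> \<rho>i \<subseteq> frozen_idla R \<omega> N" for \<omega>
  proof -
    let ?A = "frozen_idla R \<omega>"
    define Y where "Y = (\<lambda>j. first_outside (S (?A j)) (\<omega> j))"
    have Ycl: "Y j \<in> comb_closure (S (?A j))" for j
      unfolding Y_def using proper by (intro first_outside_in_closure) (auto simp: S_def)
    have img: "?A N = Y ` {..<N}" unfolding Y_def S_def by (rule frozen_idla_image)
    define g where "g = (\<lambda>v. s * H' v - 4 * s\<^sup>2 * (H' v)\<^sup>2)"
    have g_half: "s * H' v / 2 \<le> g v" "0 \<le> g v" if "v \<in> comb_closure (S A)" for v A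
    proof -
      have a: "0 \<le> s * H' v" using cl(1)[OF that] s by simp
      have "(8 * s * H' v) * (s * H' v) \<le> 1 * (s * H' v)" using cl(2)[OF that] a by (intro mult_right_mono)
      then show "s * H' v / 2 \<le> g v" by (simp add: g_def power2_eq_square mult_ac)
      then show "0 \<le> g v" using a by linarith
    qed
    define f where "f = (\<lambda>j. g (Y j) - (s * q 0 + 4 * s\<^sup>2 * (q 0)\<^sup>2))"
    have factor: "exp (f j) \<le> \<Psi> (?A j) (Y j)" for j
    proof -
      define x where "x = s * (H' (Y j) - q 0)"
      have a: "0 \<le> s * H' (Y j)" "s * H' (Y j) \<le> 1 / 8"
        using cl(1)[OF Ycl, of j] cl(2)[OF Ycl, of j] s unfolding mult.assoc by (simp, linarith)
      have x: "\<bar>x\<bar> \<le> 1 / 2" unfolding x_def right_diff_distrib using a sq0 s mult_pos_pos[OF s sq0(1)] by linarith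
      have "2 * x\<^sup>2 \<le> 4 * s\<^sup>2 * (q 0)\<^sup>2 + 4 * s\<^sup>2 * (H' (Y j))\<^sup>2"
      proof -
        have "0 \<le> 2 * (s * q 0 + s * H' (Y j))\<^sup>2" by simp
        then show ?thesis by (simp add: x_def power2_eq_square algebra_simps)
      qed
      moreover have "f j = x - (4 * s\<^sup>2 * (q 0)\<^sup>2 + 4 * s\<^sup>2 * (H' (Y j))\<^sup>2)"
        by (simp add: f_def g_def x_def algebra_simps)
      ultimately have "exp (f j) \<le> exp (x - 2 * x\<^sup>2)" by simp
      also have "\<dots> \<le> 1 + x" by (rule one_plus_ge_exp[OF x])
      finally show ?thesis by (simp add: \<Psi>_def x_def)
    qed
    have "ennreal (exp (\<Sum>j<N. f j)) \<le> explorer_product R S \<Psi> N \<omega>"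
      by (rule explorer_product_ge_exp) (use factor in \<open>simp add: Y_def\<close>)
    then have "ennreal (exp (\<Sum>j<N. f j)) < ennreal (exp (4 * s\<^sup>2))" using nE by simp
    then have "(\<Sum>j<N. f j) < 4 * s\<^sup>2" by (simp add: ennreal_less_iff)
    then have 1: "(\<Sum>j<N. g (Y j)) \<le> 4 * s\<^sup>2 + real N * (s * q 0 + 4 * s\<^sup>2 * (q 0)\<^sup>2)"
      by (simp add: f_def sum_subtractf)
    have 2: "(\<Sum>v\<in>?A N. g v) \<le> (\<Sum>j<N. g (Y j))"
      unfolding img using sum_image_le[of "{..<N}" g Y] g_half(2)[OF Ycl] by (simp add: comp_def)
    have 3: "(\<Sum>v\<in>?A N. g v) = (\<Sum>v\<in>?A N - \<D> \<rho>i. g v) + (\<Sum>v\<in>\<D> \<rho>i. g v)"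
      using D by (intro sum.subset_diff) auto
    have 4: "(\<Sum>v\<in>?A N - \<D> \<rho>i. s * H' v / 2) \<le> (\<Sum>v\<in>?A N - \<D> \<rho>i. g v)"
    proof (rule sum_mono)
      fix v assume "v \<in> ?A N - \<D> \<rho>i"
      then obtain i where "v = Y i" unfolding img by blast
      then show "s * H' v / 2 \<le> g v" using g_half(1)[OF Ycl[of i]] by simp
    qed
    have 5: "(\<Sum>v\<in>\<D> \<rho>i. g v) = s * (\<Sum>v\<in>\<D> \<rho>i. H' v) - 4 * s\<^sup>2 * (\<Sum>v\<in>\<D> \<rho>i. (H' v)\<^sup>2)"
      by (simp add: g_def sum_subtractf sum_distrib_left)
    have 6: "(\<Sum>v\<in>\<D> \<rho>i. H' v) \<ge> 4 / 9 * \<rho>i ^ 3 * q 0 - 300"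
      using sum_H_inside unfolding H'_def by (subst sum_reflect_\<D>[OF sg, of H]) simp
    have 7: "(\<Sum>v\<in>\<D> \<rho>i. (H' v)\<^sup>2) \<le> 200"
      using sum_sq_H_inside unfolding H'_def by (subst sum_reflect_\<D>[OF sg, of "\<lambda>v. (H v)\<^sup>2"]) simp
    have 8: "s * (\<Sum>v\<in>\<D> \<rho>i. H' v) \<ge> s * (4 / 9 * \<rho>i ^ 3 * q 0 - 300)" using 6 s by (intro mult_left_mono) auto
    have 9: "4 * s\<^sup>2 * (\<Sum>v\<in>\<D> \<rho>i. (H' v)\<^sup>2) \<le> 4 * s\<^sup>2 * 200" using 7 by (intro mult_left_mono) auto
    have "s * (\<Sum>v\<in>?A N - \<D> \<rho>i. H' v) / 2 = (\<Sum>v\<in>?A N - \<D> \<rho>i. s * H' v / 2)"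
      by (simp add: sum_distrib_left sum_divide_distrib)
    also have "\<dots> \<le> 4 * s\<^sup>2 + real N * (s * q 0 + 4 * s\<^sup>2 * (q 0)\<^sup>2)
        - s * (4 / 9 * \<rho>i ^ 3 * q 0 - 300) + 4 * s\<^sup>2 * 200"
      using 1 2 3 4 5 8 9 by linarith
    also have "\<dots> = s * (4 * s + q 0 * (real N - 4 / 9 * \<rho>i ^ 3) + 4 * s * (q 0)\<^sup>2 * real N + 300 + 800 * s)"
      by (simp add: algebra_simps power2_eq_square)
    finally have "s * ((\<Sum>v\<in>?A N - \<D> \<rho>i. H' v) / 2) \<le> s * (4 * s + q 0 * (real N - 4 / 9 * \<rho>i ^ 3) + 4 * s * (q 0)\<^sup>2 * real N + 300 + 800 * s)"
      by simp
    then have "(\<Sum>v\<in>?A N - \<D> \<rho>i. H' v) / 2 \<le> 4 * s + q 0 * (real N - 4 / 9 * \<rho>i ^ 3) + 4 * s * (q 0)\<^sup>2 * real N + 300 + 800 * s"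
      using s by (simp only: mult_le_cancel_left_pos)
    then show ?thesis by (simp only: pos_divide_le_eq[OF zero_less_numeral] mult.commute[of _ 2])
  qed
  show ?thesis unfolding fails_within_def using E main
    by (intro bexI[of _ ?E]) (auto simp: exp_minus inverse_eq_divide H'_def)
qed

end

lemma excess_ge_card:
  assumes "finite A" "Z \<subseteq> A - D" "\<And>v. v \<in> A \<Longrightarrow> 0 \<le> f v" "\<And>v. v \<in> Z \<Longrightarrow> (c :: real) \<le> f v"
  shows "real (card Z) * c \<le> (\<Sum>v\<in>A - D. f v)"
proof -
  have "real (card Z) * c = (\<Sum>v\<in>Z. c)" by simp
  also have "\<dots> \<le> (\<Sum>v\<in>Z. f v)" using assms by (intro sum_mono) auto
  also have "\<dots> \<le> (\<Sum>v\<in>A - D. f v)" using assms by (intro sum_mono2) auto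
  finally show ?thesis .
qed

text \<open>
  A tooth reaching the boundary of the region has about \<open>m * r\<close> sites outside \<open>\<D> \<rho>i\<close>, and on most of
  them the potential is of order \<open>1 / r\<close>.
\<close>

lemma tip_excess:
  fixes \<sigma> y0 :: int
  assumes A: "finite A" "star_closed A" "\<And>v. v \<in> A \<Longrightarrow> 0 \<le> H (reflect \<sigma> 1 v)" and sgn: "\<bar>\<sigma>\<bar> = 1"
    and le: "xt \<le> x0" and tip: "(\<sigma> * xt, y0) \<in> A" "height xt \<le> \<bar>real_of_int y0\<bar>"
    and \<rho>i: "\<rho>i + m / 2 \<le> \<rho>"
  shows "m / 192 \<le> (\<Sum>v\<in>A - \<D> \<rho>i. H (reflect \<sigma> 1 v))"
proof -
  define r where "r = \<rho> - real_of_int xt"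
  define u where "u = m / 2"
  have u: "u \<ge> 50" "2 * u \<le> r" "r \<ge> 100" using m le by (auto simp: u_def r_def \<rho>_def)
  \<comment> \<open>The outermost part of the tooth that lies outside \<open>\<D> \<rho>i\<close>.\<close>
  define J where "J = {j :: int. (r - u)\<^sup>2 / 3 \<le> real_of_int j \<and> real_of_int j < (r - 1)\<^sup>2 / 3}"
  define \<phi> where "\<phi> = (\<lambda>j. (\<sigma> * xt, if y0 \<ge> 0 then j else - j :: int))"
  have inj: "inj_on \<phi> J" by (auto simp: inj_on_def \<phi>_def split: if_splits)
  have axt: "\<bar>real_of_int (\<sigma> * xt)\<bar> = real_of_int xt"
    using sgn xt by (simp add: abs_mult) (metis mult_1 of_int_1 of_int_abs)
  have hx: "height xt = (r - 1)\<^sup>2 / 3" using xt by (simp add: height_def r_def algebra_simps)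
  have j0: "0 \<le> j" if "j \<in> J" for j
  proof -
    have "0 \<le> (r - u)\<^sup>2 / 3" by simp
    then have "0 \<le> real_of_int j" using that unfolding J_def by (blast intro: order_trans)
    then show ?thesis by simp
  qed
  have Z: "\<phi> ` J \<subseteq> A - \<D> \<rho>i"
  proof (intro subsetI)
    fix v assume "v \<in> \<phi> ` J"
    then obtain j where j: "j \<in> J" "v = \<phi> j" by auto
    have "real_of_int j \<le> \<bar>real_of_int y0\<bar>" using j tip(2) hx by (auto simp: J_def)
    then have "j \<le> \<bar>y0\<bar>" by linarith
    then have "v \<in> A" using star_closed_segment[OF A(2) tip(1) j0[OF j(1)]] by (simp add: j \<phi>_def)
    moreover have "v \<notin> \<D> \<rho>i"
    proof
      assume "v \<in> \<D> \<rho>i"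
      then have "real_of_int xt < \<rho>i" "\<bar>real_of_int j\<bar> < 1 / 3 * (\<rho>i - real_of_int xt)\<^sup>2"
        unfolding j \<phi>_def \<D>_def using axt by (auto split: if_splits)
      moreover have "(\<rho>i - real_of_int xt)\<^sup>2 \<le> (r - u)\<^sup>2"
        using \<rho>i calculation(1) by (intro power_mono) (auto simp: r_def u_def)
      ultimately show False using j by (auto simp: J_def)
    qed
    ultimately show "v \<in> A - \<D> \<rho>i" by simp
  qed
  have val: "1 / (24 * r) \<le> H (reflect \<sigma> 1 v)" if "v \<in> \<phi> ` J" for v
  proof -
    from that obtain j where j: "j \<in> J" "v = \<phi> j" by auto
    have ss: "\<sigma> * \<sigma> = 1" using sign_cases[OF sgn] by auto
    have "reflect \<sigma> 1 v = (xt, if y0 \<ge> 0 then j else - j)"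
      by (simp add: j \<phi>_def reflect_def ss flip: mult.assoc)
    then have e: "H (reflect \<sigma> 1 v) = q xt + \<bar>real_of_int j\<bar> * (- laplace q xt) / 2"
      by (simp add: H_eq)
    have "r\<^sup>2 / 12 \<le> (r - u)\<^sup>2 / 3"
    proof -
      have "(r / 2)\<^sup>2 \<le> (r - u)\<^sup>2" using u by (intro power_mono) auto
      then show ?thesis by (simp add: power_divide)
    qed
    then have "r\<^sup>2 / 12 \<le> \<bar>real_of_int j\<bar>" using j by (auto simp: J_def)
    then have "r\<^sup>2 / 12 * (1 / r ^ 3) \<le> \<bar>real_of_int j\<bar> * (- laplace q xt)"
      using target_slope(1)[OF le] u by (intro mult_mono) (auto simp: r_def)
    moreover have "r\<^sup>2 / 12 * (1 / r ^ 3) = 2 * (1 / (24 * r))"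
      using u by (simp add: power2_eq_square power3_eq_cube)
    ultimately show ?thesis unfolding e using q_pos[of xt] by linarith
  qed
  have "real (card (\<phi> ` J)) * (1 / (24 * r)) \<le> (\<Sum>v\<in>A - \<D> \<rho>i. H (reflect \<sigma> 1 v))"
    by (rule excess_ge_card[OF A(1) Z A(3) val])
  moreover have "m / 192 \<le> real (card (\<phi> ` J)) * (1 / (24 * r))"
  proof -
    have "(r - 1)\<^sup>2 / 3 - (r - u)\<^sup>2 / 3 - 1 \<le> real (card (\<phi> ` J))"
      unfolding card_image[OF inj] unfolding J_def by (rule card_int_interval)
    moreover have "(r - 1)\<^sup>2 / 3 - (r - u)\<^sup>2 / 3 = (u - 1) * (2 * r - 1 - u) / 3"
      by (simp add: power2_eq_square field_simps)
    moreover have "(u - 1) * r \<le> (u - 1) * (2 * r - 1 - u)" using u by (intro mult_left_mono) auto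
    moreover have "u * r / 4 \<le> (u - 1) * r / 3 - 1"
    proof -
      have "50 * r \<le> u * r" using u by (intro mult_right_mono) auto
      moreover have "(u - 1) * r / 3 - 1 - u * r / 4 = u * r / 12 - r / 3 - 1" by (simp add: field_simps)
      ultimately show ?thesis using u by linarith
    qed
    ultimately have "u * r / 4 \<le> real (card (\<phi> ` J))" by linarith
    then have "u * r / 4 * (1 / (24 * r)) \<le> real (card (\<phi> ` J)) * (1 / (24 * r))"
      using u by (intro mult_right_mono) auto
    moreover have "u * r / 4 * (1 / (24 * r)) = m / 192" using u by (simp add: u_def)
    ultimately show ?thesis by simp
  qed
  ultimately show ?thesis by linarith
qed

text \<open>
  Beyond \<open>x0\<close> the target tooth has potential \<open>\<bar>y\<bar> * \<kappa> / 2\<close>; the outer half of a tooth of length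
  \<open>T\<close> is enough.
\<close>

lemma far_tip_excess:
  fixes \<sigma> y0 :: int and \<rho>i :: real
  assumes A: "finite A" "star_closed A" "\<And>v. v \<in> A \<Longrightarrow> 0 \<le> H (reflect \<sigma> 1 v)" and sgn: "\<bar>\<sigma>\<bar> = 1"
    and far: "x0 < xt" and tip: "(\<sigma> * xt, y0) \<in> A" "T \<le> \<bar>real_of_int y0\<bar>" and T4: "T \<ge> 4"
    and \<rho>i: "\<rho>i \<le> x0"
  shows "\<kappa> * T\<^sup>2 / 16 \<le> (\<Sum>v\<in>A - \<D> \<rho>i. H (reflect \<sigma> 1 v))"
proof -
  define J where "J = {j :: int. T / 2 \<le> real_of_int j \<and> real_of_int j < T}"
  define \<phi> where "\<phi> = (\<lambda>j. (\<sigma> * xt, if y0 \<ge> 0 then j else - j :: int))"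
  have inj: "inj_on \<phi> J" by (auto simp: inj_on_def \<phi>_def split: if_splits)
  have axt: "\<bar>real_of_int (\<sigma> * xt)\<bar> = real_of_int xt"
    using sgn xt by (simp add: abs_mult) (metis mult_1 of_int_1 of_int_abs)
  have Z: "\<phi> ` J \<subseteq> A - \<D> \<rho>i"
  proof (intro subsetI)
    fix v assume "v \<in> \<phi> ` J"
    then obtain j where j: "j \<in> J" "v = \<phi> j" by auto
    have "real_of_int j \<le> \<bar>real_of_int y0\<bar>" using j tip(2) by (auto simp: J_def)
    then have "j \<le> \<bar>y0\<bar>" by linarith
    moreover have "0 \<le> real_of_int j" using j T4 unfolding J_def by simp
    ultimately have "v \<in> A" using star_closed_segment[OF A(2) tip(1), of j] by (simp add: j \<phi>_def)
    moreover have "v \<notin> \<D> \<rho>i"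
    proof
      assume "v \<in> \<D> \<rho>i"
      then have "real_of_int xt < \<rho>i"
        unfolding j \<phi>_def \<D>_def using axt by (auto split: if_splits)
      then show False using \<rho>i far by linarith
    qed
    ultimately show "v \<in> A - \<D> \<rho>i" by simp
  qed
  have val: "\<kappa> * T / 4 \<le> H (reflect \<sigma> 1 v)" if "v \<in> \<phi> ` J" for v
  proof -
    from that obtain j where j: "j \<in> J" "v = \<phi> j" by auto
    have ss: "\<sigma> * \<sigma> = 1" using sign_cases[OF sgn] by auto
    have "reflect \<sigma> 1 v = (xt, if y0 \<ge> 0 then j else - j)"
      by (simp add: j \<phi>_def reflect_def ss flip: mult.assoc)
    then have "H (reflect \<sigma> 1 v) = q xt - \<bar>real_of_int j\<bar> * laplace q xt / 2"
      by (simp add: H_eq)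
    then have e: "H (reflect \<sigma> 1 v) = q xt + \<bar>real_of_int j\<bar> * \<kappa> / 2"
      unfolding laplace_far_target[OF far] by simp
    have "T / 2 * \<kappa> \<le> \<bar>real_of_int j\<bar> * \<kappa>" using j kappa by (intro mult_right_mono) (auto simp: J_def)
    then show ?thesis unfolding e using q_pos[of xt] by (simp add: mult.commute)
  qed
  have "real (card (\<phi> ` J)) * (\<kappa> * T / 4) \<le> (\<Sum>v\<in>A - \<D> \<rho>i. H (reflect \<sigma> 1 v))"
    by (rule excess_ge_card[OF A(1) Z A(3) val])
  moreover have "\<kappa> * T\<^sup>2 / 16 \<le> real (card (\<phi> ` J)) * (\<kappa> * T / 4)"
  proof -
    have "T - T / 2 - 1 \<le> real (card (\<phi> ` J))"
      unfolding card_image[OF inj] unfolding J_def by (rule card_int_interval)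
    then have "T / 4 \<le> real (card (\<phi> ` J))" using T4 by linarith
    then have "T / 4 * (\<kappa> * T / 4) \<le> real (card (\<phi> ` J)) * (\<kappa> * T / 4)"
      using kappa T by (intro mult_right_mono) auto
    then show ?thesis by (simp add: power2_eq_square mult_ac)
  qed
  ultimately show ?thesis by linarith
qed

text \<open>
  With the target at \<open>x0\<close>, the potential is at least \<open>1 / m\<^sup>2\<close> on everything beyond.
\<close>

lemma count_excess:
  fixes \<sigma> :: int and \<rho>i :: real
  assumes A: "finite A" "\<And>v. v \<in> A \<Longrightarrow> 0 \<le> H (reflect \<sigma> 1 v)" and sgn: "\<bar>\<sigma>\<bar> = 1"
    and eq: "xt = x0" and \<rho>i: "\<rho>i \<le> x0"
  shows "real (card {v \<in> A. x0 \<le> \<sigma> * fst v}) * (1 / m\<^sup>2) \<le> (\<Sum>v\<in>A - \<D> \<rho>i. H (reflect \<sigma> 1 v))"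
proof (rule excess_ge_card[OF A(1) _ A(2)])
  show "{v \<in> A. x0 \<le> \<sigma> * fst v} \<subseteq> A - \<D> \<rho>i"
  proof safe
    fix x y assume *: "x0 \<le> \<sigma> * fst (x, y)" "(x, y) \<in> \<D> \<rho>i"
    have "\<sigma> * x \<le> \<bar>x\<bar>" using sign_cases[OF sgn] by auto
    then have "x0 \<le> \<bar>x\<bar>" using * by simp
    moreover have "\<bar>real_of_int x\<bar> < \<rho>i" using * by (simp add: \<D>_def)
    ultimately show False using \<rho>i by linarith
  qed
  fix v assume v: "v \<in> {v \<in> A. x0 \<le> \<sigma> * fst v}"
  have "q (\<sigma> * fst v) = 1 / m\<^sup>2" using v eq q_right[of "\<sigma> * fst v"] by (simp add: \<rho>_def)
  then show "1 / m\<^sup>2 \<le> H (reflect \<sigma> 1 v)"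
    using H_ge_right[of "\<sigma> * fst v" "snd v"] v eq by (simp add: reflect_def)
qed

end

section \<open>The front on the backbone\<close>

definition count_right :: "int \<Rightarrow> int \<Rightarrow> (int \<times> int) set \<Rightarrow> nat" where
  "count_right \<sigma> X A = card {v \<in> A. X < \<sigma> * fst v}"

definition tooth_count :: "int \<Rightarrow> (int \<times> int) set \<Rightarrow> int \<Rightarrow> nat" where
  "tooth_count \<sigma> A x = card {v \<in> A. \<sigma> * fst v = x}"

text \<open>
  The values on the backbone of a function that is harmonic there and vanishes linearly on tooth \<open>i\<close> at
  height \<open>L i\<close>, a discrete solution of \<open>g'' = 2 * g / L\<close>. Short teeth force fast growth.
\<close>

fun growth :: "(nat \<Rightarrow> real) \<Rightarrow> nat \<Rightarrow> real" where
  "growth L 0 = 1"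
| "growth L (Suc 0) = 1"
| "growth L (Suc (Suc i)) = 2 * growth L (Suc i) - growth L i + 2 * growth L (Suc i) / L (Suc i)"

lemma growth_mono_pos:
  assumes "\<And>i. 0 < L i"
  shows "1 \<le> growth L i \<and> growth L i \<le> growth L (Suc i)"
proof (induction i)
  case (Suc i)
  have "0 \<le> 2 * growth L (Suc i) / L (Suc i)" using Suc assms[of "Suc i"] by simp
  then have "growth L (Suc i) \<le> growth L (Suc (Suc i))" using Suc unfolding growth.simps(3) by linarith
  then show ?case using Suc by simp
qed simp

lemma growth_le:
  assumes "\<And>i. 0 < L i" "i \<le> j"
  shows "growth L i \<le> growth L j"
  using growth_mono_pos[of L, OF assms(1)] lift_Suc_mono_le[of "growth L" i j] assms(2) by blast

lemma growth_slope_sum: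
  "growth L (Suc (a + v)) - growth L (a + v) =
   growth L (Suc a) - growth L a + (\<Sum>i\<in>{a<..a + v}. 2 * growth L i / L i)"
proof (induction v)
  case (Suc v)
  have "{a<..a + Suc v} = insert (Suc (a + v)) {a<..a + v}" by auto
  then show ?case using Suc by simp
qed simp

text \<open>
  The inequality between the arithmetic and the harmonic mean.
\<close>

lemma sum_inverse_ge:
  fixes L :: "'a \<Rightarrow> real"
  assumes "finite A" "A \<noteq> {}" "\<And>i. i \<in> A \<Longrightarrow> 0 < L i"
  shows "(real (card A))\<^sup>2 / (\<Sum>i\<in>A. L i) \<le> (\<Sum>i\<in>A. 1 / L i)"
proof -
  define S where "S = (\<Sum>i\<in>A. L i)"
  have S: "0 < S" unfolding S_def using assms by (intro sum_pos) auto
  define t where "t = real (card A) / S"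
  have "2 * t - t\<^sup>2 * L i \<le> 1 / L i" if "i \<in> A" for i
  proof -
    have "0 \<le> (1 - t * L i)\<^sup>2 / L i" using assms(3)[OF that] by simp
    also have "\<dots> = 1 / L i - 2 * t + t\<^sup>2 * L i"
      using assms(3)[OF that] by (simp add: power2_eq_square field_simps)
    finally show ?thesis by linarith
  qed
  then have "(\<Sum>i\<in>A. 2 * t - t\<^sup>2 * L i) \<le> (\<Sum>i\<in>A. 1 / L i)" by (rule sum_mono)
  moreover have "(\<Sum>i\<in>A. 2 * t - t\<^sup>2 * L i) = real (card A) * (2 * t) - t\<^sup>2 * S"
    by (simp add: sum_subtractf S_def sum_distrib_left)
  moreover have "real (card A) * (2 * t) - t\<^sup>2 * S = (real (card A))\<^sup>2 / S"
    using S by (simp add: t_def power2_eq_square field_simps)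
  ultimately show ?thesis by (simp add: S_def)
qed

text \<open>
  Over the first \<open>v\<close> steps the slope accumulates at least \<open>2 * g / L\<close> per step, hence \<open>2 * v\<^sup>2 / \<Sum> L\<close>
  relative to the initial value; over the next \<open>v\<close> steps this slope is integrated.
\<close>

lemma growth_block:
  assumes L: "\<And>i. 0 < L i" and v: "v \<ge> 1"
  shows "growth L a * (1 + 2 * real v ^ 3 / (\<Sum>i\<in>{a<..a + v}. L i)) \<le> growth L (a + 2 * v)"
proof -
  define S where "S = (\<Sum>i\<in>{a<..a + v}. L i)"
  have ga: "1 \<le> growth L a" using growth_mono_pos[of L, OF L] by blast
  define d where "d = growth L (Suc (a + v)) - growth L (a + v)"
  have d: "growth L a * (2 * (real v)\<^sup>2 / S) \<le> d"
  proof -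
    have "(real v)\<^sup>2 / S \<le> (\<Sum>i\<in>{a<..a + v}. 1 / L i)"
      using sum_inverse_ge[of "{a<..a + v}" L] L v by (simp add: S_def)
    then have "2 * growth L a * ((real v)\<^sup>2 / S) \<le> 2 * growth L a * (\<Sum>i\<in>{a<..a + v}. 1 / L i)"
      using ga by (intro mult_left_mono) auto
    also have "\<dots> = (\<Sum>i\<in>{a<..a + v}. 2 * growth L a / L i)" by (simp add: sum_distrib_left)
    also have "\<dots> \<le> (\<Sum>i\<in>{a<..a + v}. 2 * growth L i / L i)"
      using L growth_le[of L, OF L] by (intro sum_mono divide_right_mono mult_left_mono) (auto intro: less_imp_le)
    also have "\<dots> \<le> d"
      using growth_mono_pos[of L _, OF L, of a] by (simp add: d_def growth_slope_sum)
    finally show ?thesis by (simp add: mult_ac)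
  qed
  have slope: "d \<le> growth L (Suc i) - growth L i" if "a + v \<le> i" for i
  proof -
    obtain j where i: "i = (a + v) + j" using \<open>a + v \<le> i\<close> le_Suc_ex by blast
    have "0 \<le> 2 * growth L k / L k" for k using growth_mono_pos[of L _, OF L, of k] L[of k] by simp
    then have "0 \<le> (\<Sum>k\<in>{a + v<..a + v + j}. 2 * growth L k / L k)" by (intro sum_nonneg)
    then show ?thesis unfolding i d_def using growth_slope_sum[of L "a + v" j] by linarith
  qed
  have "growth L (a + v) + real j * d \<le> growth L (a + v + j)" for j
  proof (induction j)
    case (Suc j)
    then show ?case using slope[of "a + v + j"] by (simp add: algebra_simps)
  qed simp
  from this[of v] have "growth L (a + v) + real v * d \<le> growth L (a + 2 * v)" by (simp add: mult_2 add.assoc)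
  moreover have "growth L a \<le> growth L (a + v)" by (rule growth_le[of L, OF L]) simp
  moreover have "real v * (growth L a * (2 * (real v)\<^sup>2 / S)) \<le> real v * d" using d by (intro mult_left_mono) auto
  moreover have "growth L a * (1 + 2 * real v ^ 3 / S) =
      growth L a + real v * (growth L a * (2 * (real v)\<^sup>2 / S))"
    by (simp add: algebra_simps power2_eq_square power3_eq_cube)
  ultimately have "growth L a * (1 + 2 * real v ^ 3 / S) \<le> growth L (a + 2 * v)" by linarith
  then show ?thesis unfolding S_def .
qed

text \<open>
  Each of the \<open>k\<close> blocks multiplies by \<open>1 + z \<ge> exp (1 - 1 / z)\<close>, so a block is useful unless its lengths
  \<open>L i\<close> add up to \<open>2 * v ^ 3\<close>. The exponent is linear in the total length, so only the
  number of sites matters and not their distribution over the teeth.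
\<close>

lemma growth_ge_exp:
  assumes L: "\<And>i. 0 < L i" and v: "v \<ge> 1"
  shows "exp (real k - (\<Sum>i\<in>{0<..<2 * v * k}. L i) / (2 * real v ^ 3)) \<le> growth L (2 * v * k)"
proof (induction k)
  case 0
  have "{0<..<2 * v * 0} = {}" by auto
  then have "(\<Sum>i\<in>{0<..<2 * v * 0}. L i) = 0" by (simp only: sum.empty)
  then show ?case by simp
next
  case (Suc k)
  let ?a = "2 * v * k"
  define S where "S = (\<Sum>i\<in>{?a<..?a + v}. L i)"
  have S: "0 < S" unfolding S_def using L v by (intro sum_pos) auto
  define z where "z = 2 * real v ^ 3 / S"
  have z: "0 < z" using S v by (simp add: z_def)
  have "1 - 1 / z \<le> ln (1 + z)"
  proof -
    have "1 - 1 / z \<le> z / (1 + z)" using z by (simp add: field_simps)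
    also have "\<dots> \<le> ln (1 + z)" using ln_add_one_self_le_self2[of "- z / (1 + z)"] z
        ln_inverse[of "1 + z"] by (simp add: field_simps ln_div)
    finally show ?thesis .
  qed
  then have ez: "exp (1 - S / (2 * real v ^ 3)) \<le> 1 + z" using z
    by (simp add: z_def ln_ge_iff)
  have sub: "(\<Sum>i\<in>{0<..<?a}. L i) + S \<le> (\<Sum>i\<in>{0<..<2 * v * Suc k}. L i)"
  proof -
    have "(\<Sum>i\<in>{0<..<?a}. L i) + S = (\<Sum>i\<in>{0<..<?a} \<union> {?a<..?a + v}. L i)"
      unfolding S_def by (intro sum.union_disjoint[symmetric]) auto
    also have "\<dots> \<le> (\<Sum>i\<in>{0<..<2 * v * Suc k}. L i)"
      using v L by (intro sum_mono2) (auto intro: less_imp_le)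
    finally show ?thesis .
  qed
  have "exp (real (Suc k) - (\<Sum>i\<in>{0<..<2 * v * Suc k}. L i) / (2 * real v ^ 3)) \<le>
      exp ((real k - (\<Sum>i\<in>{0<..<?a}. L i) / (2 * real v ^ 3)) + (1 - S / (2 * real v ^ 3)))"
  proof -
    have "((\<Sum>i\<in>{0<..<?a}. L i) + S) / (2 * real v ^ 3) \<le> (\<Sum>i\<in>{0<..<2 * v * Suc k}. L i) / (2 * real v ^ 3)"
      using sub by (intro divide_right_mono) auto
    then show ?thesis by (simp add: add_divide_distrib)
  qed
  also have "\<dots> \<le> growth L ?a * (1 + z)"
  proof -
    have "0 \<le> growth L ?a" using growth_mono_pos[of L ?a, OF L] by linarith
    then show ?thesis unfolding exp_add using Suc ez by (intro mult_mono) auto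
  qed
  also have "\<dots> \<le> growth L (?a + 2 * v)"
    using growth_block[of L v, OF L v, of ?a] by (simp add: z_def S_def)
  finally show ?case by (simp add: algebra_simps)
qed

text \<open>
  A subtree that contains a site contains the segment of the tooth below it.
\<close>

lemma star_closed_tooth_count:
  assumes A: "star_closed A" "finite A" and v: "(x, y) \<in> A"
  shows "\<bar>y\<bar> + 1 \<le> int (tooth_count \<sigma> A (\<sigma> * x))"
proof -
  let ?f = "\<lambda>j. (x, if y \<ge> 0 then j else - j :: int)"
  have "?f ` {0..\<bar>y\<bar>} \<subseteq> {w \<in> A. \<sigma> * fst w = \<sigma> * x}"
    using star_closed_segment[OF A(1) v] by auto
  then have "card (?f ` {0..\<bar>y\<bar>}) \<le> tooth_count \<sigma> A (\<sigma> * x)"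
    unfolding tooth_count_def using A(2) by (intro card_mono) auto
  moreover have "card (?f ` {0..\<bar>y\<bar>}) = card {0..\<bar>y\<bar>}"
    by (rule card_image) (auto simp: inj_on_def split: if_splits)
  ultimately show ?thesis by simp
qed

text \<open>
  Constant up to \<open>X\<close>, where it equals \<open>1\<close>, and constant beyond \<open>X + w\<close>, where it is exponentially large.
  In between it vanishes at the ends of the teeth. Thus by optional stopping an explorer gets
  past \<open>X + w\<close> with probability at most \<open>1 / growth L w\<close>.
\<close>

definition halving_potential :: "(nat \<Rightarrow> real) \<Rightarrow> int \<Rightarrow> nat \<Rightarrow> int \<times> int \<Rightarrow> real" where
  "halving_potential L X w = (\<lambda>(x, y).
     if x \<le> X then 1 else if X + int w \<le> x then growth L w
     else growth L (nat (x - X)) * max 0 (1 - \<bar>real_of_int y\<bar> / L (nat (x - X))))"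

text \<open>
  Constant pieces and linear teeth are harmonic, and the recursion of \<open>growth\<close> is harmonicity at the root of a
  tooth. At \<open>X + w\<close> the function stops increasing, which is superharmonic. At \<open>X\<close> the first step
  is flat because \<open>growth L 1 = growth L 0\<close>. Since the cluster's tooth is shorter than
  \<open>L\<close>, the truncation by \<open>max\<close> is not felt inside the cluster.
\<close>

lemma halving_potential_superharmonic:
  assumes L: "\<And>i. 1 \<le> L i" and w: "w \<ge> 1"
    and y: "X < x \<Longrightarrow> x < X + int w \<Longrightarrow> \<bar>real_of_int y\<bar> + 1 \<le> L (nat (x - X))"
  shows "nbr_mean (halving_potential L X w) (x, y) \<le> halving_potential L X w (x, y)"
proof -
  let ?G = "halving_potential L X w"
  have L0: "\<And>i. 0 < L i" by (rule less_le_trans[OF zero_less_one L])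
  have "(x < X \<or> x = X \<and> y \<noteq> 0) \<or> (x = X \<and> y = 0) \<or> (X < x \<and> x < X + int w \<and> y \<noteq> 0) \<or>
      (X < x \<and> x < X + int w \<and> y = 0) \<or> (x = X + int w \<and> y = 0) \<or>
      (X + int w < x \<or> x = X + int w \<and> y \<noteq> 0)"
    by (cases "y = 0"; cases "x < X"; cases "x = X"; cases "x < X + int w"; cases "x = X + int w") auto
  then consider "x < X \<or> x = X \<and> y \<noteq> 0" | "x = X" "y = 0" | "X < x" "x < X + int w" "y \<noteq> 0"
    | "X < x" "x < X + int w" "y = 0" | "x = X + int w" "y = 0" | "X + int w < x \<or> x = X + int w \<and> y \<noteq> 0"
    by blast
  then show ?thesis
  proof cases
    case 1
    then show ?thesis
      by (cases "y = 0") (auto simp: nbr_mean_backbone nbr_mean_tooth halving_potential_def)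
  next
    case 2
    have "?G (x + 1, 0) = 1" using 2 w by (auto simp: halving_potential_def)
    then show ?thesis using 2 w by (simp add: nbr_mean_backbone) (simp add: halving_potential_def)
  next
    case 3
    define l where "l = L (nat (x - X))"
    define g where "g = growth L (nat (x - X))"
    have l: "0 < l" "\<bar>real_of_int y\<bar> + 1 \<le> l" using y 3 L0 by (auto simp: l_def)
    have G: "?G (x, y') = g * (1 - \<bar>real_of_int y'\<bar> / l)" if "\<bar>real_of_int y'\<bar> \<le> l" for y'
      using 3 l that by (simp add: halving_potential_def l_def g_def max_def)
    have b: "\<bar>real_of_int (y + 1)\<bar> \<le> l" "\<bar>real_of_int (y - 1)\<bar> \<le> l" "\<bar>real_of_int y\<bar> \<le> l" using l by auto
    have s: "\<bar>real_of_int (y + 1)\<bar> + \<bar>real_of_int (y - 1)\<bar> = 2 * \<bar>real_of_int y\<bar>" using 3(3) by linarith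
    have "?G (x, y + 1) + ?G (x, y - 1) = g * (2 - (\<bar>real_of_int (y + 1)\<bar> + \<bar>real_of_int (y - 1)\<bar>) / l)"
      unfolding G[OF b(1)] G[OF b(2)] by (simp add: algebra_simps add_divide_distrib)
    also have "\<dots> = 2 * ?G (x, y)" unfolding s G[OF b(3)] by (simp add: algebra_simps)
    finally show ?thesis using 3 by (simp add: nbr_mean_tooth)
  next
    case 4
    define i where "i = nat (x - X) - 1"
    have i: "nat (x - X) = Suc i" "nat (x + 1 - X) = Suc (Suc i)" using 4 by (auto simp: i_def)
    define l where "l = L (Suc i)"
    have l: "1 \<le> l" using L by (simp add: l_def)
    have up: "?G (x + 1, 0) = growth L (Suc (Suc i))"
    proof (cases "X + int w \<le> x + 1")
      case True
      then have "w = Suc (Suc i)" using 4 i by linarith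
      then show ?thesis using 4 True by (simp add: halving_potential_def)
    qed (use 4 i in \<open>simp add: halving_potential_def\<close>)
    have down: "?G (x - 1, 0) = growth L i"
    proof (cases "x - 1 \<le> X")
      case True
      then have "i = 0" using 4 by (simp add: i_def)
      then show ?thesis using True by (simp add: halving_potential_def)
    next
      case False
      then have "nat (x - 1 - X) = i" using 4 by (simp add: i_def)
      then show ?thesis using 4 False by (simp add: halving_potential_def)
    qed
    have side: "?G (x, 1) = growth L (Suc i) * (1 - 1 / l)" "?G (x, -1) = growth L (Suc i) * (1 - 1 / l)"
      using 4 i l by (auto simp: halving_potential_def l_def max_def)
    have mid: "?G (x, 0) = growth L (Suc i)" using 4 i by (simp add: halving_potential_def)
    have "nbr_mean ?G (x, 0) = (growth L (Suc (Suc i)) + growth L i + 2 * (growth L (Suc i) * (1 - 1 / l))) / 4"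
      by (simp add: nbr_mean_backbone up down side)
    also have "\<dots> = growth L (Suc i)" by (simp add: l_def algebra_simps)
    finally show ?thesis using 4 mid by simp
  next
    case 5
    have "?G (x - 1, 0) \<le> growth L w"
    proof (cases "x - 1 \<le> X")
      case True
      then show ?thesis using growth_mono_pos[of L, OF L0, of w] by (simp add: halving_potential_def)
    next
      case False
      then have "?G (x - 1, 0) = growth L (w - 1)" using 5 w
        by (simp add: halving_potential_def nat_diff_distrib)
      also have "\<dots> \<le> growth L w" by (rule growth_le[of L, OF L0]) simp
      finally show ?thesis .
    qed
    then show ?thesis using 5 w by (simp add: nbr_mean_backbone) (simp add: halving_potential_def)
  next
    case 6
    then show ?thesis using w
      by (cases "y = 0") (auto simp: nbr_mean_backbone nbr_mean_tooth halving_potential_def)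
  qed
qed

lemma halving_potential_nonneg:
  assumes "\<And>i. 1 \<le> L i"
  shows "0 \<le> halving_potential L X w v"
proof -
  have "\<And>i. 0 < L i" by (rule less_le_trans[OF zero_less_one assms])
  then have "1 \<le> growth L i" for i using growth_mono_pos[of L i] by simp
  then have "0 \<le> growth L i" for i using order_trans[OF zero_le_one] by blast
  then show ?thesis by (cases v) (auto simp: halving_potential_def)
qed

lemma sum_tooth_count_le:
  assumes "finite A"
  shows "(\<Sum>i\<in>{0<..<w}. tooth_count \<sigma> A (X + int i)) \<le> count_right \<sigma> X A"
proof -
  have "(\<Sum>i\<in>{0<..<w}. tooth_count \<sigma> A (X + int i)) = card (\<Union>i\<in>{0<..<w}. {v \<in> A. \<sigma> * fst v = X + int i})"
    unfolding tooth_count_def using assms by (intro card_UN_disjoint[symmetric]) auto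
  also have "\<dots> \<le> count_right \<sigma> X A"
    unfolding count_right_def using assms by (intro card_mono) auto
  finally show ?thesis .
qed

lemma count_right_mono: "finite B \<Longrightarrow> A \<subseteq> B \<Longrightarrow> count_right \<sigma> X A \<le> count_right \<sigma> X B"
  unfolding count_right_def by (intro card_mono) auto

text \<open>
  The product of \<open>(1 + G) / 2\<close>, with \<open>G\<close> built from the tooth lengths of the current cluster. An explorer
  settling beyond \<open>X\<close> contributes a factor \<open>1 / 2 \<ge> exp (-1)\<close> at least, one settling beyond
  \<open>X + w\<close> even \<open>exp (k / 2 - 1)\<close>, and all others exactly \<open>1\<close>. If there were at most \<open>N\<close>
  of the former but more than \<open>N / 8\<close> of the latter, the product would be at least
  \<open>exp (N * (k / 16 - 1))\<close>.
\<close>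

lemma halving_step:
  fixes \<sigma> X :: int and N s :: real and v k K :: nat
  assumes sgn: "\<bar>\<sigma>\<bar> = 1" and X: "0 \<le> X" and v: "1 \<le> v" and k: "1 \<le> k" and N: "0 < N"
    and w: "real (2 * v * k) \<le> 2 * N" and vk: "3 * N \<le> real v ^ 3 * real k"
    and ks: "16 + 64 * s\<^sup>2 / N \<le> real k"
  shows "fails_within (exp (- (4 * s\<^sup>2))) (\<lambda>\<omega>. real (count_right \<sigma> X (idla \<omega> K)) \<le> N \<longrightarrow>
    real (count_right \<sigma> (X + int (2 * v * k)) (idla \<omega> K)) \<le> N / 8)"
proof -
  define w where "w = 2 * v * k"
  have w1: "1 \<le> w" using v k by (simp add: w_def)
  define L where "L = (\<lambda>A i. real (tooth_count \<sigma> A (X + int i)) + 1)"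
  define G where "G = (\<lambda>A v. halving_potential (L A) X w (reflect \<sigma> 1 v))"
  \<comment> \<open>On clusters that are not good the factor is \<open>1\<close>, so that the product lemma applies to all clusters.\<close>
  define good where "good = (\<lambda>A. star_closed A \<and> real (count_right \<sigma> X A) \<le> N)"
  define \<Psi> where "\<Psi> = (\<lambda>A v. if good A then (1 + G A v) / 2 else 1)"
  have L1: "1 \<le> L A i" for A i by (simp add: L_def)
  have L0: "0 < L A i" for A i using L1[of A i] by linarith
  have sg: "\<bar>\<sigma>\<bar> = 1" "\<bar>1 :: int\<bar> = 1" using sgn by auto
  have G0: "0 \<le> G A v" for A v unfolding G_def by (rule halving_potential_nonneg[OF L1])
  have card_nz: "card (comb_nbrs u) \<noteq> 0" for u using finite_comb_nbrs comb_nbrs_nonempty by simp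
  have super: "nbr_mean (\<Psi> A) u \<le> \<Psi> A u" if A: "finite A" "u \<in> A" for A u
  proof (cases "good A")
    case False
    then show ?thesis using card_nz by (simp add: \<Psi>_def nbr_mean_def)
  next
    case True
    obtain x y where u: "u = (x, y)" by force
    have "nbr_mean (G A) u = nbr_mean (halving_potential (L A) X w) (\<sigma> * x, y)"
      unfolding G_def using nbr_mean_reflect[OF sg, of "halving_potential (L A) X w" u] by (simp add: u reflect_def)
    also have "\<dots> \<le> halving_potential (L A) X w (\<sigma> * x, y)"
    proof (rule halving_potential_superharmonic[OF L1 w1])
      assume "X < \<sigma> * x"
      then have "X + int (nat (\<sigma> * x - X)) = \<sigma> * x" by simp
      moreover have "\<bar>y\<bar> + 1 \<le> int (tooth_count \<sigma> A (\<sigma> * x))"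
        using star_closed_tooth_count[OF _ A(1)] True A(2) by (simp add: good_def u)
      ultimately show "\<bar>real_of_int y\<bar> + 1 \<le> L A (nat (\<sigma> * x - X))" unfolding L_def by simp
    qed
    also have "\<dots> = G A u" by (simp add: G_def u reflect_def)
    finally have "nbr_mean (G A) u \<le> G A u" .
    moreover have "nbr_mean (\<Psi> A) u = (1 + nbr_mean (G A) u) / 2"
      unfolding nbr_mean_def \<Psi>_def using True card_nz[of u]
      by (simp add: sum.distrib add_divide_distrib sum_divide_distrib[symmetric])
    ultimately show ?thesis using True by (simp add: \<Psi>_def)
  qed
  have start: "\<Psi> A (0, 0) \<le> 1" for A using X by (simp add: \<Psi>_def G_def reflect_def halving_potential_def)
  let ?E = "{\<omega>. ennreal (exp (4 * s\<^sup>2)) \<le> explorer_product UNIV (\<lambda>A. A) \<Psi> K \<omega>}"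
  have E: "?E \<in> sets explorers_law" "measure explorers_law ?E \<le> 1 / exp (4 * s\<^sup>2)"
    using explorer_product_markov[of "\<lambda>A. A" \<Psi> "exp (4 * s\<^sup>2)" UNIV K] super start G0
    by (auto simp: \<Psi>_def)
  have main: "real (count_right \<sigma> (X + int w) (idla \<omega> K)) \<le> N / 8"
    if proper: "\<forall>k. proper_path (\<omega> k)" and nE: "\<omega> \<notin> ?E" and few: "real (count_right \<sigma> X (idla \<omega> K)) \<le> N" for \<omega>
  proof (rule ccontr)
    assume many: "\<not> real (count_right \<sigma> (X + int w) (idla \<omega> K)) \<le> N / 8"
    let ?A = "frozen_idla UNIV \<omega>"
    define Y where "Y = (\<lambda>j. first_outside (?A j) (\<omega> j))"
    have img: "?A K = Y ` {..<K}" unfolding Y_def using frozen_idla_image[of UNIV \<omega> K] by simp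
    have inj: "inj_on Y {..<K}"
    proof -
      have "Y i \<noteq> Y j" if "i < j" for i j
      proof -
        have "Y i \<in> ?A (Suc i)" by (simp add: Y_def)
        then have "Y i \<in> ?A j" using frozen_idla_mono[of "Suc i" j UNIV \<omega>] that by auto
        moreover have "Y j \<notin> ?A j" unfolding Y_def using first_outside_cases(1)[of "\<omega> j" "?A j"] proper by simp
        ultimately show ?thesis by auto
      qed
      then show ?thesis by (auto intro!: linorder_inj_onI)
    qed
    have good: "good (?A j)" if "j < K" for j
    proof -
      have "count_right \<sigma> X (?A j) \<le> count_right \<sigma> X (?A K)"
        using that by (intro count_right_mono frozen_idla_mono) auto
      moreover have "star_closed (?A j)"
        by (rule star_closed_frozen_idla) (use proper in auto)
      ultimately show ?thesis using few by (simp add: good_def idla_eq_frozen)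
    qed
    \<comment> \<open>The exponent contributed by a site of the final cluster.\<close>
    define f where "f = (\<lambda>v :: int \<times> int. (if X < \<sigma> * fst v then -1 else 0) + (if X + int w < \<sigma> * fst v then real k / 2 else 0))"
    have factor: "exp (f (Y j)) \<le> \<Psi> (?A j) (Y j)" if j: "j < K" for j
    proof -
      obtain x y where xy: "reflect \<sigma> 1 (Y j) = (x, y)" by force
      then have x: "\<sigma> * fst (Y j) = x" by (simp add: reflect_def)
      have \<Psi>: "\<Psi> (?A j) (Y j) = (1 + halving_potential (L (?A j)) X w (x, y)) / 2"
        using good[OF j] by (simp add: \<Psi>_def G_def xy)
      have half: "exp (-1 :: real) \<le> 1 / 2" using exp_ge_add_one_self[of 1] by (simp add: exp_minus field_simps)
      consider "x \<le> X" | "X < x" "x \<le> X + int w" | "X + int w < x" by linarith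
      then show ?thesis
      proof cases
        case 1
        then show ?thesis unfolding \<Psi> by (simp add: f_def x halving_potential_def)
      next
        case 2
        have "0 \<le> halving_potential (L (?A j)) X w (x, y)" by (rule halving_potential_nonneg[OF L1])
        then show ?thesis unfolding \<Psi> using 2 half by (simp add: f_def x)
      next
        case 3
        have "(\<Sum>i\<in>{0<..<w}. L (?A j) i) \<le> N + real w"
        proof -
          have "(\<Sum>i\<in>{0<..<w}. L (?A j) i) = real (\<Sum>i\<in>{0<..<w}. tooth_count \<sigma> (?A j) (X + int i)) + real (card {0<..<w})"
            by (simp add: L_def sum.distrib)
          also have "real (\<Sum>i\<in>{0<..<w}. tooth_count \<sigma> (?A j) (X + int i)) \<le> real (count_right \<sigma> X (?A j))"
            by (simp only: of_nat_le_iff sum_tooth_count_le finite_frozen_idla)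
          also have "real (count_right \<sigma> X (?A j)) \<le> N" using good[OF j] by (simp add: good_def)
          also have "N + real (card {0<..<w}) \<le> N + real w" by simp
          finally show ?thesis by simp
        qed
        also have "\<dots> \<le> 3 * N" using w by (simp add: w_def)
        also have "\<dots> \<le> real v ^ 3 * real k" by (rule vk)
        finally have "(\<Sum>i\<in>{0<..<w}. L (?A j) i) / (2 * real v ^ 3) \<le> real k / 2"
          using v by (simp add: field_simps)
        then have "exp (real k / 2) \<le> exp (real k - (\<Sum>i\<in>{0<..<w}. L (?A j) i) / (2 * real v ^ 3))" by simp
        also have "\<dots> \<le> growth (L (?A j)) w"
          unfolding w_def by (rule growth_ge_exp[of "L (?A j)", OF L0 v])
        finally have g: "exp (real k / 2) \<le> growth (L (?A j)) w" .
        have "exp (f (Y j)) = exp (-1) * exp (real k / 2)" using 3 by (simp add: f_def x exp_add[symmetric])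
        also have "\<dots> \<le> 1 / 2 * growth (L (?A j)) w" using half g by (intro mult_mono) auto
        also have "\<dots> \<le> \<Psi> (?A j) (Y j)" unfolding \<Psi> using 3 by (simp add: halving_potential_def)
        finally show ?thesis .
      qed
    qed
    have "ennreal (exp (\<Sum>j<K. f (Y j))) \<le> explorer_product UNIV (\<lambda>A. A) \<Psi> K \<omega>"
      by (rule explorer_product_ge_exp) (use factor in \<open>simp add: Y_def\<close>)
    moreover have "4 * s\<^sup>2 \<le> (\<Sum>j<K. f (Y j))"
    proof -
      have "(\<Sum>j<K. f (Y j)) = (\<Sum>v\<in>?A K. f v)" unfolding img by (simp add: sum.reindex[OF inj] comp_def)
      also have "\<dots> = - real (count_right \<sigma> X (?A K)) + real k / 2 * real (count_right \<sigma> (X + int w) (?A K))"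
        unfolding f_def sum.distrib count_right_def
        by (simp add: sum.inter_filter[symmetric])
      also have "\<dots> \<ge> - N + real k / 2 * (N / 8)"
        using few many by (intro add_mono mult_left_mono) (auto simp: idla_eq_frozen)
      also have "- N + real k / 2 * (N / 8) = N * (real k / 16 - 1)" by (simp add: algebra_simps)
      also have "\<dots> \<ge> N * (4 * s\<^sup>2 / N)" using ks N by (intro mult_left_mono) (auto simp: field_simps)
      also have "N * (4 * s\<^sup>2 / N) = 4 * s\<^sup>2" using N by simp
      finally show ?thesis .
    qed
    ultimately have "ennreal (exp (4 * s\<^sup>2)) \<le> explorer_product UNIV (\<lambda>A. A) \<Psi> K \<omega>"
      by (meson ennreal_leI exp_le_cancel_iff order_trans)
    then show False using nE by simp
  qed
  show ?thesis unfolding fails_within_def using E main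
    by (intro bexI[of _ ?E]) (auto simp: exp_minus inverse_eq_divide w_def)
qed

text \<open>
  With \<open>N = y ^ 3\<close> a step costs width \<open>O(y)\<close> as long as \<open>y \<ge> t = s powr (2 / 3)\<close>. Below that, more
  blocks are needed to reach probability \<open>exp (- (4 * s\<^sup>2))\<close>, the blocks may be shorter, and the width is
  \<open>O(t\<^sup>2 / y)\<close>.
\<close>

lemma halving_cube:
  fixes \<sigma> X :: int and y t s :: real and K :: nat
  assumes sgn: "\<bar>\<sigma>\<bar> = 1" and X: "0 \<le> X" and t: "0 < t" "t ^ 3 = s\<^sup>2" and y: "18 \<le> y" "18 * t \<le> y\<^sup>2"
  shows "\<exists>w. real w \<le> 324 * (y + t\<^sup>2 / y) \<and>
    fails_within (exp (- (4 * s\<^sup>2))) (\<lambda>\<omega>. real (count_right \<sigma> X (idla \<omega> K)) \<le> y ^ 3 \<longrightarrow>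
      real (count_right \<sigma> (X + int w) (idla \<omega> K)) \<le> (y / 2) ^ 3)"
proof -
  \<comment> \<open>The number of blocks is proportional to \<open>M\<close>, their length to \<open>z\<close>, and \<open>z ^ 3 * M = y ^ 3\<close>.\<close>
  define M where "M = max 1 ((t / y) ^ 3)"
  define z where "z = y * min 1 (y / t)"
  define k where "k = nat \<lceil>80 * M\<rceil>"
  define v where "v = nat \<lceil>z\<rceil>"
  have M: "1 \<le> M" "(t / y) ^ 3 \<le> M" by (auto simp: M_def)
  have z1: "1 \<le> z"
  proof (cases "y \<le> t")
    case True
    then have "z = y\<^sup>2 / t" using t by (simp add: z_def min_def power2_eq_square)
    then show ?thesis using y t by (simp add: le_divide_eq)
  next
    case False
    then show ?thesis using t y by (simp add: z_def min_def)
  qed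
  have kb: "80 * M \<le> real k" "real k \<le> 81 * M" using M unfolding k_def by linarith+
  have vb: "z \<le> real v" "real v \<le> 2 * z" using z1 unfolding v_def by linarith+
  have zM: "z * M \<le> y + t\<^sup>2 / y" "z ^ 3 * M = y ^ 3"
  proof -
    have "z * M \<le> y + t\<^sup>2 / y \<and> z ^ 3 * M = y ^ 3"
    proof (cases "y \<le> t")
      case True
      have "(t / y) ^ 3 \<ge> 1" using True y by (intro one_le_power) auto
      then have "M = (t / y) ^ 3" by (simp add: M_def)
      moreover have "z = y * (y / t)" using True t by (simp add: z_def min_def)
      moreover have "y * (y / t) * (t / y) ^ 3 = t\<^sup>2 / y" "(y * (y / t)) ^ 3 * (t / y) ^ 3 = y ^ 3"
        using y(1) t(1) by (simp_all add: power2_eq_square power3_eq_cube)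
      ultimately have "z * M = t\<^sup>2 / y" "z ^ 3 * M = y ^ 3" by simp_all
      then show ?thesis using y by simp
    next
      case False
      have "(t / y) ^ 3 \<le> 1" using False t y by (intro power_le_one) auto
      then have "M = 1" by (simp add: M_def)
      moreover have "z = y" using False t y by (simp add: z_def min_def)
      ultimately show ?thesis using y by simp
    qed
    then show "z * M \<le> y + t\<^sup>2 / y" "z ^ 3 * M = y ^ 3" by auto
  qed
  have wle: "real (2 * v * k) \<le> 324 * (y + t\<^sup>2 / y)"
  proof -
    have "real (2 * v * k) = 2 * (real v * real k)" by simp
    also have "\<dots> \<le> 2 * ((2 * z) * (81 * M))" using kb vb z1 M by (intro mult_left_mono mult_mono) auto
    also have "\<dots> = 324 * (z * M)" by simp
    also have "\<dots> \<le> 324 * (y + t\<^sup>2 / y)" using zM by (intro mult_left_mono) auto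
    finally show ?thesis .
  qed
  have y2: "324 \<le> y\<^sup>2" using y power_mono[of 18 y 2] by simp
  have "324 * y \<le> y ^ 3" using mult_right_mono[OF y2, of y] y by (simp add: power2_eq_square power3_eq_cube)
  moreover have "324 * (t\<^sup>2 / y) \<le> y ^ 3"
  proof -
    have "(18 * t)\<^sup>2 \<le> (y\<^sup>2)\<^sup>2" using y t by (intro power_mono) auto
    then have "324 * t\<^sup>2 \<le> y ^ 3 * y" by (simp add: power_mult_distrib power2_eq_square power3_eq_cube mult.assoc)
    then show ?thesis using y by (simp add: field_simps)
  qed
  ultimately have w2: "real (2 * v * k) \<le> 2 * y ^ 3" using wle by (simp add: distrib_left)
  have ts: "64 * s\<^sup>2 / y ^ 3 = 64 * (t / y) ^ 3" using t by (simp add: power_divide)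
  have "fails_within (exp (- (4 * s\<^sup>2))) (\<lambda>\<omega>. real (count_right \<sigma> X (idla \<omega> K)) \<le> y ^ 3 \<longrightarrow>
      real (count_right \<sigma> (X + int (2 * v * k)) (idla \<omega> K)) \<le> y ^ 3 / 8)"
  proof (rule halving_step[OF sgn X _ _ _ w2])
    show "1 \<le> v" "1 \<le> k" using vb z1 kb M by linarith+
    have "3 * y ^ 3 \<le> 80 * (z ^ 3 * M)" using y by (simp add: zM)
    also have "\<dots> = z ^ 3 * (80 * M)" by simp
    also have "\<dots> \<le> real v ^ 3 * real k" using vb kb z1 M by (intro mult_mono power_mono) auto
    finally show "3 * y ^ 3 \<le> real v ^ 3 * real k" .
    show "16 + 64 * s\<^sup>2 / y ^ 3 \<le> real k" unfolding ts using M kb by linarith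
  qed (use y in auto)
  then show ?thesis using wle by (intro exI[of _ "2 * v * k"]) (simp add: power_divide)
qed

lemma halving_iterate:
  fixes \<sigma> X :: int and y t s :: real and K J :: nat
  assumes sgn: "\<bar>\<sigma>\<bar> = 1" and X: "0 \<le> X" and t: "0 < t" "t ^ 3 = s\<^sup>2"
    and y: "\<And>j. j < J \<Longrightarrow> 18 \<le> y / 2 ^ j \<and> 18 * t \<le> (y / 2 ^ j)\<^sup>2"
  shows "\<exists>W. real W \<le> 324 * (\<Sum>j<J. y / 2 ^ j + t\<^sup>2 * 2 ^ j / y) \<and>
    fails_within (real J * exp (- (4 * s\<^sup>2))) (\<lambda>\<omega>. real (count_right \<sigma> X (idla \<omega> K)) \<le> y ^ 3 \<longrightarrow>
      real (count_right \<sigma> (X + int W) (idla \<omega> K)) \<le> (y / 2 ^ J) ^ 3)"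
  using X y
proof (induction J arbitrary: X y)
  case 0
  have "fails_within 0 (\<lambda>\<omega>. True)" unfolding fails_within_def by (intro bexI[of _ "{}"]) auto
  then show ?case by (intro exI[of _ 0]) (auto elim: fails_within_weaken)
next
  case (Suc J)
  have y0: "18 \<le> y" "18 * t \<le> y\<^sup>2" using Suc.prems(2)[of 0] by auto
  obtain w where w: "real w \<le> 324 * (y + t\<^sup>2 / y)"
    "fails_within (exp (- (4 * s\<^sup>2))) (\<lambda>\<omega>. real (count_right \<sigma> X (idla \<omega> K)) \<le> y ^ 3 \<longrightarrow>
      real (count_right \<sigma> (X + int w) (idla \<omega> K)) \<le> (y / 2) ^ 3)"
    using halving_cube[OF sgn Suc.prems(1) t y0] by blast
  have "18 \<le> (y / 2) / 2 ^ j \<and> 18 * t \<le> ((y / 2) / 2 ^ j)\<^sup>2" if "j < J" for j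
    using Suc.prems(2)[of "Suc j"] that by simp
  then obtain W where W: "real W \<le> 324 * (\<Sum>j<J. (y / 2) / 2 ^ j + t\<^sup>2 * 2 ^ j / (y / 2))"
    "fails_within (real J * exp (- (4 * s\<^sup>2))) (\<lambda>\<omega>. real (count_right \<sigma> (X + int w) (idla \<omega> K)) \<le> (y / 2) ^ 3 \<longrightarrow>
      real (count_right \<sigma> (X + int w + int W) (idla \<omega> K)) \<le> ((y / 2) / 2 ^ J) ^ 3)"
    using Suc.IH[of "X + int w" "y / 2"] Suc.prems(1) by auto
  have "(\<Sum>j<Suc J. y / 2 ^ j + t\<^sup>2 * 2 ^ j / y) = (y + t\<^sup>2 / y) + (\<Sum>j<J. (y / 2) / 2 ^ j + t\<^sup>2 * 2 ^ j / (y / 2))"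
    by (subst sum.lessThan_Suc_shift) (simp add: mult_ac)
  then have "real (w + W) \<le> 324 * (\<Sum>j<Suc J. y / 2 ^ j + t\<^sup>2 * 2 ^ j / y)" using w(1) W(1) by (simp add: distrib_left)
  moreover have "fails_within (real (Suc J) * exp (- (4 * s\<^sup>2))) (\<lambda>\<omega>. real (count_right \<sigma> X (idla \<omega> K)) \<le> y ^ 3 \<longrightarrow>
      real (count_right \<sigma> (X + int (w + W)) (idla \<omega> K)) \<le> (y / 2 ^ Suc J) ^ 3)"
    using fails_within_conj[OF w(2) W(2)]
    by (elim fails_within_mono) (auto simp: algebra_simps)
  ultimately show ?case by blast
qed

text \<open>
  The widths of successive steps form two geometric series, one decreasing from \<open>y\<close> and one increasing up to
  \<open>O(s)\<close>, when \<open>y ^ 3 = O(s)\<close> and the iteration stops. The constant is \<open>5832 = 18 ^ 3\<close>.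
\<close>

lemma few_sites_far_right:
  fixes \<sigma> X :: int and y s :: real and K :: nat
  assumes sgn: "\<bar>\<sigma>\<bar> = 1" and X: "0 \<le> X" and s: "1 \<le> s" and y: "1 \<le> y"
  shows "\<exists>W. real W \<le> 648 * (y + s) \<and>
    fails_within ((y + 2) * exp (- (4 * s\<^sup>2))) (\<lambda>\<omega>. real (count_right \<sigma> X (idla \<omega> K)) \<le> y ^ 3 \<longrightarrow>
      real (count_right \<sigma> (X + int W) (idla \<omega> K)) \<le> 5832 * s)"
proof -
  define t where "t = root 3 (s\<^sup>2)"
  have t: "0 < t" "t ^ 3 = s\<^sup>2" using s by (auto simp: t_def)
  define stop where "stop = (\<lambda>j :: nat. \<not> (18 \<le> y / 2 ^ j \<and> 18 * t \<le> (y / 2 ^ j)\<^sup>2))"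
  define J where "J = (LEAST j. stop j)"
  have ex: "stop (nat \<lceil>y\<rceil>)"
  proof -
    have "real (nat \<lceil>y\<rceil>) < 2 ^ nat \<lceil>y\<rceil>" using of_nat_less_two_power by blast
    then have "y < 2 ^ nat \<lceil>y\<rceil>" using y by linarith
    then have "y / 2 ^ nat \<lceil>y\<rceil> < 1" by simp
    then have "\<not> 18 \<le> y / 2 ^ nat \<lceil>y\<rceil>" by linarith
    then show ?thesis unfolding stop_def by blast
  qed
  have J: "stop J" unfolding J_def using ex by (rule LeastI)
  have "J \<le> nat \<lceil>y\<rceil>" unfolding J_def using ex by (rule Least_le)
  then have Jy: "real J \<le> y + 2" using y by linarith
  have before: "18 \<le> y / 2 ^ j \<and> 18 * t \<le> (y / 2 ^ j)\<^sup>2" if "j < J" for j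
    using not_less_Least[of j stop] that unfolding J_def stop_def by blast
  obtain W where W: "real W \<le> 324 * (\<Sum>j<J. y / 2 ^ j + t\<^sup>2 * 2 ^ j / y)"
    "fails_within (real J * exp (- (4 * s\<^sup>2))) (\<lambda>\<omega>. real (count_right \<sigma> X (idla \<omega> K)) \<le> y ^ 3 \<longrightarrow>
      real (count_right \<sigma> (X + int W) (idla \<omega> K)) \<le> (y / 2 ^ J) ^ 3)"
    using halving_iterate[OF sgn X t before] by blast
  have "(\<Sum>j<J. y / 2 ^ j + t\<^sup>2 * 2 ^ j / y) \<le> 2 * y + 2 * s"
  proof -
    have "(\<Sum>j<J. y / 2 ^ j) = 2 * y - 2 * y / 2 ^ J"
      by (induction J) (auto simp: field_simps)
    then have 1: "(\<Sum>j<J. y / 2 ^ j) \<le> 2 * y" using y by simp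
    have e: "(\<Sum>j<J. t\<^sup>2 * 2 ^ j / y) = t\<^sup>2 * (2 ^ J - 1) / y"
      by (induction J) (auto simp: algebra_simps add_divide_distrib diff_divide_distrib)
    have "(\<Sum>j<J. t\<^sup>2 * 2 ^ j / y) \<le> 2 * s"
    proof (cases J)
      case 0
      then show ?thesis using s by simp
    next
      case (Suc i)
      define u where "u = y / 2 ^ i"
      have u: "18 \<le> u" "18 * t \<le> u\<^sup>2" using before[of i] Suc by (auto simp: u_def)
      have "t\<^sup>2 / u \<le> s"
      proof (rule power2_le_imp_le)
        have "(t\<^sup>2 / u)\<^sup>2 = t ^ 3 * t / u\<^sup>2" by (simp add: power_divide eval_nat_numeral)
        also have "\<dots> \<le> t ^ 3 * u\<^sup>2 / u\<^sup>2" using u t by (intro divide_right_mono mult_left_mono) auto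
        also have "\<dots> = s\<^sup>2" using u t by simp
        finally show "(t\<^sup>2 / u)\<^sup>2 \<le> s\<^sup>2" .
      qed (use s in simp)
      moreover have "t\<^sup>2 * (2 ^ J - 1) / y \<le> 2 * (t\<^sup>2 / u)"
      proof -
        have "t\<^sup>2 * (2 ^ J - 1) / y \<le> t\<^sup>2 * 2 ^ J / y" using y by (intro divide_right_mono mult_left_mono) auto
        also have "\<dots> = 2 * (t\<^sup>2 / u)" using Suc by (simp add: u_def)
        finally show ?thesis .
      qed
      ultimately show ?thesis unfolding e by linarith
    qed
    then show ?thesis using 1 by (simp add: sum.distrib)
  qed
  then have "324 * (\<Sum>j<J. y / 2 ^ j + t\<^sup>2 * 2 ^ j / y) \<le> 324 * (2 * y + 2 * s)" by (rule mult_left_mono) simp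
  then have Wle: "real W \<le> 648 * (y + s)" using W(1) by simp
  have final: "(y / 2 ^ J) ^ 3 \<le> 5832 * s"
  proof -
    define u where "u = y / 2 ^ J"
    have u0: "0 < u" using y by (simp add: u_def)
    have "u < 18 \<or> u\<^sup>2 < 18 * t" using J by (auto simp: stop_def u_def)
    then have "u ^ 3 \<le> 5832 * s"
    proof
      assume "u < 18"
      then have "u ^ 3 \<le> 18 ^ 3" using u0 by (intro power_mono) auto
      then show ?thesis using s by simp
    next
      assume "u\<^sup>2 < 18 * t"
      then have "(u\<^sup>2) ^ 3 \<le> (18 * t) ^ 3" by (intro power_mono) auto
      also have "\<dots> = 5832 * s\<^sup>2" by (simp add: power_mult_distrib t)
      also have "\<dots> \<le> (5832 * s)\<^sup>2" by (simp add: power_mult_distrib)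
      finally have "(u ^ 3)\<^sup>2 \<le> (5832 * s)\<^sup>2" by (simp flip: power_mult)
      then show ?thesis using s by (intro power2_le_imp_le[of "u ^ 3"]) auto
    qed
    then show ?thesis by (simp add: u_def)
  qed
  have "fails_within ((y + 2) * exp (- (4 * s\<^sup>2))) (\<lambda>\<omega>. real (count_right \<sigma> X (idla \<omega> K)) \<le> y ^ 3 \<longrightarrow>
      real (count_right \<sigma> (X + int W) (idla \<omega> K)) \<le> 5832 * s)"
    using W(2)
  proof (rule fails_within_mono)
    show "real J * exp (- (4 * s\<^sup>2)) \<le> (y + 2) * exp (- (4 * s\<^sup>2))" using Jy by (intro mult_right_mono) auto
  qed (use final in auto)
  then show ?thesis using Wle by blast
qed

text \<open>
  A subtree that reaches \<open>x\<close> contains the backbone from \<open>X\<close> to \<open>x\<close>.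
\<close>

lemma star_closed_reach:
  assumes A: "finite A" "star_closed A" and sgn: "\<bar>\<sigma>\<bar> = 1" and X: "0 \<le> X" and v: "(x, y) \<in> A"
  shows "\<sigma> * x \<le> X + int (count_right \<sigma> X A)"
proof (cases "\<sigma> * x \<le> X")
  case False
  have x0: "(x, 0) \<in> A"
    using star_closed_tooth_pos[OF A(2) v, of 0] star_closed_tooth_neg[OF A(2) v, of 0] by (cases "0 \<le> y") auto
  have "(\<lambda>j. (\<sigma> * j, 0)) ` {X<..\<sigma> * x} \<subseteq> {v \<in> A. X < \<sigma> * fst v}"
  proof safe
    fix j assume j: "j \<in> {X<..\<sigma> * x}"
    have "\<sigma> * \<sigma> = 1" using sign_cases[OF sgn] by auto
    then show "X < \<sigma> * fst (\<sigma> * j, 0)" using j by (simp flip: mult.assoc)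
    show "(\<sigma> * j, 0) \<in> A"
      using sign_cases[OF sgn] star_closed_backbone_pos[OF A(2) x0, of j] star_closed_backbone_neg[OF A(2) x0, of "- j"] j X
      by auto
  qed
  then have "card ((\<lambda>j. (\<sigma> * j, 0 :: int)) ` {X<..\<sigma> * x}) \<le> count_right \<sigma> X A"
    unfolding count_right_def using A by (intro card_mono) auto
  moreover have "inj_on (\<lambda>j. (\<sigma> * j, 0 :: int)) {X<..\<sigma> * x}" using sgn by (auto simp: inj_on_def)
  ultimately have "nat (\<sigma> * x - X) \<le> count_right \<sigma> X A" by (simp add: card_image)
  then show ?thesis by linarith
qed simp

section \<open>Both bounds, and almost sure convergence\<close>

lemma \<D>_mono: "\<rho> \<le> \<rho>' \<Longrightarrow> \<D> \<rho> \<subseteq> \<D> \<rho>'"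
proof
  fix v assume le: "\<rho> \<le> \<rho>'" and "v \<in> \<D> \<rho>"
  then obtain x y where v: "v = (x, y)" "\<bar>real_of_int x\<bar> < \<rho>" "\<bar>real_of_int y\<bar> < 1 / 3 * (\<rho> - \<bar>real_of_int x\<bar>)\<^sup>2"
    by (auto simp: \<D>_def)
  have "(\<rho> - \<bar>real_of_int x\<bar>)\<^sup>2 \<le> (\<rho>' - \<bar>real_of_int x\<bar>)\<^sup>2" using le v by (intro power_mono) auto
  then have "\<bar>real_of_int y\<bar> < 1 / 3 * (\<rho>' - \<bar>real_of_int x\<bar>)\<^sup>2" using v(3) by linarith
  then show "v \<in> \<D> \<rho>'" using le v by (simp add: \<D>_def)
qed

text \<open>
  The bound of \<open>outer_excess\<close> with \<open>q 0 = 1 / \<rho>\<^sup>2\<close> and the inner radius provided by \<open>inner_bound\<close>: the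
  annulus between \<open>n - 11236 * s\<close> and \<open>n\<close> has about \<open>4 / 9 * 3 * 11236 * s * n\<^sup>2\<close> sites.
\<close>

lemma excess_bound:
  fixes n s \<rho> N :: real
  assumes s: "1 \<le> s" "22472 * s \<le> n" and \<rho>: "n \<le> \<rho>" and N: "\<bar>N - 4 / 9 * n ^ 3\<bar> \<le> 11 * n"
  shows "2 * (4 * s + 1 / \<rho>\<^sup>2 * (N - 4 / 9 * (n - 11236 * s) ^ 3) + 4 * s * (1 / \<rho>\<^sup>2)\<^sup>2 * N + 300 + 800 * s)
    \<le> 33000 * s"
proof -
  define r where "r = n - 11236 * s"
  have n: "n \<ge> 22472" "0 \<le> r" "r \<le> n" using s by (auto simp: r_def)
  have cube: "n ^ 3 - r ^ 3 = (n - r) * (n\<^sup>2 + n * r + r\<^sup>2)"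
    by (simp add: algebra_simps power2_eq_square power3_eq_cube)
  have "n * r \<le> n\<^sup>2" "r\<^sup>2 \<le> n\<^sup>2" using n by (auto simp: power2_eq_square intro: mult_mono)
  then have "n\<^sup>2 + n * r + r\<^sup>2 \<le> 3 * n\<^sup>2" by linarith
  moreover have "n - r = 11236 * s" by (simp add: r_def)
  ultimately have "(n - r) * (n\<^sup>2 + n * r + r\<^sup>2) \<le> 11236 * s * (3 * n\<^sup>2)"
    using s by (simp only:) (intro mult_left_mono, auto)
  then have d: "N - 4 / 9 * r ^ 3 \<le> 11 * n + 4 / 9 * (33708 * s * n\<^sup>2)" using N cube by linarith
  have nn: "11 * n \<le> s * n\<^sup>2"
  proof -
    have "11 * n \<le> n * n" using n by (intro mult_right_mono) auto
    also have "\<dots> \<le> s * (n * n)" using s n mult_right_mono[of 1 s "n * n"] by simp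
    finally show ?thesis by (simp add: power2_eq_square)
  qed
  have p: "0 < 1 / \<rho>\<^sup>2" "1 / \<rho>\<^sup>2 \<le> 1 / n\<^sup>2"
    using n \<rho> by (auto intro!: divide_left_mono power_mono mult_pos_pos)
  have "1 / \<rho>\<^sup>2 * (N - 4 / 9 * r ^ 3) \<le> 1 / \<rho>\<^sup>2 * (15000 * (s * n\<^sup>2))"
  proof (intro mult_left_mono)
    have "4 / 9 * (33708 * s * n\<^sup>2) \<le> 14999 * (s * n\<^sup>2)"
    proof -
      have "0 \<le> s * n\<^sup>2" using s by simp
      then show ?thesis by simp
    qed
    then show "N - 4 / 9 * r ^ 3 \<le> 15000 * (s * n\<^sup>2)" using d nn by linarith
  qed (use p in auto)
  also have "\<dots> \<le> 1 / n\<^sup>2 * (15000 * (s * n\<^sup>2))" using p s by (intro mult_right_mono) auto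
  also have "\<dots> = 15000 * s" using n by simp
  finally have 1: "1 / \<rho>\<^sup>2 * (N - 4 / 9 * r ^ 3) \<le> 15000 * s" .
  have "n * 1 \<le> n * n\<^sup>2" using n by (intro mult_left_mono) (auto simp: power2_eq_square mult_ge1_I)
  then have "11 * n \<le> 11 * n ^ 3" by (simp add: power2_eq_square power3_eq_cube)
  then have b: "N \<le> 12 * n ^ 3" using N n by linarith
  have "4 * s * (1 / \<rho>\<^sup>2)\<^sup>2 * N \<le> s"
  proof (cases "0 \<le> N")
    case True
    have "4 * s * (1 / \<rho>\<^sup>2)\<^sup>2 * N \<le> 4 * s * (1 / n\<^sup>2)\<^sup>2 * (12 * n ^ 3)"
      using p b True s n by (intro mult_mono mult_nonneg_nonneg power_mono) auto
    also have "\<dots> = s * (48 / n)" using n by (simp add: power_divide eval_nat_numeral)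
    also have "\<dots> \<le> s * 1" using n s by (intro mult_left_mono) auto
    finally show ?thesis by simp
  next
    case False
    then have "4 * s * (1 / \<rho>\<^sup>2)\<^sup>2 * N \<le> 0" using s by (intro mult_nonneg_nonpos) auto
    then show ?thesis using s by linarith
  qed
  moreover have "2 * (4 * s + a + b + 300 + 800 * s) \<le> 33000 * s" if "a \<le> 15000 * s" "b \<le> s" for a b
    using that s(1) by simp
  ultimately show ?thesis using 1 unfolding r_def by blast
qed

text \<open>
  The constants are chosen in turn. The excess is at most \<open>33000 * s\<close>. A tooth that reaches the boundary at
  some \<open>\<bar>x\<bar> \<le> x0\<close> has excess \<open>m / 192\<close>, which is larger for \<open>m = 10 ^ 7 * s\<close>. The number of sites with
  \<open>\<bar>x\<bar> \<ge> x0\<close> is at most \<open>33000 * s * m\<^sup>2 \<le> y ^ 3\<close> for \<open>y = 1500000 * s\<close>, so these sites reach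
  at most \<open>648 * (y + s) + 5832 * s \<le> 10 ^ 9 * s\<close> beyond \<open>x0\<close>, which gives \<open>x1\<close>. The slope
  \<open>\<kappa> = 1 / (32 * 10 ^ 22 * s ^ 3)\<close> keeps the potential small for \<open>T = 10 ^ 22 * s\<^sup>2\<close>,
  and \<open>10 ^ 22\<close> is large enough for \<open>\<kappa> * T\<^sup>2 / 16\<close> to exceed the excess. Finally
  \<open>10 ^ 12\<close> swallows \<open>m\<close>, \<open>x1 - x0\<close> and the square root of \<open>3 * T\<close>.
\<close>

lemma finite_clusters_at_scale:
  fixes n :: nat and s :: real
  assumes s_bd: "s = sqrt (ln (real n))" "1 \<le> s" "1000000000000000 * s\<^sup>2 \<le> real n"
  shows "fails_within (14 / real n ^ 3) (\<lambda>\<omega>. \<D> (real n - 1000000000000 * s) \<subseteq> idla_cluster \<omega> n \<and>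
    idla_cluster \<omega> n \<subseteq> \<D> (real n + 1000000000000 * s))"
proof -
  define m where "m = 10000000 * s"
  define x0 where "x0 = \<lceil>real n + m\<rceil>"
  define x1 where "x1 = x0 + \<lfloor>1000000000 * s\<rfloor>"
  define T where "T = 10000000000000000000000 * s\<^sup>2"
  define \<kappa> where "\<kappa> = 1 / (32 * 10000000000000000000000 * s ^ 3)"
  define \<rho>i where "\<rho>i = real n - 11236 * s"
  define R where "R = outer_region x0 m x1 T"
  let ?N = "num_sites n"
  have ss: "s \<le> s\<^sup>2" using s_bd(2) by (simp add: power2_eq_square)
  have ns: "1000000000000000 * s \<le> real n" using ss s_bd(3) by linarith
  have n: "real n \<ge> 1000000000000000" using ns s_bd(2) by linarith
  have lnn: "s\<^sup>2 = ln (real n)" using s_bd n by simp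
  have e4: "exp (- (4 * s\<^sup>2)) = 1 / real n ^ 4"
  proof -
    have "exp (4 * s\<^sup>2) = real n ^ 4" unfolding lnn using n exp_of_nat_mult[of 4 "ln (real n)"] by simp
    then show ?thesis by (simp add: exp_minus inverse_eq_divide)
  qed
  have x0_bd: "real n + m \<le> x0" "real_of_int x0 < real n + m + 1" unfolding x0_def by linarith+
  have x1_bd: "real_of_int x1 \<le> x0 + 1000000000 * s" "x0 + 1000000000 * s < real_of_int x1 + 1" "x0 \<le> x1"
    unfolding x1_def using s_bd(2) by (auto simp: le_floor_iff)
  have m_bd: "m \<ge> 100" "m \<ge> s" using s_bd(2) by (auto simp: m_def)
  have outer: "outer_tooth x0 xt x1 m \<kappa> T s" if "0 \<le> xt" "xt \<le> x1" for xt
  proof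
    show "4 * m\<^sup>2 \<le> real_of_int x0" using s_bd(3) x0_bd(1) m_bd by (simp add: m_def power_mult_distrib)
    show "0 \<le> \<kappa>" using s_bd(2) by (simp add: \<kappa>_def)
    show "\<kappa> \<le> 1 / m ^ 3"
      unfolding \<kappa>_def m_def using s_bd(2) by (intro divide_left_mono) (auto simp: power_mult_distrib)
    show "8 * s * (1 / m + 1 / m\<^sup>2 + \<kappa> * (x1 - x0) + (T + 1) * \<kappa>) \<le> 1"
    proof -
      have a: "s * (1 / m) \<le> 1 / 10000000" using s_bd(2) by (simp add: m_def)
      have b: "s * (1 / m\<^sup>2) \<le> 1 / 10000000"
      proof -
        have "1 / m\<^sup>2 \<le> 1 / m" using m_bd by (intro divide_left_mono) (auto simp: power2_eq_square)
        then have "s * (1 / m\<^sup>2) \<le> s * (1 / m)" using s_bd(2) by (intro mult_left_mono) auto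
        then show ?thesis using a by linarith
      qed
      have sk: "s * \<kappa> = 1 / (32 * 10000000000000000000000 * s\<^sup>2)" using s_bd(2) by (simp add: \<kappa>_def power2_eq_square power3_eq_cube)
      have sk0: "0 \<le> s * \<kappa>" unfolding sk by simp
      have c: "s * (\<kappa> * (real_of_int x1 - real_of_int x0)) \<le> 1 / 32"
      proof -
        have "s * \<kappa> * (real_of_int x1 - real_of_int x0) \<le> s * \<kappa> * (10000000000000000000000 * s\<^sup>2)"
          using x1_bd(1) ss sk0 s_bd(2) by (intro mult_left_mono) linarith+
        also have "\<dots> = 1 / 32" unfolding sk using s_bd(2) by simp
        finally show ?thesis by (simp only: mult.assoc)
      qed
      have d: "s * ((T + 1) * \<kappa>) \<le> 1 / 16"
      proof -
        have "1 \<le> s\<^sup>2" using s_bd(2) by simp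
        then have "s * \<kappa> * (T + 1) \<le> s * \<kappa> * (2 * (10000000000000000000000 * s\<^sup>2))"
          using sk0 unfolding T_def by (intro mult_left_mono) linarith+
        also have "\<dots> = 1 / 16" unfolding sk using s_bd(2) by simp
        finally show ?thesis by (simp only: mult_ac)
      qed
      have "8 * s * (1 / m + 1 / m\<^sup>2 + \<kappa> * (x1 - x0) + (T + 1) * \<kappa>) =
          8 * (s * (1 / m) + s * (1 / m\<^sup>2) + s * (\<kappa> * (real_of_int x1 - real_of_int x0)) + s * ((T + 1) * \<kappa>))"
        by (simp only: distrib_left mult.assoc of_int_diff)
      also have "\<dots> \<le> 8 * (1 / 10000000 + 1 / 10000000 + 1 / 32 + 1 / 16)" using a b c d by (intro mult_left_mono add_mono) auto
      also have "\<dots> \<le> 1" by simp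
      finally show ?thesis .
    qed
    show "T > 0" "s > 0" using s_bd(2) by (auto simp: T_def)
  qed (use that x1_bd m_bd in auto)
  have \<rho>i: "1 \<le> \<rho>i" "\<rho>i + 3 \<le> x0" using ns x0_bd(1) m_bd s_bd(2) by (auto simp: \<rho>i_def)
  have DR: "\<D> (real n - 11200 * s) \<subseteq> R"
  proof
    fix v assume "v \<in> \<D> (real n - 11200 * s)"
    then obtain x y where v: "v = (x, y)" "\<bar>real_of_int x\<bar> < real n - 11200 * s"
      "\<bar>real_of_int y\<bar> < 1 / 3 * (real n - 11200 * s - \<bar>real_of_int x\<bar>)\<^sup>2"
      by (auto simp: \<D>_def)
    have "(real n - 11200 * s - \<bar>real_of_int x\<bar>)\<^sup>2 \<le> (x0 + m - 1 - \<bar>real_of_int x\<bar>)\<^sup>2"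
      using v x0_bd(1) m_bd s_bd(2) by (intro power_mono) auto
    moreover have "\<bar>x\<bar> \<le> x0" using v(2) x0_bd(1) m_bd s_bd(2) by linarith
    ultimately show "v \<in> R" using v by (simp add: R_def outer_region_def)
  qed
  define ex where "ex = (\<lambda>\<sigma> xt A. \<Sum>v\<in>A - \<D> \<rho>i. comb_harmonic (outer_profile x0 m xt \<kappa>) (\<lambda>_. 0) (reflect \<sigma> 1 v))"
  have inner: "fails_within (8 / real n ^ 3) (\<lambda>\<omega>. \<D> \<rho>i \<subseteq> frozen_idla R \<omega> ?N)"
    unfolding \<rho>i_def using ns by (intro inner_bound[OF s_bd(1,2) _ DR]) auto
  define I where "I = {1, -1 :: int} \<times> {0..x1}"
  have excess1: "fails_within (exp (- (4 * s\<^sup>2))) (\<lambda>\<omega>. \<D> \<rho>i \<subseteq> frozen_idla R \<omega> ?N \<longrightarrow>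
      ex (fst i) (snd i) (frozen_idla R \<omega> ?N) \<le> 33000 * s)" if "i \<in> I" for i
  proof -
    obtain \<sigma> xt where i: "i = (\<sigma>, xt)" by force
    have sg: "\<bar>\<sigma>\<bar> = 1" and xt: "0 \<le> xt" "xt \<le> x1" using that by (auto simp: i I_def)
    interpret outer_tooth x0 xt x1 m \<kappa> T s by (rule outer[OF xt])
    have N: "\<bar>real ?N - 4 / 9 * real n ^ 3\<bar> \<le> 11 * real n" using n by (intro num_sites_cubic) simp
    have rn: "real n \<le> \<rho>" using x0_bd m_bd by (simp add: \<rho>_def)
    have ns': "22472 * s \<le> real n" using ns s_bd(2) by linarith
    show ?thesis
      using outer_excess[OF \<rho>i sg, of ?N] excess_bound[OF s_bd(2) ns' rn N]
      unfolding ex_def i fst_conv snd_conv R_def q0 \<rho>i_def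
      by (elim fails_within_weaken) (auto intro: order_trans)
  qed
  have excess: "fails_within (real (card I) * exp (- (4 * s\<^sup>2))) (\<lambda>\<omega>. \<forall>i\<in>I. \<D> \<rho>i \<subseteq> frozen_idla R \<omega> ?N \<longrightarrow>
      ex (fst i) (snd i) (frozen_idla R \<omega> ?N) \<le> 33000 * s)"
    by (rule fails_within_Ball[OF _ excess1]) (auto simp: I_def)
  define y where "y = 1500000 * s"
  have X: "0 \<le> x0 - 1" using x0_bd(1) n m_bd by linarith
  have "\<exists>W. real W \<le> 648 * (y + s) \<and> fails_within ((y + 2) * exp (- (4 * s\<^sup>2)))
      (\<lambda>\<omega>. real (count_right \<sigma> (x0 - 1) (idla \<omega> ?N)) \<le> y ^ 3 \<longrightarrow>
        real (count_right \<sigma> (x0 - 1 + int W) (idla \<omega> ?N)) \<le> 5832 * s)" if "\<bar>\<sigma>\<bar> = 1" for \<sigma>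
    using s_bd(2) by (intro few_sites_far_right[OF that X s_bd(2)]) (simp add: y_def)
  note exW = this
  define good_W where "good_W = (\<lambda>\<sigma> W. real W \<le> 648 * (y + s) \<and> fails_within ((y + 2) * exp (- (4 * s\<^sup>2)))
      (\<lambda>\<omega>. real (count_right \<sigma> (x0 - 1) (idla \<omega> ?N)) \<le> y ^ 3 \<longrightarrow>
        real (count_right \<sigma> (x0 - 1 + int W) (idla \<omega> ?N)) \<le> 5832 * s))"
  \<comment> \<open>The width of the front may be different on the two sides.\<close>
  define W where "W = (\<lambda>\<sigma>. SOME w. good_W \<sigma> w)"
  have good_W: "good_W \<sigma> (W \<sigma>)" if "\<bar>\<sigma>\<bar> = 1" for \<sigma>
    unfolding W_def by (rule someI_ex) (use exW[OF that] in \<open>unfold good_W_def\<close>)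
  have W: "real (W \<sigma>) \<le> 648 * (y + s)"
    "fails_within ((y + 2) * exp (- (4 * s\<^sup>2)))
      (\<lambda>\<omega>. real (count_right \<sigma> (x0 - 1) (idla \<omega> ?N)) \<le> y ^ 3 \<longrightarrow>
        real (count_right \<sigma> (x0 - 1 + int (W \<sigma>)) (idla \<omega> ?N)) \<le> 5832 * s)" if "\<bar>\<sigma>\<bar> = 1" for \<sigma>
    using good_W[OF that] unfolding good_W_def by (rule conjunct1, rule conjunct2)
  have far: "fails_within (real (card {1, -1 :: int}) * ((y + 2) * exp (- (4 * s\<^sup>2))))
      (\<lambda>\<omega>. \<forall>\<sigma>\<in>{1, -1}. real (count_right \<sigma> (x0 - 1) (idla \<omega> ?N)) \<le> y ^ 3 \<longrightarrow>
        real (count_right \<sigma> (x0 - 1 + int (W \<sigma>)) (idla \<omega> ?N)) \<le> 5832 * s)"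
    by (rule fails_within_Ball) (auto intro: W(2))
  have good: "\<D> (real n - 1000000000000 * s) \<subseteq> idla_cluster \<omega> n \<and> idla_cluster \<omega> n \<subseteq> \<D> (real n + 1000000000000 * s)"
    if proper: "\<forall>k. proper_path (\<omega> k)" and D: "\<D> \<rho>i \<subseteq> frozen_idla R \<omega> ?N"
      and exc: "\<forall>i\<in>I. \<D> \<rho>i \<subseteq> frozen_idla R \<omega> ?N \<longrightarrow> ex (fst i) (snd i) (frozen_idla R \<omega> ?N) \<le> 33000 * s"
      and fr: "\<forall>\<sigma>\<in>{1, -1}. real (count_right \<sigma> (x0 - 1) (idla \<omega> ?N)) \<le> y ^ 3 \<longrightarrow>
        real (count_right \<sigma> (x0 - 1 + int (W \<sigma>)) (idla \<omega> ?N)) \<le> 5832 * s" for \<omega>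
  proof -
    let ?A = "frozen_idla R \<omega> ?N"
    have star: "star_closed ?A" using proper by (intro star_closed_frozen_idla) auto
    have e: "ex \<sigma> xt ?A \<le> 33000 * s" if "\<bar>\<sigma>\<bar> = 1" "0 \<le> xt" "xt \<le> x1" for \<sigma> xt
    proof -
      have "(\<sigma>, xt) \<in> I" using that by (auto simp: I_def)
      then show ?thesis using exc D by force
    qed
    have sgx: "\<bar>if x \<ge> 0 then 1 else -1 :: int\<bar> = 1" "(if x \<ge> 0 then 1 else -1) * \<bar>x\<bar> = x" for x :: int by auto
    \<comment> \<open>The cluster stays in the region: otherwise some tooth would have too much excess.\<close>
    have AR: "?A \<subseteq> R"
    proof (rule ccontr)
      assume "\<not> ?A \<subseteq> R"
      then obtain x z where v: "(x, z) \<in> ?A" "(x, z) \<notin> R" by auto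
      define \<sigma> :: int where "\<sigma> = (if x \<ge> 0 then 1 else -1)"
      have sg: "\<bar>\<sigma>\<bar> = 1" "\<sigma> * \<bar>x\<bar> = x" using sgx[of x] by (auto simp: \<sigma>_def)
      consider "\<bar>x\<bar> \<le> x0" "(x0 + m - 1 - \<bar>real_of_int x\<bar>)\<^sup>2 / 3 \<le> \<bar>real_of_int z\<bar>"
        | "x0 < \<bar>x\<bar>" "\<bar>x\<bar> \<le> x1" "T \<le> \<bar>real_of_int z\<bar>"
        using v(2) by (auto simp: R_def outer_region_def not_less)
      then show False
      proof cases
        case 1
        have xx: "0 \<le> \<bar>x\<bar>" "\<bar>x\<bar> \<le> x1" using 1 x1_bd by auto
        interpret outer_tooth x0 "\<bar>x\<bar>" x1 m \<kappa> T s by (rule outer[OF xx])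
        have "m / 192 \<le> ex \<sigma> \<bar>x\<bar> ?A" unfolding ex_def
        proof (rule tip_excess[OF finite_frozen_idla star _ sg(1) 1(1)])
          show "\<And>v. v \<in> ?A \<Longrightarrow> 0 \<le> comb_harmonic (outer_profile x0 m \<bar>x\<bar> \<kappa>) (\<lambda>_. 0) (reflect \<sigma> 1 v)"
            using H_cluster_nonneg[OF sg(1) proper] unfolding R_def by blast
          show "(\<sigma> * \<bar>x\<bar>, z) \<in> ?A" using v(1) sg(2) by simp
          show "height \<bar>x\<bar> \<le> \<bar>real_of_int z\<bar>" using 1(2) by (simp add: height_def \<rho>_def)
          show "\<rho>i + m / 2 \<le> \<rho>" using \<rho>i(2) m_bd by (simp add: \<rho>_def)
        qed
        then show False using e[OF sg(1) xx] s_bd(2) by (simp add: m_def)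
      next
        case 2
        have xx: "0 \<le> \<bar>x\<bar>" "\<bar>x\<bar> \<le> x1" using 2 by auto
        interpret outer_tooth x0 "\<bar>x\<bar>" x1 m \<kappa> T s by (rule outer[OF xx])
        have "\<kappa> * T\<^sup>2 / 16 \<le> ex \<sigma> \<bar>x\<bar> ?A" unfolding ex_def
        proof (rule far_tip_excess[OF finite_frozen_idla star _ sg(1) 2(1)])
          show "\<And>v. v \<in> ?A \<Longrightarrow> 0 \<le> comb_harmonic (outer_profile x0 m \<bar>x\<bar> \<kappa>) (\<lambda>_. 0) (reflect \<sigma> 1 v)"
            using H_cluster_nonneg[OF sg(1) proper] unfolding R_def by blast
          show "(\<sigma> * \<bar>x\<bar>, z) \<in> ?A" using v(1) sg(2) by simp
          show "4 \<le> T" using ss s_bd(2) unfolding T_def by linarith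
        qed (use 2 \<rho>i in auto)
        moreover have "\<kappa> * T\<^sup>2 / 16 = 10000000000000000000000 * s / 512"
          using s_bd(2) by (simp add: \<kappa>_def T_def power2_eq_square power3_eq_cube)
        ultimately show False using e[OF sg(1) xx] s_bd(2) by simp
      qed
    qed
    have A: "idla \<omega> ?N = ?A" by (rule idla_eq_frozen_within[OF AR])
    have count: "real (count_right \<sigma> (x0 - 1) ?A) \<le> y ^ 3" if sg: "\<bar>\<sigma>\<bar> = 1" for \<sigma>
    proof -
      have xx: "0 \<le> x0" "x0 \<le> x1" using X x1_bd by auto
      interpret outer_tooth x0 x0 x1 m \<kappa> T s by (rule outer[OF xx])
      have "real (card {v \<in> ?A. x0 \<le> \<sigma> * fst v}) * (1 / m\<^sup>2) \<le> ex \<sigma> x0 ?A" unfolding ex_def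
      proof (rule count_excess[OF finite_frozen_idla _ sg refl])
        show "\<And>v. v \<in> ?A \<Longrightarrow> 0 \<le> comb_harmonic (outer_profile x0 m x0 \<kappa>) (\<lambda>_. 0) (reflect \<sigma> 1 v)"
          using H_cluster_nonneg[OF sg proper] unfolding R_def by blast
      qed (use \<rho>i in auto)
      also have "\<dots> \<le> 33000 * s" by (rule e[OF sg xx])
      finally have "real (card {v \<in> ?A. x0 \<le> \<sigma> * fst v}) \<le> 33000 * s * m\<^sup>2" using m_bd by (simp add: divide_le_eq)
      also have "\<dots> \<le> y ^ 3"
      proof -
        have "33000 * s * m\<^sup>2 = 3300000000000000000 * s ^ 3" by (simp add: m_def power2_eq_square power3_eq_cube)
        moreover have "y ^ 3 = 3375000000000000000 * s ^ 3" by (simp add: y_def power3_eq_cube)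
        moreover have "0 \<le> s ^ 3" using s_bd(2) by simp
        ultimately show ?thesis by simp
      qed
      finally have "real (card {v \<in> ?A. x0 \<le> \<sigma> * fst v}) \<le> y ^ 3" .
      moreover have "{v \<in> ?A. x0 - 1 < \<sigma> * fst v} = {v \<in> ?A. x0 \<le> \<sigma> * fst v}" by auto
      ultimately show ?thesis by (simp add: count_right_def)
    qed
    have reach: "\<bar>x\<bar> \<le> x1" if v: "(x, z) \<in> ?A" for x z
    proof -
      define \<sigma> :: int where "\<sigma> = (if x \<ge> 0 then 1 else -1)"
      have sg: "\<bar>\<sigma>\<bar> = 1" "\<sigma> * x = \<bar>x\<bar>" "\<sigma> \<in> {1, -1}" by (auto simp: \<sigma>_def)
      have c: "real (count_right \<sigma> (x0 - 1 + int (W \<sigma>)) ?A) \<le> 5832 * s"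
        using fr sg(3) count[OF sg(1)] unfolding A by blast
      have "\<sigma> * x \<le> (x0 - 1 + int (W \<sigma>)) + int (count_right \<sigma> (x0 - 1 + int (W \<sigma>)) ?A)"
        using X by (intro star_closed_reach[OF finite_frozen_idla star sg(1) _ v]) auto
      then have "real_of_int \<bar>x\<bar> \<le> x0 - 1 + real (W \<sigma>) + real (count_right \<sigma> (x0 - 1 + int (W \<sigma>)) ?A)"
        unfolding sg(2) by linarith
      also have "\<dots> \<le> x0 - 1 + 648 * (y + s) + 5832 * s" using W(1)[OF sg(1)] c by linarith
      also have "\<dots> \<le> x0 - 1 + 1000000000 * s" using s_bd(2) by (simp add: y_def)
      finally show ?thesis using x1_bd(2) by linarith
    qed
    have "?A \<subseteq> \<D> (real n + 1000000000000 * s)"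
    proof
      fix v assume v: "v \<in> ?A"
      obtain x z where xz: "v = (x, z)" by force
      have xR: "(x, z) \<in> R" "\<bar>x\<bar> \<le> x1" using v AR reach by (auto simp: xz)
      have xb: "\<bar>real_of_int x\<bar> \<le> x0 + 1000000000 * s" using xR(2) x1_bd(1) by linarith
      have gap: "1000000000000 * s / 2 \<le> real n + 1000000000000 * s - \<bar>real_of_int x\<bar>"
        using xb x0_bd(2) s_bd(2) by (simp add: m_def)
      have "\<bar>real_of_int z\<bar> < 1 / 3 * (real n + 1000000000000 * s - \<bar>real_of_int x\<bar>)\<^sup>2"
      proof (cases "\<bar>x\<bar> \<le> x0")
        case True
        have "(x0 + m - 1 - \<bar>real_of_int x\<bar>)\<^sup>2 \<le> (real n + 1000000000000 * s - \<bar>real_of_int x\<bar>)\<^sup>2"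
          using True x0_bd(2) m_bd s_bd(2) by (intro power_mono) (auto simp: m_def)
        then show ?thesis using xR(1) True by (simp add: R_def outer_region_def)
      next
        case False
        have "\<bar>real_of_int z\<bar> < T" using xR False by (simp add: R_def outer_region_def)
        moreover have "(1000000000000 * s / 2)\<^sup>2 \<le> (real n + 1000000000000 * s - \<bar>real_of_int x\<bar>)\<^sup>2"
          using gap s_bd(2) by (intro power_mono) auto
        moreover have "(1000000000000 * s / 2)\<^sup>2 = 25 * 10000000000000000000000 * s\<^sup>2" by (simp add: power2_eq_square)
        ultimately show ?thesis using s_bd(2) unfolding T_def by simp
      qed
      moreover have "\<bar>real_of_int x\<bar> < real n + 1000000000000 * s" using gap s_bd(2) by linarith
      ultimately show "v \<in> \<D> (real n + 1000000000000 * s)" by (simp add: xz \<D>_def)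
    qed
    moreover have "\<D> (real n - 1000000000000 * s) \<subseteq> \<D> \<rho>i" using s_bd(2) by (intro \<D>_mono) (simp add: \<rho>i_def)
    ultimately show ?thesis using D by (simp add: idla_cluster_def A)
  qed
  have prob: "8 / real n ^ 3 + (real (card I) * exp (- (4 * s\<^sup>2)) +
      real (card {1, -1 :: int}) * ((y + 2) * exp (- (4 * s\<^sup>2)))) \<le> 14 / real n ^ 3"
  proof -
    have "real (card I) = 2 * real (nat (x1 + 1))" by (simp add: I_def card_cartesian_product)
    moreover have "real (nat (x1 + 1)) \<le> 2 * real n"
      using x1_bd(1) x0_bd(2) ns n unfolding m_def by linarith
    moreover have "y + 2 \<le> real n" using ns n s_bd(2) unfolding y_def by linarith
    ultimately have "real (card I) + 2 * (y + 2) \<le> 6 * real n" by argo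
    then have "(real (card I) + 2 * (y + 2)) * (1 / real n ^ 4) \<le> 6 * real n * (1 / real n ^ 4)"
      by (intro mult_right_mono) auto
    also have "\<dots> = 6 / real n ^ 3"
    proof -
      have "6 * u * (1 / u ^ 4) = 6 / u ^ 3" if "u \<noteq> 0" for u :: real
        using that by (simp add: field_simps flip: power_Suc)
      then show ?thesis using n by simp
    qed
    finally have "(real (card I) + 2 * (y + 2)) * (1 / real n ^ 4) \<le> 6 / real n ^ 3" .
    moreover have "real (card {1, -1 :: int}) = 2" by simp
    moreover have "a * b + 2 * (c * b) = (a + 2 * c) * b" for a b c :: real by (simp add: algebra_simps)
    ultimately have "real (card I) * (1 / real n ^ 4) + real (card {1, -1 :: int}) * ((y + 2) * (1 / real n ^ 4))
      \<le> 6 / real n ^ 3" by (simp only:)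
    moreover have "8 / real n ^ 3 + 6 / real n ^ 3 = 14 / real n ^ 3" by (simp add: add_divide_distrib[symmetric])
    ultimately show ?thesis unfolding e4 by linarith
  qed
  show ?thesis
    using fails_within_conj[OF inner fails_within_conj[OF excess far]] prob
    by (rule fails_within_mono) (use good in blast)
qed

theorem theorem1p2:
  shows "\<exists>a::real. a > 0 \<and>
    (AE \<omega> in explorers_law. \<forall>\<^sub>F n in sequentially.
       \<D> (real n - a * sqrt (ln (real n))) \<subseteq> idla_cluster \<omega> n \<and>
       idla_cluster \<omega> n \<subseteq> \<D> (real n + a * sqrt (ln (real n))))"
proof (intro exI conjI)
  show "(1000000000000 :: real) > 0" by simp
  let ?Q = "\<lambda>n \<omega>. \<D> (real n - 1000000000000 * sqrt (ln (real n))) \<subseteq> idla_cluster \<omega> n \<and>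
      idla_cluster \<omega> n \<subseteq> \<D> (real n + 1000000000000 * sqrt (ln (real n)))"
  have "eventually (\<lambda>n. 1 \<le> sqrt (ln (real n)) \<and> 1000000000000000 * (sqrt (ln (real n)))\<^sup>2 \<le> real n) sequentially"
    by (intro eventually_conj; real_asymp)
  then obtain n0 where n0: "\<And>n. n \<ge> n0 \<Longrightarrow> 1 \<le> sqrt (ln (real n)) \<and> 1000000000000000 * (sqrt (ln (real n)))\<^sup>2 \<le> real n"
    unfolding eventually_sequentially by blast
  have "\<forall>n. \<exists>E. E \<in> sets explorers_law \<and> measure explorers_law E \<le> 14 / real n ^ 3 \<and>
      (n \<ge> n0 \<longrightarrow> (\<forall>\<omega>. (\<forall>k. proper_path (\<omega> k)) \<longrightarrow> \<omega> \<notin> E \<longrightarrow> ?Q n \<omega>))"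
  proof
    fix n
    show "\<exists>E. E \<in> sets explorers_law \<and> measure explorers_law E \<le> 14 / real n ^ 3 \<and>
      (n \<ge> n0 \<longrightarrow> (\<forall>\<omega>. (\<forall>k. proper_path (\<omega> k)) \<longrightarrow> \<omega> \<notin> E \<longrightarrow> ?Q n \<omega>))"
    proof (cases "n \<ge> n0")
      case True
      then show ?thesis using finite_clusters_at_scale[OF refl, of n] n0 unfolding fails_within_def by blast
    next
      case False
      then show ?thesis by (intro exI[of _ "{}"]) auto
    qed
  qed
  then obtain E where E: "\<And>n. E n \<in> sets explorers_law" "\<And>n. measure explorers_law (E n) \<le> 14 / real n ^ 3"
    "\<And>n \<omega>. n \<ge> n0 \<Longrightarrow> \<forall>k. proper_path (\<omega> k) \<Longrightarrow> \<omega> \<notin> E n \<Longrightarrow> ?Q n \<omega>"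
    by metis
  have "summable (\<lambda>n. 14 * (1 / real n ^ 3))"
    by (intro summable_mult) (use inverse_power_summable[of 3, where 'a = real] in \<open>simp add: inverse_eq_divide\<close>)
  then have "summable (\<lambda>n. measure explorers_law (E n))"
    by (rule summable_comparison_test_ev[rotated]) (use E(2) in auto)
  then have "AE \<omega> in explorers_law. eventually (\<lambda>n. \<omega> \<in> space explorers_law - E n) sequentially"
    using E(1) by (intro borel_cantelli_AE1) (auto simp: EP.emeasure_eq_measure)
  with AE_proper_explorers show "AE \<omega> in explorers_law. \<forall>\<^sub>F n in sequentially. ?Q n \<omega>"
  proof eventually_elim
    case (elim \<omega>)
    from elim(2) eventually_ge_at_top[of n0] show ?case
      by eventually_elim (use elim(1) E(3) in auto)
  qed
qed

end
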